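(* For $n\ge1$ and a partition $\alpha\vdash n$, let $H_\alpha$ be the number of tuples $(\tau_1,\dots,\tau_r)$ of transpositions in $S_n$, with $r=n+l(\alpha)-2$, such that $\tau_1\cdots\tau_r=\pi$ for a fixed permutation $\pi$ of cycle type $\alpha$ and the group $\langle\tau_1,\dots,\tau_r\rangle$ acts transitively on $\{1,\dots,n\}$. Define the formal power series $$\widehat{H}=\sum_{n\ge1}\sum_{\alpha\vdash n}H_\alpha\,\frac{z^n}{n!}\,\frac{|\mathcal{C}_\alpha|}{(n+l(\alpha)-2)!}\,p_\alpha\,u^{l(\alpha)}.$$ Then $$z\frac{\partial}{\partial z}\widehat{H}=z\frac{\partial}{\partial z}\,u\frac{\partial}{\partial u}\widehat{H}-\frac12\left(\left(z\frac{\partial}{\partial z}\right)^2\widehat{H}\right)^2.$$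
   Context: A partition $\alpha=(\alpha_1,\dots,\alpha_k)$ of $n$ (written $\alpha\vdash n$) has $l(\alpha)=k$ parts; $p_\alpha=p_{\alpha_1}\cdots p_{\alpha_k}$ where $p_1,p_2,\dots$ are indeterminates; $\mathcal{C}_\alpha\subseteq S_n$ is the conjugacy class of permutations of cycle type $\alpha$, so $|\mathcal{C}_\alpha|=n!/\prod_{i\ge1}i^{d_i}d_i!$ if $\alpha$ has $d_i$ parts equal to $i$. $z,u,p_1,p_2,\dots$ are independent indeterminates. It is known (Goulden–Jackson) that $H_\alpha=n^{l(\alpha)-3}(n+l(\alpha)-2)!\prod_{i\ge1}\left(\frac{i^i}{(i-1)!}\right)^{d_i}$. *)

theory Defs
  imports
    "HOL-Computational_Algebra.Formal_Power_Series"
    "HOL-Library.Poly_Mapping"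
    "HOL-Library.Multiset"
    "HOL-Combinatorics.Orbits"
    "HOL-Algebra.Sym_Groups"
begin

subsection \<open>Partitions and cycle types\<close>

definition partitions_of :: "nat \<Rightarrow> nat multiset set" where
  "partitions_of n = {\<alpha>. 0 \<notin># \<alpha> \<and> sum_mset \<alpha> = n}"

text \<open>Orbits are collected in a set before being mapped to their sizes, so each cycle
  (fixed points included) contributes exactly one part.\<close>

definition cycle_type :: "nat \<Rightarrow> (nat \<Rightarrow> nat) \<Rightarrow> nat multiset" where
  "cycle_type n \<pi> = image_mset card (mset_set (orbit \<pi> ` {1..n}))"

definition conj_class :: "nat \<Rightarrow> nat multiset \<Rightarrow> (nat \<Rightarrow> nat) set" where
  "conj_class n \<alpha> = {\<pi>. \<pi> permutes {1..n} \<and> cycle_type n \<pi> = \<alpha>}"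


subsection \<open>Minimal transitive factorizations\<close>

definition transpositions :: "nat \<Rightarrow> (nat \<Rightarrow> nat) set" where
  "transpositions n =
     {Transposition.transpose i j | i j. i \<in> {1..n} \<and> j \<in> {1..n} \<and> i \<noteq> j}"

definition generates_transitive :: "nat \<Rightarrow> (nat \<Rightarrow> nat) list \<Rightarrow> bool" where
  "generates_transitive n ts \<longleftrightarrow>
     (\<forall>i\<in>{1..n}. \<forall>j\<in>{1..n}. \<exists>g\<in>generate (sym_group n) (set ts). g i = j)"

text \<open>The truncated subtraction in the length is harmless: it is only used for
  nonempty \<open>\<alpha>\<close> and \<open>n \<ge> 1\<close>.\<close>

definition min_trans_factorizations ::
    "nat \<Rightarrow> nat multiset \<Rightarrow> (nat \<Rightarrow> nat) \<Rightarrow> (nat \<Rightarrow> nat) list set" where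
  "min_trans_factorizations n \<alpha> \<pi> =
     {ts. length ts = n + size \<alpha> - 2 \<and> set ts \<subseteq> transpositions n \<and>
          foldr (\<circ>) ts id = \<pi> \<and> generates_transitive n ts}"


subsection \<open>The generating series\<close>

text \<open>The series lives in \<open>\<rat>[p\<^sub>0, p\<^sub>1, \<dots>][[u]][[z]]\<close>, a subring of the ring of formal power
  series in all the indeterminates: the outer series variable is \<open>z\<close>, the inner one is \<open>u\<close>,
  and a monomial in the \<open>p\<^sub>i\<close> is a finitely supported exponent function (\<open>p\<^sub>0\<close> is unused).
  Polynomials in the \<open>p\<^sub>i\<close> suffice because there are only finitely many partitions of each \<open>n\<close>.\<close>

type_synonym p_poly = "(nat \<Rightarrow>\<^sub>0 nat) \<Rightarrow>\<^sub>0 rat"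
type_synonym zup_series = "p_poly fps fps"

definition p_var :: "nat \<Rightarrow> p_poly" where
  "p_var i = Poly_Mapping.single (Poly_Mapping.single i 1) 1"

definition p_prod :: "nat multiset \<Rightarrow> p_poly" where
  "p_prod \<alpha> = (\<Prod>i\<in>#\<alpha>. p_var i)"

definition p_const :: "rat \<Rightarrow> p_poly" where
  "p_const c = Poly_Mapping.single 0 c"

definition zup_const :: "rat \<Rightarrow> zup_series" where
  "zup_const c = fps_const (fps_const (p_const c))"

definition z_D :: "zup_series \<Rightarrow> zup_series" where
  "z_D F = fps_X * fps_deriv F"

definition u_D :: "zup_series \<Rightarrow> zup_series" where
  "u_D F = Abs_fps (\<lambda>n. fps_X * fps_deriv (fps_nth F n))"

text \<open>The argument \<open>H n \<alpha>\<close> is the number written \<open>H\<^sub>\<alpha>\<close> for a partition \<open>\<alpha>\<close> of \<open>n\<close>.\<close>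

definition H_series :: "(nat \<Rightarrow> nat multiset \<Rightarrow> nat) \<Rightarrow> zup_series" where
  "H_series H = Abs_fps (\<lambda>n. if n = 0 then 0 else
     (\<Sum>\<alpha>\<in>partitions_of n.
        fps_const (p_const (of_nat (H n \<alpha>) * (1 / fact n) *
            (of_nat (card (conj_class n \<alpha>)) / fact (n + size \<alpha> - 2))) * p_prod \<alpha>)
        * fps_X ^ size \<alpha>))"

end

theory Submission
  imports Defs
begin

text \<open>
  Removing the first transposition of a transitive factorization of \<open>\<pi>\<close> either joins two
  cycles of \<open>\<pi>\<close> and leaves a transitive factorization, or cuts a cycle and leaves a
  shuffle of two transitive factorizations on complementary unions of cycles. By induction on the
  length, Hurwitz's multivariate Abel identity shows that the resulting recurrence is solved by the
  Goulden--Jackson formula. Up to constants, the coefficient of \<open>z\<^sup>n\<close> in the series is then a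
  sum over all permutations of \<open>n\<close> points with weight \<open>n\<^bsup>l - 3\<^esup>\<close> times a
  product over the \<open>l\<close> cycles. Multiplying series means distributing the cycles \<open>K\<close>
  over two parts, so that the differential equation reduces, permutation by permutation, to the
  identity \<open>\<Sum> x\<^sub>S\<^bsup>|S| - 1\<^esup> x\<^sub>T\<^bsup>|T| - 1\<^esup> = 2 (l - 1) x\<^sub>K\<^bsup>l - 2\<^esup>\<close>
  over all splittings \<open>K = S \<union> T\<close> into nonempty parts, which counts trees on \<open>K\<close>
  with a distinguished oriented edge.
\<close>

subsection \<open>Sums over subsets and the Hurwitz--Abel identities\<close>

text \<open>The recurrence passes from a permutation to its restrictions, so everything is stated
  for arbitrary finite ground sets, and cycles are sets of points: cycles of equal length then cause
  no multiplicities. The exponent l - 3 dictates the identities that are needed. Cutting a cycle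
  leaves two parts, each made of one half of the cut cycle and a set S of other cycles; such a part
  has |S| + 1 cycles and contributes its size to the power |S| - 2. Hurwitz's identity has the
  exponents |S| - 1 and |T| for its two parts S and T, so they are lowered one at a time, and
  correction sums appear on the way. These do not vanish; they cancel against the joins, because the
  weights i^i / i! have an addition formula whose extra sums are exactly the corrections. Negative
  exponents are written as quotients. With positive sizes a denominator vanishes only for an empty
  part, and there 1 / 0 = 0 removes a summand that should be absent. In the differential equation
  itself two Euler derivatives raise l - 3 to l - 1, so one splitting identity without corrections
  is enough there.\<close>

lemma sum_Pow_insert:
  assumes "finite A" "k \<notin> A"
  shows "(\<Sum>S\<in>Pow (insert k A). f S) = (\<Sum>S\<in>Pow A. f S + f (insert k S))"
proof -
  have "inj_on (insert k) (Pow A)"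
    using assms(2) by (auto simp: inj_on_def)
  moreover have "Pow A \<inter> insert k ` Pow A = {}"
    using assms(2) by auto
  ultimately show ?thesis
    using assms(1) by (simp add: Pow_insert sum.union_disjoint sum.reindex sum.distrib)
qed

lemma sum_Pow_compl:
  "(\<Sum>S\<in>Pow A. f S (A - S)) = (\<Sum>S\<in>Pow A. f (A - S) S)"
  by (rule sum.reindex_bij_witness[of _ "\<lambda>S. A - S" "\<lambda>S. A - S"]) (auto simp: double_diff)

lemma sum_Pow_member:
  assumes "finite A"
  shows "(\<Sum>S\<in>Pow A. \<Sum>k\<in>S. f k S) = (\<Sum>k\<in>A. \<Sum>S\<in>Pow (A - {k}). f k (insert k S))"
proof -
  have "(\<Sum>S\<in>Pow A. \<Sum>k\<in>S. f k S) = (\<Sum>S\<in>Pow A. \<Sum>k | k \<in> A \<and> k \<in> S. f k S)"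
    by (intro sum.cong) auto
  also have "\<dots> = (\<Sum>k\<in>A. \<Sum>S | S \<in> Pow A \<and> k \<in> S. f k S)"
    using assms by (intro sum.swap_restrict) auto
  also have "\<dots> = (\<Sum>k\<in>A. \<Sum>S\<in>Pow (A - {k}). f k (insert k S))"
  proof (rule sum.cong[OF refl])
    fix k
    assume "k \<in> A"
    then show "(\<Sum>S | S \<in> Pow A \<and> k \<in> S. f k S) = (\<Sum>S\<in>Pow (A - {k}). f k (insert k S))"
      by (intro sum.reindex_bij_witness[of _ "insert k" "\<lambda>S. S - {k}"]) (auto simp: insert_absorb)
  qed
  finally show ?thesis .
qed

lemma sum_Pow_nested:
  assumes "finite A"
  shows "(\<Sum>S\<in>Pow A. \<Sum>J\<in>Pow (A - S). f S J) = (\<Sum>J\<in>Pow A. \<Sum>S\<in>Pow (A - J). f S J)"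
proof -
  have "(\<Sum>S\<in>Pow A. \<Sum>J\<in>Pow (A - S). f S J)
      = (\<Sum>S\<in>Pow A. \<Sum>J | J \<in> Pow A \<and> S \<inter> J = {}. f S J)"
    by (intro sum.cong) auto
  also have "\<dots> = (\<Sum>J\<in>Pow A. \<Sum>S | S \<in> Pow A \<and> S \<inter> J = {}. f S J)"
    using assms by (intro sum.swap_restrict) auto
  also have "\<dots> = (\<Sum>J\<in>Pow A. \<Sum>S\<in>Pow (A - J). f S J)"
    by (intro sum.cong) auto
  finally show ?thesis .
qed

text \<open>Up to sign this is an iterated finite difference, with one step \<open>x k\<close> for
  each k in A, of a polynomial of degree m in y. Every difference lowers the degree, so more than m
  of them give 0.\<close>

lemma alternating_sum_Pow_power_eq_0:
  fixes x :: "'a \<Rightarrow> 'b::comm_ring_1"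
  assumes "finite A" "m < card A"
  shows "(\<Sum>S\<in>Pow A. (-1) ^ card S * (y + sum x S) ^ m) = 0"
  using assms
proof (induction A arbitrary: m rule: finite_induct)
  case (insert k A)
  \<comment> \<open>The top term \<open>z ^ m\<close> is kept apart: it cancels between S and
    \<open>insert k S\<close>, which leaves only degrees j < m for the induction hypothesis.\<close>
  have *: "(x k + z) ^ m = (\<Sum>j<m. of_nat (m choose j) * x k ^ (m - j) * z ^ j) + z ^ m" for z
  proof -
    have "(z + x k) ^ m = (\<Sum>j<m. of_nat (m choose j) * z ^ j * x k ^ (m - j)) + z ^ m"
      unfolding binomial_ring lessThan_Suc_atMost[symmetric] sum.lessThan_Suc by simp
    then show ?thesis
      by (simp only: mult_ac add.commute[of "x k"])
  qed
  have "(\<Sum>S\<in>Pow (insert k A). (-1) ^ card S * (y + sum x S) ^ m)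
     = (\<Sum>S\<in>Pow A. (-1) ^ card S * (y + sum x S) ^ m
          + (-1) ^ Suc (card S) * (x k + (y + sum x S)) ^ m)"
    unfolding sum_Pow_insert[OF insert.hyps(1,2)]
  proof (rule sum.cong[OF refl])
    fix S
    assume "S \<in> Pow A"
    then have "finite S" "k \<notin> S"
      using insert.hyps finite_subset[of S A] by auto
    then show "(-1) ^ card S * (y + sum x S) ^ m + (-1) ^ card (insert k S) * (y + sum x (insert k S)) ^ m
        = (-1) ^ card S * (y + sum x S) ^ m + (-1) ^ Suc (card S) * (x k + (y + sum x S)) ^ m"
      by (simp add: add.left_commute)
  qed
  also have "\<dots> = (\<Sum>S\<in>Pow A. \<Sum>j<m. - of_nat (m choose j) * x k ^ (m - j) *
        ((-1) ^ card S * (y + sum x S) ^ j))"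
    unfolding * by (intro sum.cong refl) (simp add: distrib_left sum_distrib_left sum_negf mult_ac)
  also have "\<dots> = (\<Sum>j<m. - of_nat (m choose j) * x k ^ (m - j) *
        (\<Sum>S\<in>Pow A. (-1) ^ card S * (y + sum x S) ^ j))"
    by (subst sum.swap) (simp only: sum_distrib_left)
  also have "\<dots> = 0"
    using insert by (intro sum.neutral) auto
  finally show ?case .
qed auto

text \<open>The binomial theorem is indexed by subsets J instead of exponents so that its sum can be
  exchanged with an outer sum over S by \<open>sum_Pow_nested\<close>.\<close>

lemma power_add_eq_sum_Pow:
  fixes a b :: "'b::comm_semiring_1"
  assumes "finite A"
  shows "(a + b) ^ card A = (\<Sum>J\<in>Pow A. a ^ card J * b ^ card (A - J))"
  using prod_add[OF assms, of "\<lambda>_. a" "\<lambda>_. b"] by simp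

text \<open>A power \<open>y ^ (card S - 1)\<close> is written
  \<open>y ^ card S / y\<close>, as the exponent may be negative. Expanding the second factor around the
  total \<open>p + q + sum x A\<close> leaves alternating sums that vanish by
  \<open>alternating_sum_Pow_power_eq_0\<close> except for the top term.\<close>

lemma Hurwitz_identity:
  fixes x :: "'a \<Rightarrow> 'b::linordered_field"
  assumes "finite A" "p > 0" "\<And>k. k \<in> A \<Longrightarrow> x k \<ge> 0"
  shows "(\<Sum>S\<in>Pow A. p * ((p + sum x S) ^ card S / (p + sum x S))
            * (q + sum x (A - S)) ^ card (A - S)) = (p + q + sum x A) ^ card A"
proof -
  define s where "s = p + q + sum x A"
  have pos: "p + sum x S > 0" if "S \<subseteq> A" for S
    using assms that by (intro add_pos_nonneg sum_nonneg) auto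
  have fin: "finite S" if "S \<subseteq> A" for S
    using that assms(1) finite_subset by blast
  have split: "sum x A = sum x S + sum x (A - S)" if "S \<subseteq> A" for S
    using sum.subset_diff[OF that assms(1), of x] by simp
  have inner: "(\<Sum>S\<in>Pow (A - J). p * ((p + sum x S) ^ card S / (p + sum x S))
            * (s ^ card J * (- (p + sum x S)) ^ card (A - S - J))) = (if J = A then s ^ card A else 0)"
    if J: "J \<subseteq> A" for J
  proof (cases "J = A")
    case True
    then show ?thesis using assms(2) by simp
  next
    case False
    define B where "B = A - J"
    have B: "finite B" "card B > 0" "B \<subseteq> A"
      using J False assms(1) fin by (auto simp: B_def card_gt_0_iff)
    have "(\<Sum>S\<in>Pow B. p * ((p + sum x S) ^ card S / (p + sum x S))
            * (s ^ card J * (- (p + sum x S)) ^ card (A - S - J)))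
        = (\<Sum>S\<in>Pow B. p * s ^ card J * (-1) ^ card B *
             ((-1) ^ card S * (p + sum x S) ^ (card B - 1)))"
    proof (intro sum.cong refl)
      fix S assume "S \<in> Pow B"
      then have S: "S \<subseteq> B" "S \<subseteq> A" and "p + sum x S > 0"
        using pos B by auto
      have le: "card S \<le> card B" using S B card_mono by blast
      have c: "card (A - S - J) = card B - card S"
        using S B(1) by (subst card_Diff_subset[symmetric]) (auto simp: B_def finite_subset intro!: arg_cong[of _ _ card])
      have e: "(-1::'b) ^ (card B - card S) = (-1) ^ card B * (-1) ^ card S"
        using le by (simp add: power_diff flip: power_mult_distrib) (simp add: minus_one_power_iff)
      \<comment> \<open>The exponents |S| - 1 and |B| - |S| add up to |B| - 1 whatever S is, one
        less than the alternating sum over B would need in order to survive.\<close>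
      have "(p + sum x S) ^ card S * (p + sum x S) ^ (card B - card S)
          = (p + sum x S) * (p + sum x S) ^ (card B - 1)"
        using le B(2) by (simp add: power_add[symmetric] flip: power_Suc)
      then show "p * ((p + sum x S) ^ card S / (p + sum x S))
            * (s ^ card J * (- (p + sum x S)) ^ card (A - S - J))
          = p * s ^ card J * (-1) ^ card B * ((-1) ^ card S * (p + sum x S) ^ (card B - 1))"
        using \<open>p + sum x S > 0\<close> unfolding c
        unfolding power_minus[of "p + sum x S"] e
        by (simp add: divide_simps)
    qed
    also have "\<dots> = 0"
      using alternating_sum_Pow_power_eq_0[of B "card B - 1" p x] B
      by (simp add: sum_distrib_left[symmetric])
    finally show ?thesis using False by (simp add: B_def)
  qed
  have "(\<Sum>S\<in>Pow A. p * ((p + sum x S) ^ card S / (p + sum x S))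
            * (q + sum x (A - S)) ^ card (A - S))
      = (\<Sum>S\<in>Pow A. \<Sum>J\<in>Pow (A - S). p * ((p + sum x S) ^ card S / (p + sum x S))
            * (s ^ card J * (- (p + sum x S)) ^ card (A - S - J)))"
  proof (intro sum.cong refl)
    fix S assume "S \<in> Pow A"
    then have "q + sum x (A - S) = s + - (p + sum x S)"
      using split by (simp add: s_def)
    then show "p * ((p + sum x S) ^ card S / (p + sum x S)) * (q + sum x (A - S)) ^ card (A - S)
      = (\<Sum>J\<in>Pow (A - S). p * ((p + sum x S) ^ card S / (p + sum x S))
            * (s ^ card J * (- (p + sum x S)) ^ card (A - S - J)))"
      by (simp only: power_add_eq_sum_Pow[of "A - S", OF finite_Diff[OF assms(1)]] sum_distrib_left)
  qed
  also have "\<dots> = (\<Sum>J\<in>Pow A. if J = A then s ^ card A else 0)"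
    by (subst sum_Pow_nested[OF assms(1)]) (intro sum.cong refl inner, auto)
  also have "\<dots> = s ^ card A"
    using assms(1) by simp
  finally show ?thesis by (simp add: s_def)
qed

text \<open>Meant for sums in which a factor \<open>sum x (A - S)\<close> has been expanded: the
  marked k is chosen before S and can then be merged into the parameter attached to the
  complement.\<close>

lemma sum_Pow_compl_member:
  assumes "finite A"
  shows "(\<Sum>S\<in>Pow A. \<Sum>k\<in>A - S. f k S (A - S))
       = (\<Sum>k\<in>A. \<Sum>S\<in>Pow (A - {k}). f k S (insert k (A - {k} - S)))"
proof -
  have "(\<Sum>S\<in>Pow A. \<Sum>k\<in>A - S. f k S (A - S)) = (\<Sum>S\<in>Pow A. \<Sum>k\<in>S. f k (A - S) S)"
    by (rule sum_Pow_compl[of "\<lambda>S T. \<Sum>k\<in>T. f k S T"])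
  also have "\<dots> = (\<Sum>k\<in>A. \<Sum>T\<in>Pow (A - {k}). f k (A - {k} - T) (insert k T))"
    unfolding sum_Pow_member[OF assms]
    by (intro sum.cong refl arg_cong2[of _ _ _ _ "f _"]) auto
  also have "\<dots> = (\<Sum>k\<in>A. \<Sum>S\<in>Pow (A - {k}). f k S (insert k (A - {k} - S)))"
    by (rule sum.cong[OF refl], rule sum_Pow_compl[of "\<lambda>T S. f _ S (insert _ T)"])
  finally show ?thesis .
qed

lemma sum_mult_mult:
  fixes c :: "'b::semiring_0"
  shows "(\<Sum>k\<in>T. a * (f k * c)) = a * (sum f T * c)"
  by (simp only: sum_distrib_left[symmetric] sum_distrib_right[symmetric])

context
  fixes x :: "'a \<Rightarrow> 'b::linordered_field" and A :: "'a set"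
  assumes fin: "finite A" and x_pos: "\<And>k. k \<in> A \<Longrightarrow> x k > 0"
begin

lemma sum_subset_nonneg: "S \<subseteq> A \<Longrightarrow> sum x S \<ge> 0"
  using x_pos by (intro sum_nonneg) (auto intro: less_imp_le)

lemma Hurwitz_remove:
  assumes "k \<in> A" "p > 0"
  shows "(\<Sum>S\<in>Pow (A - {k}). p * ((p + sum x S) ^ card S / (p + sum x S))
            * (q + sum x (A - {k} - S)) ^ card (A - {k} - S)) = (p + q + sum x (A - {k})) ^ card (A - {k})"
  using assms fin x_pos by (intro Hurwitz_identity) (auto intro: less_imp_le)

lemma sum_remove: "k \<in> A \<Longrightarrow> sum x A = x k + sum x (A - {k})"
  using fin by (simp add: sum.remove)

lemma insert_compl:
  assumes "S \<subseteq> A - {k}" "k \<in> A"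
  shows "card (insert k (A - {k} - S)) = Suc (card (A - {k} - S))"
    and "sum x (insert k (A - {k} - S)) = x k + sum x (A - {k} - S)"
  using fin assms by auto

lemma power_card_remove:
  assumes "k \<in> A" "y \<noteq> (0::'b)"
  shows "y ^ card (A - {k}) = y ^ card A / y"
proof -
  have "y ^ card A = y * y ^ card (A - {k})"
    unfolding card.remove[OF fin assms(1)] power_Suc ..
  then show ?thesis using assms(2) by simp
qed

text \<open>Write y for \<open>q + sum x (A - S)\<close> and m for \<open>card (A - S)\<close>. Then
  q y^(m-1) = y^m - (y - q) y^(m-1). The first term is Hurwitz's identity. Expanding y - q over a
  marked k turns the second into Hurwitz's identity on A - {k} with q + \<open>x k\<close> in place
  of q: y is unchanged, and m - 1 is the size of the new complement.\<close>

lemma Hurwitz_identity_symmetric: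
  assumes "p > 0" "q > 0"
  shows "(\<Sum>S\<in>Pow A. (p + sum x S) ^ card S / (p + sum x S)
            * ((q + sum x (A - S)) ^ card (A - S) / (q + sum x (A - S))))
       = (p + q) / (p * q) * ((p + q + sum x A) ^ card A / (p + q + sum x A))"
proof -
  define N where "N = p + q + sum x A"
  define g where "g S = p * ((p + sum x S) ^ card S / (p + sum x S))" for S
  have N: "N > 0"
    using assms sum_subset_nonneg[of A] by (simp add: N_def)
  have "(\<Sum>S\<in>Pow A. g S * (q * ((q + sum x (A - S)) ^ card (A - S) / (q + sum x (A - S)))))
      = (\<Sum>S\<in>Pow A. g S * (q + sum x (A - S)) ^ card (A - S)
          - (\<Sum>k\<in>A - S. g S * (x k * ((q + sum x (A - S)) ^ card (A - S) / (q + sum x (A - S))))))"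
  proof (rule sum.cong[OF refl])
    fix S assume "S \<in> Pow A"
    define y where "y = q + sum x (A - S)"
    have "y > 0"
      using assms sum_subset_nonneg[of "A - S"] by (auto simp: y_def)
    then have "q * (y ^ card (A - S) / y) = y ^ card (A - S) - sum x (A - S) * (y ^ card (A - S) / y)"
      by (simp add: y_def field_simps)
    then show "g S * (q * ((q + sum x (A - S)) ^ card (A - S) / (q + sum x (A - S))))
      = g S * (q + sum x (A - S)) ^ card (A - S)
          - (\<Sum>k\<in>A - S. g S * (x k * ((q + sum x (A - S)) ^ card (A - S) / (q + sum x (A - S)))))"
      unfolding y_def[symmetric] sum_mult_mult by (simp only: right_diff_distrib)
  qed
  also have "\<dots> = N ^ card A - (\<Sum>S\<in>Pow A. \<Sum>k\<in>A - S.
      g S * (x k * ((q + sum x (A - S)) ^ card (A - S) / (q + sum x (A - S)))))"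
    unfolding sum_subtractf g_def N_def using fin assms(1) x_pos
    by (subst Hurwitz_identity) (auto intro: less_imp_le)
  also have "(\<Sum>S\<in>Pow A. \<Sum>k\<in>A - S.
      g S * (x k * ((q + sum x (A - S)) ^ card (A - S) / (q + sum x (A - S)))))
    = (\<Sum>k\<in>A. \<Sum>S\<in>Pow (A - {k}). x k * (g S * (q + x k + sum x (A - {k} - S)) ^ card (A - {k} - S)))"
    unfolding sum_Pow_compl_member[OF fin, of "\<lambda>k S T. g S * (x k * ((q + sum x T) ^ card T / (q + sum x T)))"]
  proof (intro sum.cong refl)
    fix k S assume kS: "k \<in> A" "S \<in> Pow (A - {k})"
    have "q + x k + sum x (A - {k} - S) > 0"
      using assms(2) x_pos[OF kS(1)] sum_subset_nonneg[of "A - {k} - S"] by (auto intro!: add_pos_nonneg)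
    with kS show "g S * (x k * ((q + sum x (insert k (A - {k} - S))) ^ card (insert k (A - {k} - S))
        / (q + sum x (insert k (A - {k} - S)))))
        = x k * (g S * (q + x k + sum x (A - {k} - S)) ^ card (A - {k} - S))"
      by (simp add: insert_compl add.assoc[symmetric])
  qed
  also have "\<dots> = (\<Sum>k\<in>A. x k * (N ^ card A / N))"
  proof (rule sum.cong[OF refl])
    fix k assume k: "k \<in> A"
    have "p + (q + x k) + sum x (A - {k}) = N"
      using sum_remove[OF k] by (simp add: N_def)
    then show "(\<Sum>S\<in>Pow (A - {k}). x k * (g S * (q + x k + sum x (A - {k} - S)) ^ card (A - {k} - S)))
        = x k * (N ^ card A / N)"
      using Hurwitz_remove[OF k assms(1), of "q + x k"] power_card_remove[OF k, of N] N
      unfolding g_def sum_distrib_left[symmetric] by simp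
  qed
  \<comment> \<open>Here N - \<open>sum x A\<close> is p + q.\<close>
  also have "N ^ card A - \<dots> = (p + q) * (N ^ card A / N)"
    using N unfolding sum_distrib_right[symmetric] by (simp add: N_def field_simps)
  finally have "p * q * (\<Sum>S\<in>Pow A. (p + sum x S) ^ card S / (p + sum x S)
      * ((q + sum x (A - S)) ^ card (A - S) / (q + sum x (A - S)))) = (p + q) * (N ^ card A / N)"
    (is "_ * ?X = _ * ?Z") by (simp only: g_def sum_distrib_left mult_ac)
  then have "?X = (p + q) / (p * q) * ?Z"
  proof -
    have "?X = p * q * ?X / (p * q)"
      using assms by (intro nonzero_mult_div_cancel_left[symmetric]) simp
    also have "\<dots> = (p + q) / (p * q) * ?Z"
      unfolding \<open>p * q * ?X = (p + q) * ?Z\<close> by simp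
    finally show ?thesis .
  qed
  then show ?thesis
    by (simp only: N_def)
qed

text \<open>The summand for \<open>S = A\<close> vanishes because of \<open>1 / 0 = 0\<close>; likewise the
  summands for \<open>S = {}\<close> and \<open>S = A\<close> in \<open>Cayley_split_identity\<close> below.\<close>

lemma Hurwitz_identity_zero:
  assumes "p > 0"
  shows "(\<Sum>S\<in>Pow A. (p + sum x S) ^ card S * (sum x (A - S) ^ card (A - S) / sum x (A - S)))
       = of_nat (card A) * ((p + sum x A) ^ card A / (p + sum x A))"
proof -
  define N where "N = p + sum x A"
  have N: "N > 0"
    using assms sum_subset_nonneg[of A] by (simp add: N_def)
  \<comment> \<open>Now the complement has no parameter q. One factor \<open>sum x (A - S)\<close>
    is borrowed from the power and expanded over a marked k, and \<open>x k\<close> then serves as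
    the positive parameter that Hurwitz's identity requires.\<close>
  have "(\<Sum>S\<in>Pow A. (p + sum x S) ^ card S * (sum x (A - S) ^ card (A - S) / sum x (A - S)))
      = (\<Sum>S\<in>Pow A. \<Sum>k\<in>A - S. (p + sum x S) ^ card S * (x k * (sum x (A - S) ^ card (A - S) / (sum x (A - S))\<^sup>2)))"
    unfolding sum_mult_mult by (intro sum.cong refl) (simp add: power2_eq_square)
  also have "\<dots> = (\<Sum>k\<in>A. \<Sum>S\<in>Pow (A - {k}).
       x k * ((x k + sum x (A - {k} - S)) ^ card (A - {k} - S) / (x k + sum x (A - {k} - S)))
         * (p + sum x S) ^ card S)"
    unfolding sum_Pow_compl_member[OF fin, of "\<lambda>k S T. (p + sum x S) ^ card S * (x k * (sum x T ^ card T / (sum x T)\<^sup>2))"]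
  proof (intro sum.cong refl)
    fix k S assume kS: "k \<in> A" "S \<in> Pow (A - {k})"
    have "x k + sum x (A - {k} - S) > 0"
      using x_pos[OF kS(1)] sum_subset_nonneg[of "A - {k} - S"] by (auto intro!: add_pos_nonneg)
    with kS show "(p + sum x S) ^ card S * (x k * (sum x (insert k (A - {k} - S)) ^ card (insert k (A - {k} - S))
        / (sum x (insert k (A - {k} - S)))\<^sup>2))
      = x k * ((x k + sum x (A - {k} - S)) ^ card (A - {k} - S) / (x k + sum x (A - {k} - S)))
         * (p + sum x S) ^ card S"
      by (simp add: insert_compl power2_eq_square)
  qed
  also have "\<dots> = (\<Sum>k\<in>A. N ^ card A / N)"
  proof (rule sum.cong[OF refl])
    fix k assume k: "k \<in> A"
    have "x k + p + sum x (A - {k}) = N"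
      using sum_remove[OF k] by (simp add: N_def)
    then show "(\<Sum>S\<in>Pow (A - {k}).
       x k * ((x k + sum x (A - {k} - S)) ^ card (A - {k} - S) / (x k + sum x (A - {k} - S)))
         * (p + sum x S) ^ card S) = N ^ card A / N"
      using Hurwitz_remove[OF k x_pos[OF k], of p] power_card_remove[OF k, of N] N
        sum_Pow_compl[of "\<lambda>T S. x k * ((x k + sum x T) ^ card T / (x k + sum x T))
         * (p + sum x S) ^ card S" "A - {k}"]
      by simp
  qed
  finally show ?thesis by (simp add: N_def)
qed

end

text \<open>The argument of \<open>Hurwitz_identity_symmetric\<close> again, with y^(m-2) in place
  of y^(m-1). Merging k into q now brings in the factor (p + q + \<open>x k\<close>) / (q +
  \<open>x k\<close>) of that identity, which varies with k; this is why a sum over k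
  remains.\<close>

lemma Hurwitz_cut_half:
  fixes x :: "'a \<Rightarrow> 'b::linordered_field"
  assumes fin: "finite A" and x_pos: "\<And>k. k \<in> A \<Longrightarrow> x k > 0" and pq: "p > 0" "q > 0"
  defines "N \<equiv> p + q + sum x A"
  shows "p * q * (\<Sum>S\<in>Pow A. (p + sum x S) ^ card S / (p + sum x S)
            * ((q + sum x (A - S)) ^ card (A - S) / (q + sum x (A - S))\<^sup>2))
       = (p + q) / q * (N ^ card A / N)
         - (\<Sum>k\<in>A. x k * (p + q + x k) / (q + x k) * (N ^ card A / N\<^sup>2))"
proof -
  define D where "D p S = (p + sum x S) ^ card S / (p + sum x S)" for p S
  define E where "E S = (q + sum x S) ^ card S / (q + sum x S)\<^sup>2" for S
  have nonneg: "S \<subseteq> A \<Longrightarrow> sum x S \<ge> 0" for S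
    using x_pos by (intro sum_nonneg) (auto intro: less_imp_le)
  have N: "N > 0"
    using pq nonneg[of A] by (simp add: N_def)
  have "q * (\<Sum>S\<in>Pow A. D p S * E (A - S))
      = (\<Sum>S\<in>Pow A. D p S * D q (A - S) - (\<Sum>k\<in>A - S. D p S * (x k * E (A - S))))"
    unfolding sum_distrib_left
  proof (rule sum.cong[OF refl])
    fix S assume "S \<in> Pow A"
    have "q + sum x (A - S) > 0"
      using pq nonneg[of "A - S"] by (auto intro!: add_pos_nonneg)
    then have "(q + sum x (A - S)) * E (A - S) = D q (A - S)"
      by (simp add: D_def E_def power2_eq_square)
    then have "q * E (A - S) = D q (A - S) - sum x (A - S) * E (A - S)"
      by (simp add: distrib_right eq_diff_eq)
    then show "q * (D p S * E (A - S))
        = D p S * D q (A - S) - (\<Sum>k\<in>A - S. D p S * (x k * E (A - S)))"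
      unfolding sum_mult_mult mult.left_commute[of q] by (simp only: right_diff_distrib)
  qed
  also have "\<dots> = (p + q) / (p * q) * (N ^ card A / N)
      - (\<Sum>S\<in>Pow A. \<Sum>k\<in>A - S. D p S * (x k * E (A - S)))"
    unfolding sum_subtractf N_def using Hurwitz_identity_symmetric[OF fin x_pos pq] by (simp add: D_def)
  also have "(\<Sum>S\<in>Pow A. \<Sum>k\<in>A - S. D p S * (x k * E (A - S)))
     = (\<Sum>k\<in>A. \<Sum>S\<in>Pow (A - {k}). x k * (D p S * D (q + x k) (A - {k} - S)))"
    unfolding sum_Pow_compl_member[OF fin, of "\<lambda>k S T. D p S * (x k * E T)"]
  proof (intro sum.cong refl)
    fix k S assume kS: "k \<in> A" "S \<in> Pow (A - {k})"
    have "q + x k + sum x (A - {k} - S) > 0"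
      using pq x_pos[OF kS(1)] nonneg[of "A - {k} - S"] by (auto intro!: add_pos_nonneg)
    with kS show "D p S * (x k * E (insert k (A - {k} - S)))
        = x k * (D p S * D (q + x k) (A - {k} - S))"
      by (simp add: insert_compl[OF fin x_pos] D_def E_def add.assoc[symmetric] power2_eq_square)
  qed
  also have "\<dots> = (\<Sum>k\<in>A. x k * ((p + q + x k) / (p * (q + x k)) * (N ^ card A / N\<^sup>2)))"
  proof (rule sum.cong[OF refl])
    fix k assume k: "k \<in> A"
    have s: "p + (q + x k) + sum x (A - {k}) = N"
      using sum_remove[OF fin x_pos k] by (simp add: N_def)
    have "q + x k > 0"
      using pq x_pos[OF k] by simp
    then have "(\<Sum>S\<in>Pow (A - {k}). D p S * D (q + x k) (A - {k} - S))
        = (p + (q + x k)) / (p * (q + x k)) * (N ^ card (A - {k}) / N)"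
      using Hurwitz_identity_symmetric[of "A - {k}" x p "q + x k"] fin x_pos pq
      unfolding D_def s by auto
    also have "N ^ card (A - {k}) / N = N ^ card A / N\<^sup>2"
      using power_card_remove[where y = N, OF fin x_pos k] N by (simp add: power2_eq_square)
    finally show "(\<Sum>S\<in>Pow (A - {k}). x k * (D p S * D (q + x k) (A - {k} - S)))
        = x k * ((p + q + x k) / (p * (q + x k)) * (N ^ card A / N\<^sup>2))"
      unfolding sum_distrib_left[symmetric] by (simp only: add.assoc)
  qed
  finally have "p * (q * (\<Sum>S\<in>Pow A. D p S * E (A - S)))
    = p * ((p + q) / (p * q) * (N ^ card A / N))
       - (\<Sum>k\<in>A. p * (x k * ((p + q + x k) / (p * (q + x k)) * (N ^ card A / N\<^sup>2))))"
    by (simp only: right_diff_distrib sum_distrib_left)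
  also have "p * ((p + q) / (p * q) * (N ^ card A / N)) = (p + q) / q * (N ^ card A / N)"
    using pq by simp
  also have "(\<Sum>k\<in>A. p * (x k * ((p + q + x k) / (p * (q + x k)) * (N ^ card A / N\<^sup>2))))
      = (\<Sum>k\<in>A. x k * (p + q + x k) / (q + x k) * (N ^ card A / N\<^sup>2))"
    using pq by (intro sum.cong refl) simp
  finally show ?thesis by (simp only: D_def E_def mult.assoc)
qed

text \<open>Both exponents are two below the number of elements, as they are for the two parts left
  by a cut. Since N is the sum of the two part sizes, multiplying by N raises one exponent or the
  other and leaves two instances of \<open>Hurwitz_cut_half\<close> with p and q exchanged.\<close>

lemma Hurwitz_cut_identity:
  fixes x :: "'a \<Rightarrow> 'b::linordered_field"
  assumes fin: "finite A" and x_pos: "\<And>k. k \<in> A \<Longrightarrow> x k > 0" and pq: "p > 0" "q > 0"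
  defines "N \<equiv> p + q + sum x A"
  shows "p * q * N * (\<Sum>S\<in>Pow A. (p + sum x S) ^ card S / (p + sum x S)\<^sup>2
            * ((q + sum x (A - S)) ^ card (A - S) / (q + sum x (A - S))\<^sup>2))
       = (p + q) * (1 / p + 1 / q) * (N ^ card A / N)
         - (\<Sum>k\<in>A. x k * (p + q + x k) * (1 / (p + x k) + 1 / (q + x k)) * (N ^ card A / N\<^sup>2))"
proof -
  define D where "D p S = (p + sum x S) ^ card S / (p + sum x S)" for p S
  define E where "E p S = (p + sum x S) ^ card S / (p + sum x S)\<^sup>2" for p S
  have nonneg: "S \<subseteq> A \<Longrightarrow> sum x S \<ge> 0" for S
    using x_pos by (intro sum_nonneg) (auto intro: less_imp_le)
  have DE: "D r S = (r + sum x S) * E r S" if "r > 0" "S \<subseteq> A" for r S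
  proof -
    have "r + sum x S > 0" using that nonneg[of S] by (auto intro!: add_pos_nonneg)
    then show ?thesis by (simp add: D_def E_def power2_eq_square)
  qed
  have "N * (\<Sum>S\<in>Pow A. E p S * E q (A - S))
     = (\<Sum>S\<in>Pow A. D p S * E q (A - S)) + (\<Sum>S\<in>Pow A. D q (A - S) * E p S)"
    unfolding sum_distrib_left sum.distrib[symmetric]
  proof (rule sum.cong[OF refl])
    fix S assume S: "S \<in> Pow A"
    then have "N = (p + sum x S) + (q + sum x (A - S))"
      using fin sum.subset_diff[of S A x] by (auto simp: N_def)
    moreover have "D p S = (p + sum x S) * E p S" "D q (A - S) = (q + sum x (A - S)) * E q (A - S)"
      using S pq by (auto intro!: DE)
    ultimately show "N * (E p S * E q (A - S)) = D p S * E q (A - S) + D q (A - S) * E p S"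
      by (simp add: algebra_simps)
  qed
  also have "(\<Sum>S\<in>Pow A. D q (A - S) * E p S) = (\<Sum>S\<in>Pow A. D q S * E p (A - S))"
    by (rule sum_Pow_compl[of "\<lambda>S T. D q T * E p S"])
  finally have "p * q * N * (\<Sum>S\<in>Pow A. E p S * E q (A - S))
     = p * q * (\<Sum>S\<in>Pow A. D p S * E q (A - S)) + q * p * (\<Sum>S\<in>Pow A. D q S * E p (A - S))"
    by (simp only: mult.assoc mult.commute[of q p] distrib_left)
  also have "\<dots> = ((p + q) / q * (N ^ card A / N) + (q + p) / p * (N ^ card A / N))
     - ((\<Sum>k\<in>A. x k * (p + q + x k) / (q + x k) * (N ^ card A / N\<^sup>2))
       + (\<Sum>k\<in>A. x k * (q + p + x k) / (p + x k) * (N ^ card A / N\<^sup>2)))"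
    using Hurwitz_cut_half[OF fin x_pos pq] Hurwitz_cut_half[OF fin x_pos pq(2,1)]
    by (simp add: D_def E_def N_def add.commute[of q p])
  also have "(p + q) / q * (N ^ card A / N) + (q + p) / p * (N ^ card A / N)
      = (p + q) * (1 / p + 1 / q) * (N ^ card A / N)"
    by (simp add: algebra_simps)
  also have "(\<Sum>k\<in>A. x k * (p + q + x k) / (q + x k) * (N ^ card A / N\<^sup>2))
       + (\<Sum>k\<in>A. x k * (q + p + x k) / (p + x k) * (N ^ card A / N\<^sup>2))
     = (\<Sum>k\<in>A. x k * (p + q + x k) * (1 / (p + x k) + 1 / (q + x k)) * (N ^ card A / N\<^sup>2))"
  proof -
    have "y * M / b * Z + y * M / a * Z = y * M * (1 / a + 1 / b) * Z" for y M a b Z :: 'b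
      by (simp add: distrib_left distrib_right)
    then show ?thesis
      unfolding sum.distrib[symmetric] add.commute[of q p] by (intro sum.cong refl)
  qed
  finally show ?thesis by (simp only: E_def)
qed

text \<open>Multiplying by \<open>sum x A\<close>, the sum of the two part totals, raises one of the
  exponents, and the two sums so obtained agree by symmetry. Expanding the new factor over a marked
  k leads to \<open>Hurwitz_identity_zero\<close> on A - {k} with p = \<open>x k\<close>; the factor
  \<open>card (A - {k})\<close> found there is the number of edges of a tree on A.\<close>

lemma Cayley_split_identity:
  fixes x :: "'a \<Rightarrow> 'b::linordered_field"
  assumes fin: "finite A" and x_pos: "\<And>k. k \<in> A \<Longrightarrow> x k > 0"
  shows "(\<Sum>S\<in>Pow A. sum x S ^ card S / sum x S * (sum x (A - S) ^ card (A - S) / sum x (A - S)))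
   = 2 * (of_nat (card A) - 1) * (sum x A ^ card A / (sum x A)\<^sup>2)"
proof (cases "A = {}")
  case False
  define G where "G S = sum x S ^ card S / sum x S" for S
  define N where "N = sum x A"
  have N: "N > 0"
    using False fin x_pos by (auto simp: N_def intro: sum_pos)
  have "N * (\<Sum>S\<in>Pow A. G S * G (A - S))
      = (\<Sum>S\<in>Pow A. G S * (sum x (A - S) * G (A - S))) + (\<Sum>S\<in>Pow A. G (A - S) * (sum x S * G S))"
    unfolding sum_distrib_left sum.distrib[symmetric]
  proof (rule sum.cong[OF refl])
    fix S assume "S \<in> Pow A"
    then have "N = sum x S + sum x (A - S)"
      using fin sum.subset_diff[of S A x] by (auto simp: N_def)
    then show "N * (G S * G (A - S)) = G S * (sum x (A - S) * G (A - S)) + G (A - S) * (sum x S * G S)"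
      by (simp add: algebra_simps)
  qed
  also have "(\<Sum>S\<in>Pow A. G (A - S) * (sum x S * G S)) = (\<Sum>S\<in>Pow A. G S * (sum x (A - S) * G (A - S)))"
    by (rule sum_Pow_compl[of "\<lambda>S T. G T * (sum x S * G S)"])
  also have "(\<Sum>S\<in>Pow A. G S * (sum x (A - S) * G (A - S)))
      = (\<Sum>S\<in>Pow A. \<Sum>k\<in>A - S. G S * (x k * G (A - S)))"
    unfolding sum_mult_mult ..
  also have "\<dots> = (\<Sum>k\<in>A. \<Sum>S\<in>Pow (A - {k}).
        x k * (G S * (x k + sum x (A - {k} - S)) ^ card (A - {k} - S)))"
    unfolding sum_Pow_compl_member[OF fin, of "\<lambda>k S T. G S * (x k * G T)"]
  proof (intro sum.cong refl)
    fix k S assume kS: "k \<in> A" "S \<in> Pow (A - {k})"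
    have "x k + sum x (A - {k} - S) > 0"
      using x_pos[OF kS(1)] sum_subset_nonneg[where A = A and x = x and S = "A - {k} - S", OF fin x_pos] by (auto intro!: add_pos_nonneg)
    with kS show "G S * (x k * G (insert k (A - {k} - S)))
        = x k * (G S * (x k + sum x (A - {k} - S)) ^ card (A - {k} - S))"
      by (simp add: insert_compl[OF fin x_pos] G_def)
  qed
  also have "\<dots> = (\<Sum>k\<in>A. x k * ((of_nat (card A) - 1) * (N ^ card A / N\<^sup>2)))"
  proof (rule sum.cong[OF refl])
    fix k assume k: "k \<in> A"
    have s: "x k + sum x (A - {k}) = N"
      using sum_remove[OF fin x_pos k] by (simp add: N_def)
    have "(\<Sum>S\<in>Pow (A - {k}). G S * (x k + sum x (A - {k} - S)) ^ card (A - {k} - S))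
       = (\<Sum>S\<in>Pow (A - {k}). (x k + sum x S) ^ card S * G (A - {k} - S))"
      using sum_Pow_compl[of "\<lambda>S T. G S * (x k + sum x T) ^ card T" "A - {k}"] by (simp add: mult_ac)
    also have "\<dots> = of_nat (card (A - {k})) * (N ^ card (A - {k}) / N)"
      using Hurwitz_identity_zero[of "A - {k}" x "x k"] fin x_pos k s by (simp add: G_def)
    also have "of_nat (card (A - {k})) = (of_nat (card A) - 1 :: 'b)"
      unfolding card.remove[OF fin k] by simp
    also have "\<dots> * (N ^ card (A - {k}) / N) = (of_nat (card A) - 1) * (N ^ card A / N\<^sup>2)"
      using power_card_remove[where y = N, OF fin x_pos k] N
      by (simp add: power2_eq_square)
    finally show "(\<Sum>S\<in>Pow (A - {k}). x k * (G S * (x k + sum x (A - {k} - S)) ^ card (A - {k} - S)))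
        = x k * ((of_nat (card A) - 1) * (N ^ card A / N\<^sup>2))"
      unfolding sum_distrib_left[symmetric] by simp
  qed
  also have "\<dots> = N * ((of_nat (card A) - 1) * (N ^ card A / N\<^sup>2))"
    unfolding sum_distrib_right[symmetric] N_def ..
  finally have "N * (\<Sum>S\<in>Pow A. G S * G (A - S)) = N * (2 * (of_nat (card A) - 1) * (N ^ card A / N\<^sup>2))"
    by (simp only: mult_2 mult_2_right distrib_right distrib_left mult.assoc)
  then have "(\<Sum>S\<in>Pow A. G S * G (A - S)) = 2 * (of_nat (card A) - 1) * (N ^ card A / N\<^sup>2)"
    using N by (simp only: mult_cancel_left) simp
  then show ?thesis by (simp only: G_def N_def)
qed simp

subsection \<open>Abel identities for the weights \<open>i\<^sup>i / i!\<close>\<close>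

lemma sum_Pow_card:
  fixes f :: "nat \<Rightarrow> 'b::semiring_1"
  assumes "finite A"
  shows "(\<Sum>S\<in>Pow A. f (card S)) = (\<Sum>i\<le>card A. of_nat (card A choose i) * f i)"
proof -
  have "(\<Sum>S\<in>Pow A. f (card S)) = (\<Sum>i\<le>card A. \<Sum>S | S \<in> Pow A \<and> card S = i. f (card S))"
    using assms by (intro sum.group[symmetric]) (auto intro: card_mono)
  also have "\<dots> = (\<Sum>i\<le>card A. of_nat (card A choose i) * f i)"
  proof (rule sum.cong[OF refl])
    fix i
    have "(\<Sum>S | S \<in> Pow A \<and> card S = i. f (card S)) = (\<Sum>S | S \<subseteq> A \<and> card S = i. f i)"
      by (intro sum.cong) auto
    then show "(\<Sum>S | S \<in> Pow A \<and> card S = i. f (card S)) = of_nat (card A choose i) * f i"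
      using n_subsets[OF assms, of i] by simp
  qed
  finally show ?thesis .
qed

text \<open>Hurwitz's identity with every \<open>x k\<close> equal to 1, subsets being collected by
  size.\<close>

lemma Abel_identity:
  fixes p q :: "'b::linordered_field"
  assumes "p > 0"
  shows "(\<Sum>i\<le>m. of_nat (m choose i) * (p * ((p + of_nat i) ^ i / (p + of_nat i))
            * (q + of_nat (m - i)) ^ (m - i))) = (p + q + of_nat m) ^ m"
proof -
  let ?f = "\<lambda>i. p * ((p + of_nat i) ^ i / (p + of_nat i)) * (q + of_nat (m - i)) ^ (m - i)"
  have "(\<Sum>S\<in>Pow {..<m}. ?f (card S)) = (\<Sum>S\<in>Pow {..<m}. p * ((p + of_nat (card S)) ^ card S
      / (p + of_nat (card S))) * (q + of_nat (card ({..<m} - S))) ^ card ({..<m} - S))"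
    by (intro sum.cong refl) (auto simp: card_Diff_subset finite_subset[of _ "{..<m}"])
  also have "\<dots> = (p + q + of_nat m) ^ m"
    using Hurwitz_identity[of "{..<m}" p "\<lambda>_. 1" q] assms by simp
  finally have "(\<Sum>S\<in>Pow {..<m}. ?f (card S)) = (p + q + of_nat m) ^ m" .
  then show ?thesis
    using sum_Pow_card[of "{..<m}" ?f] by simp
qed

lemma alternating_sum_choose_power_eq_0:
  assumes "m < k"
  shows "(\<Sum>i\<le>k. of_nat (k choose i) * ((-1) ^ i * of_nat i ^ m)) = (0 :: 'b::comm_ring_1)"
proof -
  have "(\<Sum>S\<in>Pow {..<k}. (-1) ^ card S * of_nat (card S) ^ m) = (0 :: 'b)"
    using alternating_sum_Pow_power_eq_0[of "{..<k}" m "0::'b" "\<lambda>_. 1"] assms by simp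
  then show ?thesis
    using sum_Pow_card[of "{..<k}" "\<lambda>i. (-1) ^ i * of_nat i ^ m :: 'b"] by simp
qed

text \<open>The partial fraction expansion of k! / (b (b + 1) ... (b + k)). By Pascal's rule the sum
  for k + 1 at b is the sum for k at b minus the sum for k at b + 1, and the closed form obeys the
  same recurrence.\<close>

lemma alternating_sum_choose_over_add:
  fixes b :: "'b::linordered_field"
  assumes "b > 0"
  shows "(\<Sum>i\<le>k. of_nat (k choose i) * ((-1) ^ i / (of_nat i + b))) = fact k / pochhammer b (Suc k)"
  using assms
proof (induction k arbitrary: b)
  case (Suc k)
  have "(\<Sum>i\<le>Suc k. of_nat (Suc k choose i) * ((-1) ^ i / (of_nat i + b)))
      = 1 / b + (\<Sum>i\<le>k. of_nat (Suc k choose Suc i) * ((-1) ^ Suc i / (of_nat (Suc i) + b)))"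
    by (subst sum.atMost_Suc_shift) simp
  also have "(\<Sum>i\<le>k. of_nat (Suc k choose Suc i) * ((-1) ^ Suc i / (of_nat (Suc i) + b)))
     = (\<Sum>i\<le>k. of_nat (k choose Suc i) * ((-1) ^ Suc i / (of_nat (Suc i) + b)))
      - (\<Sum>i\<le>k. of_nat (k choose i) * ((-1) ^ i / (of_nat i + (b + 1))))"
    unfolding sum_subtractf[symmetric]
    by (intro sum.cong refl) (simp add: algebra_simps add_divide_distrib diff_divide_distrib)
  also have "1 / b + (\<dots>) = (1 / b + (\<Sum>i\<le>k. of_nat (k choose Suc i) * ((-1) ^ Suc i / (of_nat (Suc i) + b))))
      - (\<Sum>i\<le>k. of_nat (k choose i) * ((-1) ^ i / (of_nat i + (b + 1))))"
    by simp
  also have "1 / b + (\<Sum>i\<le>k. of_nat (k choose Suc i) * ((-1) ^ Suc i / (of_nat (Suc i) + b)))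
     = (\<Sum>i\<le>Suc k. of_nat (k choose i) * ((-1) ^ i / (of_nat i + b)))"
    by (subst sum.atMost_Suc_shift) simp
  also have "\<dots> = (\<Sum>i\<le>k. of_nat (k choose i) * ((-1) ^ i / (of_nat i + b)))"
    by simp
  also have "\<dots> - (\<Sum>i\<le>k. of_nat (k choose i) * ((-1) ^ i / (of_nat i + (b + 1))))
     = fact k / pochhammer b (Suc k) - fact k / pochhammer (b + 1) (Suc k)"
    using Suc.IH[of b] Suc.IH[of "b + 1"] Suc.prems by (simp add: add_pos_pos)
  also have "\<dots> = fact (Suc k) / pochhammer b (Suc (Suc k))"
  proof -
    define P Q where "P = pochhammer (b + 1) k" and "Q = b + 1 + of_nat k"
    have "P > 0" "Q > 0"
      using Suc.prems by (auto simp: P_def Q_def intro!: pochhammer_pos add_pos_nonneg)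
    moreover have "pochhammer b (Suc k) = b * P" "pochhammer (b + 1) (Suc k) = P * Q"
      "pochhammer b (Suc (Suc k)) = b * (P * Q)"
      unfolding P_def Q_def
      using pochhammer_rec[of b k] pochhammer_rec[of b "Suc k"] pochhammer_Suc[of "b + 1" k] by simp_all
    moreover have "fact (Suc k) = (Q - b) * fact k"
      by (simp add: Q_def)
    ultimately show ?thesis
      using Suc.prems by (simp add: divide_simps) (simp add: algebra_simps)
  qed
  finally show ?case .
qed simp

text \<open>Division with remainder, i^(m+1) / (i + b) = i^m - b i^m / (i + b): the polynomial part
  sums to 0 as long as m < k, so each step contributes a factor -b.\<close>

lemma alternating_sum_choose_power_over_add:
  fixes b :: "'b::linordered_field"
  assumes "b > 0" "m \<le> k"
  shows "(\<Sum>i\<le>k. of_nat (k choose i) * ((-1) ^ i * of_nat i ^ m / (of_nat i + b)))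
       = (- b) ^ m * (fact k / pochhammer b (Suc k))"
  using assms(2)
proof (induction m)
  case 0
  then show ?case using alternating_sum_choose_over_add[OF assms(1), of k] by simp
next
  case (Suc m)
  have "(\<Sum>i\<le>k. of_nat (k choose i) * ((-1) ^ i * of_nat i ^ Suc m / (of_nat i + b)))
     = (\<Sum>i\<le>k. of_nat (k choose i) * ((-1) ^ i * of_nat i ^ m)
          - b * (of_nat (k choose i) * ((-1) ^ i * of_nat i ^ m / (of_nat i + b))))"
  proof (rule sum.cong[OF refl])
    fix i
    have *: "c * (e * (n * z) / (n + b)) = c * (e * z) - b * (c * (e * z / (n + b)))"
      if "n + b > 0" for c e n z :: 'b
      using that by (simp add: field_simps)
    have "of_nat i + b > 0"
      using assms(1) by (simp add: add_nonneg_pos)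
    then show "of_nat (k choose i) * ((-1) ^ i * of_nat i ^ Suc m / (of_nat i + b))
     = of_nat (k choose i) * ((-1) ^ i * of_nat i ^ m)
          - b * (of_nat (k choose i) * ((-1) ^ i * of_nat i ^ m / (of_nat i + b)))"
      unfolding power_Suc by (rule *)
  qed
  also have "\<dots> = - b * (\<Sum>i\<le>k. of_nat (k choose i) * ((-1) ^ i * of_nat i ^ m / (of_nat i + b)))"
    using Suc.prems alternating_sum_choose_power_eq_0[of m k, where 'b = 'b]
    unfolding sum_subtractf sum_distrib_left[symmetric] by simp
  finally show ?case
    using Suc by simp
qed

text \<open>The coefficients of 1 / (1 - T), where T = z exp T is the tree function; 0^0 = 1 gives i
  = 0 the weight 1.\<close>

definition self_power :: "nat \<Rightarrow> rat" where
  "self_power i = of_nat i ^ i / fact i"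

lemma self_power_0 [simp]: "self_power 0 = 1"
  by (simp add: self_power_def)

lemma self_power_pos: "self_power i > 0"
  by (cases "i = 0") (auto simp: self_power_def)

text \<open>Abel's identity with p = 1, q = 0 and m - 1 in place of m evaluates the sum up to i = m
  as \<open>self_power m\<close>. The term i = m, whose second factor is
  \<open>self_power 0\<close>, is then taken away.\<close>

lemma sum_self_power_over_index:
  assumes "m \<ge> 1"
  shows "(\<Sum>i=1..<m. self_power i * self_power (m - i) / of_nat i)
       = self_power m * (of_nat m - 1) / of_nat m"
proof -
  obtain M where M: "m = Suc M"
    using assms by (cases m) auto
  have "(\<Sum>i=1..m. self_power i * self_power (m - i) / of_nat i)
      = (\<Sum>i\<le>M. self_power (Suc i) * self_power (M - i) / of_nat (Suc i))"
    unfolding M by (rule sum.reindex_bij_witness[of _ Suc "\<lambda>i. i - 1"]) auto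
  also have "\<dots> = (\<Sum>i\<le>M. of_nat (M choose i) * (1 * ((1 + of_nat i) ^ i / (1 + of_nat i))
            * (0 + of_nat (M - i)) ^ (M - i)) / fact M)"
  proof (rule sum.cong[OF refl])
    fix i assume "i \<in> {..M}"
    then have c: "of_nat (M choose i) = (fact M / (fact i * fact (M - i)) :: rat)"
      by (simp add: binomial_fact)
    show "self_power (Suc i) * self_power (M - i) / of_nat (Suc i)
      = of_nat (M choose i) * (1 * ((1 + of_nat i) ^ i / (1 + of_nat i))
            * (0 + of_nat (M - i)) ^ (M - i)) / fact M"
      unfolding c self_power_def fact_Suc of_nat_Suc power_Suc
      by (simp add: divide_simps)
  qed
  also have "\<dots> = self_power m"
    using Abel_identity[of 1 M 0] unfolding sum_divide_distrib[symmetric]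
    by (simp add: M self_power_def)
  finally have "(\<Sum>i=1..m. self_power i * self_power (m - i) / of_nat i) = self_power m" .
  moreover have "{1..m} = insert m {1..<m}"
    using assms by auto
  ultimately have "(\<Sum>i=1..<m. self_power i * self_power (m - i) / of_nat i) = self_power m - self_power m / of_nat m"
    by simp
  then show ?thesis
    using assms by (simp add: field_simps)
qed

text \<open>The power (a - i)^(a-i) is expanded around a. Collecting terms by the total degree k in
  i leaves the extreme case m = k of \<open>alternating_sum_choose_power_over_add\<close>. The
  right-hand side is a segment of the binomial expansion of (b + a)^(a+b) / (a + b)!.\<close>

lemma sum_self_power_over_add:
  assumes "b \<ge> 1"
  shows "of_nat b * self_power b * (\<Sum>i\<le>a. self_power i * self_power (a - i) / of_nat (i + b))
       = (\<Sum>k\<le>a. of_nat b ^ (b + k) / fact (b + k) * (of_nat a ^ (a - k) / fact (a - k)))"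
proof -
  let ?b = "of_nat b :: rat"
  have b: "?b > 0" using assms by simp
  have "fact a * (\<Sum>i\<le>a. self_power i * self_power (a - i) / of_nat (i + b))
     = (\<Sum>i\<le>a. \<Sum>j\<le>a - i. of_nat (a choose i) * of_nat i ^ i / of_nat (i + b)
          * (of_nat (a - i choose j) * (- of_nat i) ^ j * of_nat a ^ (a - i - j)))"
    unfolding sum_distrib_left
  proof (rule sum.cong[OF refl])
    fix i assume i: "i \<in> {..a}"
    have "(of_nat (a - i) :: rat) ^ (a - i) = (- of_nat i + of_nat a) ^ (a - i)"
      using i by (simp add: of_nat_diff)
    also have "\<dots> = (\<Sum>j\<le>a - i. of_nat (a - i choose j) * (- of_nat i) ^ j * of_nat a ^ (a - i - j))"
      by (rule binomial_ring)
    finally have e: "(\<Sum>j\<le>a - i. of_nat (a - i choose j) * (- of_nat i) ^ j * of_nat a ^ (a - i - j))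
      = (of_nat (a - i) :: rat) ^ (a - i)" ..
    have c: "of_nat (a choose i) = (fact a / (fact i * fact (a - i)) :: rat)"
      using i by (simp add: binomial_fact)
    show "fact a * (self_power i * self_power (a - i) / of_nat (i + b))
     = (\<Sum>j\<le>a - i. of_nat (a choose i) * of_nat i ^ i / of_nat (i + b)
          * (of_nat (a - i choose j) * (- of_nat i) ^ j * of_nat a ^ (a - i - j)))"
      unfolding sum_distrib_left[symmetric] e c by (simp add: self_power_def)
  qed
  also have "\<dots> = (\<Sum>(i, j) | i + j \<le> a. of_nat (a choose i) * of_nat i ^ i / of_nat (i + b)
          * (of_nat (a - i choose j) * (- of_nat i) ^ j * of_nat a ^ (a - i - j)))"
    by (subst sum.Sigma) (auto intro!: sum.cong)
  also have "\<dots> = (\<Sum>k\<le>a. \<Sum>i\<le>k. of_nat (a choose i) * of_nat i ^ i / of_nat (i + b)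
          * (of_nat (a - i choose (k - i)) * (- of_nat i) ^ (k - i) * of_nat a ^ (a - i - (k - i))))"
    by (rule sum.triangle_reindex_eq)
  also have "\<dots> = (\<Sum>k\<le>a. of_nat (a choose k) * of_nat a ^ (a - k) * (-1) ^ k *
      (\<Sum>i\<le>k. of_nat (k choose i) * ((-1) ^ i * of_nat i ^ k / (of_nat i + ?b))))"
    unfolding sum_distrib_left
  proof (intro sum.cong refl)
    fix k i assume "k \<in> {..a}" "i \<in> {..k}"
    then have ki: "i \<le> k" "k \<le> a" by auto
    have c: "of_nat (a choose i) * of_nat (a - i choose (k - i)) = (of_nat (a choose k) * of_nat (k choose i) :: rat)"
      using choose_mult[OF ki] by (metis of_nat_mult)
    have e: "a - i - (k - i) = a - k" using ki by simp
    have s: "(- of_nat i :: rat) ^ (k - i) = (-1) ^ k * (-1) ^ i * of_nat i ^ (k - i)"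
      using ki by (simp add: power_minus[of "of_nat i"] minus_one_power_iff)
    have p: "of_nat i ^ k = (of_nat i ^ i * of_nat i ^ (k - i) :: rat)"
      using ki by (simp add: power_add[symmetric])
    have "of_nat (a choose i) * of_nat i ^ i / of_nat (i + b)
          * (of_nat (a - i choose (k - i)) * (- of_nat i) ^ (k - i) * of_nat a ^ (a - i - (k - i)))
      = (of_nat (a choose i) * of_nat (a - i choose (k - i))) * of_nat i ^ i / of_nat (i + b)
          * ((- of_nat i) ^ (k - i) * (of_nat a ^ (a - i - (k - i)) :: rat))"
      by (simp add: mult_ac)
    also have "\<dots> = of_nat (a choose k) * of_nat a ^ (a - k) * (-1) ^ k *
      (of_nat (k choose i) * ((-1) ^ i * of_nat i ^ k / (of_nat i + ?b)))"
      unfolding c e s p by (simp add: mult_ac)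
    finally show "of_nat (a choose i) * of_nat i ^ i / of_nat (i + b)
          * (of_nat (a - i choose (k - i)) * (- of_nat i) ^ (k - i) * of_nat a ^ (a - i - (k - i)))
      = of_nat (a choose k) * of_nat a ^ (a - k) * (-1) ^ k *
      (of_nat (k choose i) * ((-1) ^ i * of_nat i ^ k / (of_nat i + ?b)))" .
  qed
  also have "\<dots> = (\<Sum>k\<le>a. of_nat (a choose k) * of_nat a ^ (a - k) * (?b ^ k * (fact k / pochhammer ?b (Suc k))))"
    unfolding alternating_sum_choose_power_over_add[OF b order.refl] power_minus[of ?b]
    by (intro sum.cong refl) (simp flip: power_mult_distrib)
  finally have main: "fact a * (\<Sum>i\<le>a. self_power i * self_power (a - i) / of_nat (i + b))
    = (\<Sum>k\<le>a. of_nat (a choose k) * of_nat a ^ (a - k) * (?b ^ k * (fact k / pochhammer ?b (Suc k))))" .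
  have "of_nat b * self_power b * (\<Sum>i\<le>a. self_power i * self_power (a - i) / of_nat (i + b))
     = of_nat b * self_power b / fact a * (fact a * (\<Sum>i\<le>a. self_power i * self_power (a - i) / of_nat (i + b)))"
    by simp
  also have "\<dots> = (\<Sum>k\<le>a. of_nat b ^ (b + k) / fact (b + k) * (of_nat a ^ (a - k) / fact (a - k)))"
    unfolding main unfolding sum_distrib_left
  proof (rule sum.cong[OF refl])
    fix k assume k: "k \<in> {..a}"
    obtain c where c: "b = Suc c" using assms by (cases b) auto
    have "fact (b - 1 + Suc k) = fact (b - 1) * (pochhammer ?b (Suc k))"
      using pochhammer_product[of "b - 1" "b - 1 + Suc k" "1::rat"] assms
      by (simp add: pochhammer_fact[symmetric] c add.commute)
    then have p: "pochhammer ?b (Suc k) = fact (b + k) / fact (b - 1)"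
      by (simp add: c)
    have f: "fact b = (?b * fact (b - 1) :: rat)"
      by (simp add: c)
    have ch: "of_nat (a choose k) = (fact a / (fact k * fact (a - k)) :: rat)"
      using k by (simp add: binomial_fact)
    show "?b * self_power b / fact a * (of_nat (a choose k) * of_nat a ^ (a - k) * (?b ^ k * (fact k / pochhammer ?b (Suc k))))
       = ?b ^ (b + k) / fact (b + k) * (of_nat a ^ (a - k) / fact (a - k))"
      unfolding p ch self_power_def f using b by (simp add: power_add divide_simps)
  qed
  finally show ?thesis .
qed

text \<open>The previous lemma yields the terms with j \<ge> b of the binomial expansion of (b +
  a)^(a+b) / (a + b)!, and with a and b exchanged those with j \<le> b. Together they form the whole
  expansion with the term j = b counted twice. Splitting off the first and last i leaves the stated
  sums.\<close>

lemma self_power_add: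
  assumes "a \<ge> 1" "b \<ge> 1"
  shows "self_power (a + b) = 2 * self_power a * self_power b
     + of_nat b * self_power b * (\<Sum>i=1..<a. self_power i * self_power (a - i) / of_nat (i + b))
     + of_nat a * self_power a * (\<Sum>i=1..<b. self_power i * self_power (b - i) / of_nat (i + a))"
proof -
  define T :: "nat \<Rightarrow> rat" where
    "T j = of_nat b ^ j / fact j * (of_nat a ^ (a + b - j) / fact (a + b - j))" for j
  have full: "of_nat b * self_power b * (\<Sum>i\<le>a. self_power i * self_power (a - i) / of_nat (i + b))
      = self_power a * self_power b
        + of_nat b * self_power b * (\<Sum>i=1..<a. self_power i * self_power (a - i) / of_nat (i + b))
        + of_nat b * (self_power a * self_power b / of_nat (a + b))"
    if "a \<ge> 1" "b \<ge> 1" for a b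
  proof -
    have "{..a} = insert 0 (insert a {1..<a})"
      using that by auto
    then show ?thesis
      using that by (simp add: distrib_left)
  qed
  have "(\<Sum>k\<le>a. of_nat b ^ (b + k) / fact (b + k) * (of_nat a ^ (a - k) / fact (a - k))) = sum T {b..a + b}"
    by (rule sum.reindex_bij_witness[of _ "\<lambda>j. j - b" "\<lambda>k. b + k"]) (auto simp: T_def)
  moreover have "(\<Sum>k\<le>b. of_nat a ^ (a + k) / fact (a + k) * (of_nat b ^ (b - k) / fact (b - k))) = sum T {..b}"
    by (rule sum.reindex_bij_witness[of _ "\<lambda>j. b - j" "\<lambda>k. b - k"]) (auto simp: T_def mult_ac)
  moreover have "sum T {..b} + sum T {b..a + b} = sum T {..a + b} + T b"
  proof -
    have "{..a + b} = {..b} \<union> {b..a + b}" "{..b} \<inter> {b..a + b} = {b}"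
      by auto
    then show ?thesis
      using sum.union_inter[of "{..b}" "{b..a + b}" T] by simp
  qed
  moreover have "sum T {..a + b} = self_power (a + b)"
  proof -
    have "sum T {..a + b} = (\<Sum>j\<le>a + b. of_nat (a + b choose j) * of_nat b ^ j * of_nat a ^ (a + b - j)) / fact (a + b)"
      unfolding sum_divide_distrib by (intro sum.cong refl) (simp add: T_def binomial_fact)
    also have "\<dots> = of_nat (b + a) ^ (a + b) / fact (a + b)"
      by (simp only: of_nat_add binomial_ring)
    finally show ?thesis
      by (simp only: self_power_def add.commute)
  qed
  moreover have "T b = self_power a * self_power b"
    by (simp add: T_def self_power_def mult_ac)
  \<comment> \<open>The last terms i = a and i = b carry the shares b / (a + b) and a / (a + b) of
    one product, which cancels the doubled \<open>T b\<close>; the two terms i = 0 give the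
    coefficient 2.\<close>
  moreover have "of_nat b * (self_power a * self_power b / of_nat (a + b))
      + of_nat a * (self_power b * self_power a / of_nat (b + a)) = self_power a * self_power b"
  proof -
    have "y * (v / s) + x * (v / s) = v" if "s = x + y" "s > 0" for x y s v :: rat
      using that(2) unfolding distrib_right[symmetric] add.commute[of y x] that(1)[symmetric] by simp
    from this[of "of_nat (a + b)" "of_nat a" "of_nat b"] show ?thesis
      using assms by (simp only: add.commute[of b a] mult.commute[of "self_power b" "self_power a"]) simp
  qed
  ultimately show ?thesis
    using sum_self_power_over_add[OF assms(2), of a] sum_self_power_over_add[OF assms(1), of b]
      full[OF assms] full[OF assms(2,1)] by (simp only: mult.commute[of "self_power b" "self_power a"])
qed

section \<open>The join-cut recurrence for the weights of the formula\<close>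

lemma sum_Diff_singleton_swap:
  assumes "finite K"
  shows "(\<Sum>C\<in>K. \<Sum>D\<in>K - {C}. f C D) = (\<Sum>C\<in>K. \<Sum>D\<in>K - {C}. f D C)"
proof -
  have "(\<Sum>C\<in>K. \<Sum>D\<in>K - {C}. f C D) = (\<Sum>C\<in>K. \<Sum>D | D \<in> K \<and> C \<noteq> D. f C D)"
    by (intro sum.cong) auto
  also have "\<dots> = (\<Sum>D\<in>K. \<Sum>C | C \<in> K \<and> C \<noteq> D. f C D)"
    using assms by (rule sum.swap_restrict[OF _ assms])
  also have "\<dots> = (\<Sum>C\<in>K. \<Sum>D\<in>K - {C}. f D C)"
    by (intro sum.cong) auto
  finally show ?thesis .
qed

lemma sum_Diff_singleton_add:
  fixes f :: "'a \<Rightarrow> 'b::comm_ring_1"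
  assumes "finite K"
  shows "(\<Sum>C\<in>K. \<Sum>D\<in>K - {C}. f C + f D) = 2 * (of_nat (card K) - 1) * sum f K"
proof -
  have "(\<Sum>C\<in>K. \<Sum>D\<in>K - {C}. f D) = (\<Sum>C\<in>K. sum f K - f C)"
    using assms by (intro sum.cong refl) (simp add: sum_diff1)
  also have "\<dots> = (of_nat (card K) - 1) * sum f K"
    by (simp add: sum_subtractf algebra_simps)
  finally have "(\<Sum>C\<in>K. \<Sum>D\<in>K - {C}. f D) = (of_nat (card K) - 1) * sum f K" .
  then show ?thesis
    using sum_Diff_singleton_swap[OF assms, of "\<lambda>C D. f C"] by (simp only: sum.distrib mult.assoc mult_2 distrib_right)
qed

text \<open>For i > 0 this is i^i / (i - 1)!, the factor of a cycle of length i in the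
  Goulden--Jackson formula, written so that the identities for \<open>self_power\<close>
  apply.\<close>

definition cycle_weight :: "nat \<Rightarrow> rat" where
  "cycle_weight i = of_nat i * self_power i"

lemma cycle_weight_1: "cycle_weight (Suc 0) = 1"
  by (simp add: cycle_weight_def self_power_def)

lemma sum_reflect: "(\<Sum>k=1..<m. f k) = (\<Sum>k=1..<m. f (m - k))" for m :: nat
  by (rule sum.reindex_bij_witness[of _ "\<lambda>k. m - k" "\<lambda>k. m - k"]) auto

text \<open>The formula satisfies the join-cut recurrence: after multiplication by \<open>N\<close>, the terms of
  \<open>self_power_add\<close> for the joins cancel against the sums over \<open>D\<close> produced by
  \<open>Hurwitz_cut_identity\<close> for the cuts.\<close>

lemma join_cut_identity:
  fixes x :: "'a \<Rightarrow> nat"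
  assumes fin: "finite K" and ne: "K \<noteq> {}" and x_pos: "\<And>C. C \<in> K \<Longrightarrow> x C \<ge> 1"
  defines "X \<equiv> \<lambda>C. of_nat (x C) :: rat"
  defines "N \<equiv> sum X K"
  shows "(\<Sum>C\<in>K. \<Sum>D\<in>K - {C}. X C * X D * (cycle_weight (x C + x D)
            * (\<Prod>B\<in>K - {C, D}. cycle_weight (x B)) * (N ^ card K / N ^ 4)))
     + (\<Sum>C\<in>K. X C * (\<Sum>k=1..<x C. cycle_weight k * cycle_weight (x C - k)
            * (\<Prod>B\<in>K - {C}. cycle_weight (x B))
            * (\<Sum>S\<in>Pow (K - {C}). (of_nat k + sum X S) ^ card S / (of_nat k + sum X S)\<^sup>2
                * ((of_nat (x C - k) + sum X (K - {C} - S)) ^ card (K - {C} - S)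
                    / (of_nat (x C - k) + sum X (K - {C} - S))\<^sup>2))))
     = 2 * (N + of_nat (card K) - 2) * (N ^ card K / N ^ 3) * (\<Prod>B\<in>K. cycle_weight (x B))"
    (is "?joins + ?cuts = _")
proof -
  define P where "P = (\<Prod>B\<in>K. cycle_weight (x B))"
  define w where "w C = self_power (x C)" for C
  define R where "R C D = (\<Sum>k=1..<x C. self_power k * self_power (x C - k) / (of_nat k + X D))" for C D
  define z where "z = N ^ card K / N ^ 4"
  \<comment> \<open>The interaction of two cycles: by \<open>self_power_add\<close>, joining C and D
    produces c C D + c D C, while all cuts of C in the presence of D produce -2 c C D.\<close>
  define c where "c C D = (X C + X D) * (X D * R C D / w C)" for C D
  have X_pos: "X C > 0" if "C \<in> K" for C
    using x_pos[OF that] by (simp add: X_def)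
  have w_pos: "w C > 0" for C
    by (simp add: w_def self_power_pos)
  have N: "N > 0"
    unfolding N_def using fin ne X_pos by (intro sum_pos) auto
  have W: "cycle_weight (x C) = X C * w C" for C
    by (simp add: cycle_weight_def X_def w_def)
  have join: "X C * X D * (cycle_weight (x C + x D) * (\<Prod>B\<in>K - {C, D}. cycle_weight (x B)) * z)
      = P * z * (2 * (X C + X D) + c C D + c D C)" if "C \<in> K" "D \<in> K - {C}" for C D
  proof -
    have P: "P = X C * w C * (X D * w D * (\<Prod>B\<in>K - {C, D}. cycle_weight (x B)))"
      unfolding P_def using that fin
      by (simp add: prod.remove[of K C] prod.remove[of "K - {C}" D] W Diff_insert2[of K C "{D}"]
          Diff_insert[of K C "{D}"])
    have "self_power (x C + x D) = 2 * w C * w D + X D * w D * R C D + X C * w C * R D C"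
      using self_power_add[of "x C" "x D"] x_pos that by (simp add: w_def X_def R_def)
    then have "cycle_weight (x C + x D)
        = (X C + X D) * (2 * w C * w D + X D * w D * R C D + X C * w C * R D C)"
      by (simp add: cycle_weight_def X_def)
    also have "\<dots> = w C * w D * (2 * (X C + X D) + c C D + c D C)"
      using w_pos[of C] w_pos[of D] by (simp add: c_def field_simps)
    finally show ?thesis
      unfolding P by (simp only: mult_ac)
  qed
  have "N * ?joins = N * (\<Sum>C\<in>K. \<Sum>D\<in>K - {C}. P * z * (2 * (X C + X D) + c C D + c D C))"
    unfolding z_def[symmetric] by (intro arg_cong[of _ _ "(*) N"] sum.cong refl join)
  also have "\<dots> = P * (z * N) * (\<Sum>C\<in>K. \<Sum>D\<in>K - {C}. 2 * (X C + X D) + c C D + c D C)"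
    unfolding sum_distrib_left[symmetric] by (simp only: mult_ac)
  also have "(\<Sum>C\<in>K. \<Sum>D\<in>K - {C}. 2 * (X C + X D) + c C D + c D C)
      = 4 * (of_nat (card K) - 1) * N + 2 * (\<Sum>C\<in>K. \<Sum>D\<in>K - {C}. c C D)"
  proof -
    define e where "e C D = X C + X D" for C D
    have "(\<Sum>C\<in>K. \<Sum>D\<in>K - {C}. 2 * e C D + c C D + c D C) = 2 * (\<Sum>C\<in>K. \<Sum>D\<in>K - {C}. e C D)
        + (\<Sum>C\<in>K. \<Sum>D\<in>K - {C}. c C D) + (\<Sum>C\<in>K. \<Sum>D\<in>K - {C}. c D C)"
      by (simp only: sum.distrib sum_distrib_left)
    then show ?thesis
      using sum_Diff_singleton_swap[OF fin, of c] sum_Diff_singleton_add[OF fin, of X]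
      by (simp add: e_def N_def)
  qed
  finally have joins: "N * ?joins
     = P * (z * N) * (4 * (of_nat (card K) - 1) * N + 2 * (\<Sum>C\<in>K. \<Sum>D\<in>K - {C}. c C D))" .
  have cut: "N * (X C * (\<Sum>k=1..<x C. cycle_weight k * cycle_weight (x C - k)
            * (\<Prod>B\<in>K - {C}. cycle_weight (x B))
            * (\<Sum>S\<in>Pow (K - {C}). (of_nat k + sum X S) ^ card S / (of_nat k + sum X S)\<^sup>2
                * ((of_nat (x C - k) + sum X (K - {C} - S)) ^ card (K - {C} - S)
                    / (of_nat (x C - k) + sum X (K - {C} - S))\<^sup>2))))
     = P * (z * N) * (2 * (X C - 1) * N - 2 * (\<Sum>D\<in>K - {C}. c C D))"
    (is "N * (X C * (\<Sum>k=1..<x C. _ k * _ k * ?Q * ?H k)) = _") if C: "C \<in> K" for C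
  proof -
    have P: "P = X C * w C * ?Q"
      unfolding P_def using C fin by (simp add: prod.remove[of K C] W)
    have N_pow: "N ^ card (K - {C}) / N = z * N * N" "N ^ card (K - {C}) / N\<^sup>2 = z * N"
    proof -
      have "N ^ card K = N * N ^ card (K - {C})"
        unfolding card.remove[OF fin C] power_Suc ..
      then show "N ^ card (K - {C}) / N = z * N * N" "N ^ card (K - {C}) / N\<^sup>2 = z * N"
        using N by (simp_all add: z_def power2_eq_square power4_eq_xxxx)
    qed
    have step: "N * (X C * (cycle_weight k * cycle_weight (x C - k) * ?Q * ?H k))
       = P / w C * (z * N) * (self_power k * self_power (x C - k) *
           (X C * (1 / of_nat k + 1 / of_nat (x C - k)) * N
             - (\<Sum>D\<in>K - {C}. X D * (X C + X D) * (1 / (of_nat k + X D) + 1 / (of_nat (x C - k) + X D)))))"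
      if k: "k \<in> {1..<x C}" for k
    proof -
      let ?k = "of_nat k :: rat" and ?l = "of_nat (x C - k) :: rat"
      have kl: "?k + ?l = X C" "?k > 0" "?l > 0"
        using k by (auto simp: X_def of_nat_diff)
      have "?k + ?l + sum X (K - {C}) = N"
        unfolding kl(1) N_def using fin C by (simp add: sum.remove)
      then have "?k * ?l * N * ?H k = X C * (1 / ?k + 1 / ?l) * (z * N * N)
        - (\<Sum>D\<in>K - {C}. X D * (X C + X D) * (1 / (?k + X D) + 1 / (?l + X D)) * (z * N))"
        using Hurwitz_cut_identity[of "K - {C}" X ?k ?l] fin X_pos kl N_pow by simp
      also have "\<dots> = z * N * (X C * (1 / ?k + 1 / ?l) * N
        - (\<Sum>D\<in>K - {C}. X D * (X C + X D) * (1 / (?k + X D) + 1 / (?l + X D))))"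
        unfolding sum_distrib_right[symmetric] by (simp add: right_diff_distrib mult_ac)
      finally have H: "?k * ?l * N * ?H k = \<dots>" .
      have "N * (X C * (cycle_weight k * cycle_weight (x C - k) * ?Q * ?H k))
        = X C * ?Q * (self_power k * self_power (x C - k)) * (?k * ?l * N * ?H k)"
        by (simp only: cycle_weight_def mult_ac)
      also have "X C * ?Q = P / w C"
        unfolding P using w_pos[of C] by simp
      finally show ?thesis
        unfolding H by (simp only: mult_ac)
    qed
    define V where "V k = self_power k * self_power (x C - k)" for k
    \<comment> \<open>Cuts at k and at \<open>x C - k\<close> give the same two lengths, so the two
      reciprocals in each term contribute equally; hence the factors 2 in \<open>V1\<close> and
      \<open>V2\<close>.\<close>
    have V_sym: "(\<Sum>k=1..<x C. V k * f (x C - k)) = (\<Sum>k=1..<x C. V k * f k)" for f :: "nat \<Rightarrow> rat"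
      by (subst sum_reflect, rule sum.cong) (auto simp: V_def)
    have V1: "(\<Sum>k=1..<x C. V k * (X C * (1 / of_nat k + 1 / of_nat (x C - k)) * N)) = w C * (2 * (X C - 1) * N)"
    proof -
      have "(\<Sum>k=1..<x C. V k * (1 / of_nat k)) = w C * (X C - 1) / X C"
        using sum_self_power_over_index[OF x_pos[OF C]] by (simp add: V_def w_def X_def)
      then have "(\<Sum>k=1..<x C. V k * (1 / of_nat k + 1 / of_nat (x C - k))) = 2 * (w C * (X C - 1) / X C)"
        unfolding distrib_left sum.distrib V_sym[of "\<lambda>k. 1 / of_nat k"] by simp
      moreover have "(\<Sum>k=1..<x C. V k * (X C * (1 / of_nat k + 1 / of_nat (x C - k)) * N))
          = X C * N * (\<Sum>k=1..<x C. V k * (1 / of_nat k + 1 / of_nat (x C - k)))"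
        unfolding sum_distrib_left by (intro sum.cong refl) (simp only: mult_ac)
      ultimately show ?thesis
        using X_pos[OF C] by simp
    qed
    have V2: "(\<Sum>k=1..<x C. V k * (\<Sum>D\<in>K - {C}. X D * (X C + X D) * (1 / (of_nat k + X D) + 1 / (of_nat (x C - k) + X D))))
       = w C * (2 * (\<Sum>D\<in>K - {C}. c C D))"
    proof -
      have "(\<Sum>k=1..<x C. V k * (\<Sum>D\<in>K - {C}. X D * (X C + X D) * (1 / (of_nat k + X D) + 1 / (of_nat (x C - k) + X D))))
        = (\<Sum>D\<in>K - {C}. X D * (X C + X D) *
             (\<Sum>k=1..<x C. V k * (1 / (of_nat k + X D) + 1 / (of_nat (x C - k) + X D))))"
        unfolding sum_distrib_left by (subst sum.swap) (intro sum.cong refl, simp only: mult_ac)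
      also have "\<dots> = (\<Sum>D\<in>K - {C}. w C * (2 * c C D))"
      proof (rule sum.cong[OF refl])
        fix D
        have "(\<Sum>k=1..<x C. V k * (1 / (of_nat k + X D) + 1 / (of_nat (x C - k) + X D))) = 2 * R C D"
          unfolding distrib_left sum.distrib V_sym[of "\<lambda>k. 1 / (of_nat k + X D)"] by (simp add: R_def V_def)
        then show "X D * (X C + X D) * (\<Sum>k=1..<x C. V k * (1 / (of_nat k + X D) + 1 / (of_nat (x C - k) + X D)))
           = w C * (2 * c C D)"
          using w_pos[of C] by (simp add: c_def)
      qed
      finally show ?thesis by (simp only: sum_distrib_left)
    qed
    have "N * (X C * (\<Sum>k=1..<x C. cycle_weight k * cycle_weight (x C - k) * ?Q * ?H k))
       = (\<Sum>k=1..<x C. P / w C * (z * N) * (V k *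
           (X C * (1 / of_nat k + 1 / of_nat (x C - k)) * N
             - (\<Sum>D\<in>K - {C}. X D * (X C + X D) * (1 / (of_nat k + X D) + 1 / (of_nat (x C - k) + X D))))))"
      unfolding sum_distrib_left[where A = "{1..<x C}"] V_def by (rule sum.cong[OF refl step])
    also have "\<dots> = P / w C * (z * N) * (w C * (2 * (X C - 1) * N) - w C * (2 * (\<Sum>D\<in>K - {C}. c C D)))"
      unfolding sum_distrib_left[symmetric] right_diff_distrib[of "V _"] sum_subtractf V1 V2 ..
    also have "\<dots> = P * (z * N) * (2 * (X C - 1) * N - 2 * (\<Sum>D\<in>K - {C}. c C D))"
      using w_pos[of C] unfolding right_diff_distrib[of "w C", symmetric] by simp
    finally show ?thesis .
  qed
  have "N * ?cuts = P * (z * N) * (\<Sum>C\<in>K. 2 * (X C - 1) * N - 2 * (\<Sum>D\<in>K - {C}. c C D))"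
    unfolding sum_distrib_left[where A = K] by (rule sum.cong[OF refl cut])
  also have "(\<Sum>C\<in>K. 2 * (X C - 1) * N - 2 * (\<Sum>D\<in>K - {C}. c C D))
     = 2 * (N - of_nat (card K)) * N - 2 * (\<Sum>C\<in>K. \<Sum>D\<in>K - {C}. c C D)"
    by (simp add: sum_subtractf sum_distrib_left[symmetric] sum_distrib_right[symmetric] N_def[symmetric])
  finally have cuts: "N * ?cuts
     = P * (z * N) * (2 * (N - of_nat (card K)) * N - 2 * (\<Sum>C\<in>K. \<Sum>D\<in>K - {C}. c C D))" .
  \<comment> \<open>With l = \<open>card K\<close>, the joins leave 4 (l - 1) N and the cuts 2 (N -
    l) N. The sum is 2 (N + l - 2) N, and N + l - 2 is the length of a minimal
    factorization.\<close>
  have "N * (?joins + ?cuts) = P * (z * N) * (2 * (N + of_nat (card K) - 2) * N)"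
    unfolding distrib_left[of N] joins cuts distrib_left[symmetric] by (simp add: algebra_simps)
  also have "\<dots> = N * (2 * (N + of_nat (card K) - 2) * (z * N) * P)"
    by (simp only: mult_ac)
  finally have "?joins + ?cuts = 2 * (N + of_nat (card K) - 2) * (z * N) * P"
    using N by (simp only: mult_cancel_left) simp
  also have "z * N = N ^ card K / N ^ 3"
    using N by (simp add: z_def power4_eq_xxxx power3_eq_cube)
  finally show ?thesis
    by (simp only: P_def)
qed

subsection \<open>Cycles of a permutation and multiplication by a transposition\<close>

definition perm_cycles :: "'a set \<Rightarrow> ('a \<Rightarrow> 'a) \<Rightarrow> 'a set set" where
  "perm_cycles A f = orbit f ` A"

locale finite_perm =
  fixes A :: "'a set" and f :: "'a \<Rightarrow> 'a"
  assumes fin: "finite A" and perm: "f permutes A"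
begin

lemma permutation: "permutation f"
  using fin perm by (auto simp: permutation_permutes)

lemma self_in_orbit: "x \<in> orbit f x"
  by (rule permutation_self_in_orbit[OF permutation])

lemma orbit_eq: "y \<in> orbit f x \<Longrightarrow> orbit f y = orbit f x"
  by (rule orbit_cyclic_eq3[OF cyclic_on_orbit'[OF permutation]])

lemma orbit_subset_A: "x \<in> A \<Longrightarrow> orbit f x \<subseteq> A"
  by (rule permutes_orbit_subset[OF perm])

lemma perm_cycle_eq: "C \<in> perm_cycles A f \<Longrightarrow> x \<in> C \<Longrightarrow> C = orbit f x"
  unfolding perm_cycles_def by (metis imageE orbit_eq)

lemma orbit_in_perm_cycles: "x \<in> A \<Longrightarrow> orbit f x \<in> perm_cycles A f"
  by (simp add: perm_cycles_def)

lemma perm_cycle_subset: "C \<in> perm_cycles A f \<Longrightarrow> C \<subseteq> A"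
  unfolding perm_cycles_def using orbit_subset_A by blast

lemma Union_perm_cycles: "\<Union>(perm_cycles A f) = A"
  using perm_cycle_subset self_in_orbit by (auto simp: perm_cycles_def)

lemma disjoint_perm_cycles: "disjoint (perm_cycles A f)"
  by (rule disjointI) (metis perm_cycle_eq disjoint_iff)

lemma finite_perm_cycles: "finite (perm_cycles A f)"
  using fin by (simp add: perm_cycles_def)

lemma finite_perm_cycle: "C \<in> perm_cycles A f \<Longrightarrow> finite C"
  using perm_cycle_subset fin finite_subset by blast

lemma perm_cycle_nonempty: "C \<in> perm_cycles A f \<Longrightarrow> C \<noteq> {}"
  by (auto simp: perm_cycles_def orbit_nonempty)

lemma card_perm_cycle: "C \<in> perm_cycles A f \<Longrightarrow> card C \<ge> 1"
  using perm_cycle_nonempty finite_perm_cycle by (auto simp: Suc_le_eq card_gt_0_iff)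

lemma sum_card_perm_cycles: "sum card (perm_cycles A f) = card A"
  using card_Union_disjoint[OF disjoint_perm_cycles finite_perm_cycle] Union_perm_cycles by simp

lemma invariant_image_eq: "B \<subseteq> A \<Longrightarrow> f ` B \<subseteq> B \<Longrightarrow> f ` B = B"
  using fin perm finite_subset by (intro endo_inj_surj) (auto intro: permutes_inj_on)

lemma invariant_compl: "B \<subseteq> A \<Longrightarrow> f ` B \<subseteq> B \<Longrightarrow> f ` (A - B) \<subseteq> A - B"
  using invariant_image_eq[of B] permutes_inj[OF perm] permutes_image[OF perm]
  by (simp add: image_set_diff)

lemma perm_restrict_permutes:
  assumes "B \<subseteq> A" "f ` B \<subseteq> B"
  shows "perm_restrict f B permutes B"
proof (rule bij_imp_permutes)
  have "inj_on f B"
    using perm by (rule permutes_inj_on)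
  then have "bij_betw f B B"
    using invariant_image_eq[OF assms] by (auto simp: bij_betw_def)
  then show "bij_betw (perm_restrict f B) B B"
    by (rule bij_betw_cong[THEN iffD1, rotated]) (simp add: perm_restrict_simps)
qed (simp add: perm_restrict_simps)

lemma orbit_perm_restrict:
  assumes "f ` B \<subseteq> B" "x \<in> B"
  shows "orbit (perm_restrict f B) x = orbit f x"
  using assms by (intro orbit_cong0[of x B]) (auto simp: perm_restrict_def)

lemma perm_restrict_compose:
  assumes "B \<subseteq> A" "f ` B \<subseteq> B"
  shows "perm_restrict f B \<circ> perm_restrict f (A - B) = f"
  using invariant_compl[OF assms] assms permutes_not_in[OF perm]
  by (fastforce simp: perm_restrict_def fun_eq_iff)

lemma Union_cycles_invariant:
  assumes "S \<subseteq> perm_cycles A f"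
  shows "\<Union>S \<subseteq> A" "f ` \<Union>S \<subseteq> \<Union>S"
proof -
  show "\<Union>S \<subseteq> A"
    using assms perm_cycle_subset by blast
  show "f ` \<Union>S \<subseteq> \<Union>S"
  proof clarify
    fix x C assume "x \<in> C" "C \<in> S"
    then have "f x \<in> C"
      using perm_cycle_eq[of C x] orbit.base[of f x] assms by auto
    then show "f x \<in> \<Union>S" using \<open>C \<in> S\<close> by blast
  qed
qed

lemma perm_cycles_restrict:
  assumes "f ` B \<subseteq> B"
  shows "perm_cycles B (perm_restrict f B) = orbit f ` B"
  unfolding perm_cycles_def by (intro image_cong refl orbit_perm_restrict[OF assms])

lemma perm_cycles_Union:
  assumes "S \<subseteq> perm_cycles A f"
  shows "perm_cycles (\<Union>S) (perm_restrict f (\<Union>S)) = S"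
  unfolding perm_cycles_restrict[OF Union_cycles_invariant(2)[OF assms]]
proof (intro equalityI subsetI)
  fix C assume "C \<in> orbit f ` \<Union>S"
  then obtain x D where "x \<in> D" "D \<in> S" "C = orbit f x" by blast
  then show "C \<in> S" using perm_cycle_eq[of D x] assms by auto
next
  fix C assume C: "C \<in> S"
  then obtain x where "x \<in> C" using perm_cycle_nonempty assms by blast
  then have "C = orbit f x" using perm_cycle_eq[of C x] assms C by auto
  then show "C \<in> orbit f ` \<Union>S" using C \<open>x \<in> C\<close> by blast
qed

lemma Diff_Union_cycles:
  assumes "S \<subseteq> perm_cycles A f"
  shows "A - \<Union>S = \<Union>(perm_cycles A f - S)"
proof (intro equalityI subsetI)
  fix x assume "x \<in> A - \<Union>S"
  then show "x \<in> \<Union>(perm_cycles A f - S)"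
    using orbit_in_perm_cycles self_in_orbit by blast
next
  fix x assume "x \<in> \<Union>(perm_cycles A f - S)"
  then obtain C where C: "x \<in> C" "C \<in> perm_cycles A f" "C \<notin> S" by blast
  have "D \<notin> S" if "x \<in> D" for D
    using that C assms perm_cycle_eq[of C x] perm_cycle_eq[of D x] by auto
  then show "x \<in> A - \<Union>S"
    using C perm_cycle_subset by blast
qed

lemma perm_cycles_Diff_Union:
  assumes "S \<subseteq> perm_cycles A f"
  shows "perm_cycles (A - \<Union>S) (perm_restrict f (A - \<Union>S)) = perm_cycles A f - S"
  unfolding Diff_Union_cycles[OF assms] by (rule perm_cycles_Union) blast

text \<open>Splitting a factorization produces sums over invariant sets; this turns them into sums
  over sets of cycles, the form in which the Hurwitz identities apply.\<close>

lemma bij_betw_Union_cycles: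
  "bij_betw Union (Pow (perm_cycles A f)) {B. B \<subseteq> A \<and> f ` B \<subseteq> B}"
proof (rule bij_betwI[where g = "\<lambda>B. perm_cycles B (perm_restrict f B)"])
  show "Union \<in> Pow (perm_cycles A f) \<rightarrow> {B. B \<subseteq> A \<and> f ` B \<subseteq> B}"
    using Union_cycles_invariant by auto
  show "(\<lambda>B. perm_cycles B (perm_restrict f B)) \<in> {B. B \<subseteq> A \<and> f ` B \<subseteq> B} \<rightarrow> Pow (perm_cycles A f)"
  proof
    fix B assume "B \<in> {B. B \<subseteq> A \<and> f ` B \<subseteq> B}"
    then show "perm_cycles B (perm_restrict f B) \<in> Pow (perm_cycles A f)"
      unfolding perm_cycles_def by (auto simp: orbit_perm_restrict)
  qed
  show "perm_cycles (\<Union>S) (perm_restrict f (\<Union>S)) = S" if "S \<in> Pow (perm_cycles A f)" for S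
    using that perm_cycles_Union by auto
  show "\<Union>(perm_cycles B (perm_restrict f B)) = B" if B: "B \<in> {B. B \<subseteq> A \<and> f ` B \<subseteq> B}" for B
  proof -
    interpret B: finite_perm B "perm_restrict f B"
      using B fin finite_subset[of B A] perm_restrict_permutes by unfold_locales auto
    show ?thesis by (rule B.Union_perm_cycles)
  qed
qed

section \<open>Cutting and joining cycles by a transposition\<close>

lemma card_orbit_pos: "0 < card (orbit f a)"
  using orbit_nonempty finite_orbit[OF self_in_orbit] by (simp add: card_gt_0_iff)

lemma funpow_card_orbit: "(f ^^ card (orbit f a)) a = a"
  and inj_on_funpow_orbit: "inj_on (\<lambda>i. (f ^^ i) a) {..<card (orbit f a)}"
  and orbit_conv_funpow: "orbit f a = (\<lambda>i. (f ^^ i) a) ` {..<card (orbit f a)}"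
proof -
  define m where "m = funpow_dist1 f a a"
  have inj: "inj_on (\<lambda>i. (f ^^ i) a) {..<m}"
    using inj_on_funpow_dist1[OF self_in_orbit] by (simp only: m_def lessThan_atLeast0)
  have orb: "orbit f a = (\<lambda>i. (f ^^ i) a) ` {..<m}"
    using orbit_conv_funpow_dist1[OF self_in_orbit] by (simp only: m_def lessThan_atLeast0)
  have c: "card (orbit f a) = m"
    unfolding orb card_image[OF inj] by simp
  show "(f ^^ card (orbit f a)) a = a"
    unfolding c m_def by (rule funpow_dist1_prop[OF self_in_orbit])
  show "inj_on (\<lambda>i. (f ^^ i) a) {..<card (orbit f a)}" "orbit f a = (\<lambda>i. (f ^^ i) a) ` {..<card (orbit f a)}"
    unfolding c by (fact inj, fact orb)
qed

text \<open>A partner of a in its own cycle is recorded by its distance k from a, since k becomes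
  the length of one piece when the cycle is cut there.\<close>

lemma sum_orbit_Diff:
  "(\<Sum>b\<in>orbit f a - {a}. g b) = (\<Sum>k=1..<card (orbit f a). g ((f ^^ k) a))"
proof -
  let ?m = "card (orbit f a)"
  have "{..<?m} - {0} = {1..<?m}" by auto
  moreover have "0 < ?m"
    by (rule card_orbit_pos)
  ultimately have "orbit f a - {a} = (\<lambda>i. (f ^^ i) a) ` {1..<?m}"
    using inj_on_image_set_diff[OF inj_on_funpow_orbit[of a], of "{..<?m}" "{0}"]
      orbit_conv_funpow[of a] by auto
  moreover have "inj_on (\<lambda>i. (f ^^ i) a) {1..<?m}"
    by (rule inj_on_subset[OF inj_on_funpow_orbit]) auto
  ultimately show ?thesis
    by (simp add: sum.reindex)
qed

lemma transpose_comp_permutes: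
  assumes "a \<in> A" "b \<in> A"
  shows "Transposition.transpose a b \<circ> f permutes A"
  using perm permutes_swap_id[OF assms] by (rule permutes_compose)

text \<open>The transposition acts after f, so f' follows f along the cycle of a except that the
  step into b is diverted to a and the step back into a is diverted to b. The iterates 0..k-1 and
  k..m-1 of a thus close up separately.\<close>

lemma perm_cycles_cut:
  fixes a :: 'a and k :: nat
  defines "C \<equiv> orbit f a"
  defines "b \<equiv> (f ^^ k) a"
  defines "f' \<equiv> Transposition.transpose a b \<circ> f"
  assumes a: "a \<in> A" and k: "1 \<le> k" "k < card C"
  shows "orbit f' a \<inter> orbit f' b = {}"
    and "orbit f' a \<union> orbit f' b = C"
    and "card (orbit f' a) = k"
    and "perm_cycles A f' = insert (orbit f' a) (insert (orbit f' b) (perm_cycles A f - {C}))"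
proof -
  define g where "g i = (f ^^ i) a" for i
  define m where "m = card C"
  have inj: "inj_on g {..<m}" and C: "C = g ` {..<m}" and gm: "g m = a"
    using inj_on_funpow_orbit[of a] orbit_conv_funpow[of a] funpow_card_orbit[of a]
    by (simp_all add: g_def[abs_def] C_def m_def)
  have g0: "g 0 = a" and gk: "g k = b" and gS: "f (g i) = g (Suc i)" for i
    by (simp_all add: g_def b_def)
  have g_eq: "g i = g j \<longleftrightarrow> i = j" if "i < m" "j < m" for i j
    using inj that by (auto simp: inj_on_def)
  have km: "k < m" "0 < m" using k by (auto simp: m_def)
  have f'g: "f' (g i) = g (Suc i)" if "Suc i < m" "Suc i \<noteq> k" for i
    using that g_eq[of "Suc i" 0] g_eq[of "Suc i" k] km
    by (simp add: f'_def gS g0 gk Transposition.transpose_def)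
  have f'k: "f' (g (k - 1)) = a"
    using k gS[of "k - 1"] by (simp add: f'_def gk)
  have f'm: "f' (g (m - 1)) = b"
    using km gS[of "m - 1"] by (simp add: f'_def gm)
  have iter1: "(f' ^^ i) a = g i" if "i < k" for i
    using that km by (induction i) (simp_all add: g0 f'g)
  have "(f' ^^ k) a = a"
    using iter1[of "k - 1"] k f'k by (cases k) auto
  then have "orbit f' a = {(f' ^^ i) a |i. i < k}"
    using k by (intro orbit_altdef_bounded) auto
  also have "\<dots> = g ` {..<k}"
    using iter1 by (auto simp: image_iff) metis+
  finally have o1: "orbit f' a = g ` {..<k}" .
  have iter2: "(f' ^^ i) b = g (k + i)" if "k + i < m" for i
    using that km by (induction i) (simp_all add: gk f'g)
  have "(f' ^^ (m - k)) b = b"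
  proof -
    obtain j where j: "m = Suc (k + j)"
      using km less_imp_Suc_add by blast
    then show ?thesis
      using iter2[of j] f'm by simp
  qed
  then have "orbit f' b = {(f' ^^ i) b |i. i < m - k}"
    using km by (intro orbit_altdef_bounded) auto
  also have "\<dots> = g ` {k..<m}"
  proof (intro equalityI subsetI)
    fix y assume "y \<in> g ` {k..<m}"
    then obtain i where "y = g i" "k \<le> i" "i < m" by auto
    then have "y = (f' ^^ (i - k)) b" "i - k < m - k"
      using iter2[of "i - k"] by auto
    then show "y \<in> {(f' ^^ i) b |i. i < m - k}" by blast
  qed (auto simp: iter2 less_diff_conv2 add.commute)
  finally have o2: "orbit f' b = g ` {k..<m}" .
  show disj: "orbit f' a \<inter> orbit f' b = {}"
    unfolding o1 o2 using km by (auto simp: g_eq)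
  show un: "orbit f' a \<union> orbit f' b = C"
    unfolding o1 o2 C using km by (auto simp flip: image_Un intro!: arg_cong[of _ _ "image g"])
  have "inj_on g {..<k}"
    using inj km by (auto intro: inj_on_subset)
  then show "card (orbit f' a) = k"
    unfolding o1 by (simp add: card_image)
  have b: "b \<in> A"
    using un self_in_orbit orbit_subset_A[OF a] orbit_nonempty km
    unfolding C_def[symmetric] C gk[symmetric] by auto
  interpret f': finite_perm A f'
    unfolding f'_def using fin transpose_comp_permutes[OF a b] by unfold_locales
  have CA: "C \<subseteq> A"
    unfolding C_def by (rule orbit_subset_A[OF a])
  have "orbit f' ` C = {orbit f' a, orbit f' b}"
  proof -
    have "orbit f' x = orbit f' a \<or> orbit f' x = orbit f' b" if "x \<in> C" for x
      using that f'.orbit_eq unfolding un[symmetric] by blast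
    moreover have "a \<in> C" "b \<in> C"
      using f'.self_in_orbit un by auto
    ultimately show ?thesis by auto
  qed
  moreover have "orbit f' ` (A - C) = perm_cycles A f - {C}"
  proof -
    have "orbit f' x = orbit f x" if "x \<in> A - C" for x
    proof (rule orbit_cong[OF self_in_orbit])
      fix s assume "s \<in> orbit f x"
      then have "f s \<in> orbit f x" by (rule orbit.step)
      then have "f s \<notin> C"
        using that orbit_eq[of "f s" x] orbit_eq[of "f s" a] self_in_orbit by (auto simp: C_def)
      then show "f' s = f s"
        using f'.self_in_orbit un by (auto simp: f'_def Transposition.transpose_def)
    qed
    then have "orbit f' ` (A - C) = orbit f ` (A - C)"
      by (intro image_cong) auto
    also have "\<dots> = perm_cycles A f - {C}"
      using orbit_eq self_in_orbit by (auto simp: perm_cycles_def C_def)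
    finally show ?thesis .
  qed
  moreover have "perm_cycles A f' = orbit f' ` C \<union> orbit f' ` (A - C)"
    using CA by (auto simp: perm_cycles_def)
  ultimately show "perm_cycles A f' = insert (orbit f' a) (insert (orbit f' b) (perm_cycles A f - {C}))"
    by auto
qed

lemma same_orbit_obtain:
  assumes "b \<in> orbit f a" "b \<noteq> a"
  obtains k where "1 \<le> k" "k < card (orbit f a)" "b = (f ^^ k) a"
proof -
  obtain k where "k < card (orbit f a)" "b = (f ^^ k) a"
    using assms(1) orbit_conv_funpow[of a] by auto
  moreover have "k \<noteq> 0"
    using assms(2) calculation by (auto intro: ccontr)
  ultimately show thesis by (intro that[of k]) auto
qed

text \<open>A join is a cut read backwards. Starting at a, f' agrees with f until the return to a is
  diverted to b, so b lies on the cycle of a under f'; cutting f' at b then gives back f.\<close>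

lemma perm_cycles_join:
  assumes a: "a \<in> A" and b: "b \<in> A" "b \<notin> orbit f a"
  defines "f' \<equiv> Transposition.transpose a b \<circ> f"
  shows "b \<in> orbit f' a"
    and "perm_cycles A f' = insert (orbit f a \<union> orbit f b) (perm_cycles A f - {orbit f a, orbit f b})"
    and "orbit f a \<union> orbit f b \<notin> perm_cycles A f - {orbit f a, orbit f b}"
proof -
  define m where "m = card (orbit f a)"
  have m: "0 < m"
    unfolding m_def by (rule card_orbit_pos)
  have iter: "(f' ^^ i) a = (f ^^ i) a" if "i < m" for i
    using that
  proof (induction i)
    case (Suc i)
    have "(f ^^ Suc i) a \<noteq> (f ^^ 0) a"
      using inj_onD[OF inj_on_funpow_orbit[of a], of "Suc i" 0] Suc.prems
      by (auto simp: m_def simp del: funpow.simps)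
    moreover have "(f ^^ Suc i) a \<noteq> b"
      using b(2) funpow_in_orbit[OF self_in_orbit, of "Suc i" a] by blast
    ultimately show ?case
      using Suc by (simp add: f'_def Transposition.transpose_def)
  qed simp
  obtain j where j: "m = Suc j"
    using m gr0_implies_Suc by blast
  have "(f' ^^ Suc j) a = f' ((f ^^ j) a)"
    using iter[of j] j by simp
  also have "\<dots> = Transposition.transpose a b ((f ^^ Suc j) a)"
    by (simp add: f'_def)
  also have "\<dots> = b"
    using funpow_card_orbit[of a] j by (simp only: m_def transpose_apply_first)
  finally show b': "b \<in> orbit f' a"
    by (auto simp: orbit_altdef simp del: funpow.simps)
  interpret f': finite_perm A f'
    unfolding f'_def using fin transpose_comp_permutes[OF a b(1)] by unfold_locales
  have "b \<noteq> a"
    using b(2) self_in_orbit by blast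
  then obtain k where k: "1 \<le> k" "k < card (orbit f' a)" "b = (f' ^^ k) a"
    using f'.same_orbit_obtain[OF b'] by blast
  have "Transposition.transpose a ((f' ^^ k) a) \<circ> f' = f"
    using k(3) by (simp add: f'_def fun_eq_iff)
  with f'.perm_cycles_cut[OF a k(1,2)] k(3)
  have un: "orbit f a \<union> orbit f b = orbit f' a"
    and cyc: "perm_cycles A f = insert (orbit f a) (insert (orbit f b) (perm_cycles A f' - {orbit f' a}))"
    by simp_all
  have notin: "orbit f a \<notin> perm_cycles A f' - {orbit f' a}" "orbit f b \<notin> perm_cycles A f' - {orbit f' a}"
    using f'.perm_cycle_eq[of _ a] f'.perm_cycle_eq[of _ b] f'.orbit_eq[OF b'] self_in_orbit by blast+
  then have *: "perm_cycles A f - {orbit f a, orbit f b} = perm_cycles A f' - {orbit f' a}"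
    unfolding cyc by auto
  show "perm_cycles A f' = insert (orbit f a \<union> orbit f b) (perm_cycles A f - {orbit f a, orbit f b})"
    unfolding un * using f'.orbit_in_perm_cycles[OF a] by auto
  show "orbit f a \<union> orbit f b \<notin> perm_cycles A f - {orbit f a, orbit f b}"
    unfolding un * by simp
qed

end

subsection \<open>Factorizations into transpositions\<close>

definition ordered_pairs :: "'a set \<Rightarrow> ('a \<times> 'a) set" where
  "ordered_pairs A = {(a, b). a \<in> A \<and> b \<in> A \<and> a \<noteq> b}"

fun pair_prod :: "('a \<times> 'a) list \<Rightarrow> 'a \<Rightarrow> 'a" where
  "pair_prod [] = id"
| "pair_prod ((a, b) # ps) = Transposition.transpose a b \<circ> pair_prod ps"

definition closed_under :: "('a \<times> 'a) list \<Rightarrow> 'a set \<Rightarrow> bool" where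
  "closed_under ps B \<longleftrightarrow> (\<forall>(a, b)\<in>set ps. a \<in> B \<longleftrightarrow> b \<in> B)"

text \<open>Transitivity as connectedness of the graph with the given pairs as edges. Unlike the
  generated group, closed sets restrict directly to subsets and to sublists.\<close>

definition connects :: "'a set \<Rightarrow> ('a \<times> 'a) list \<Rightarrow> bool" where
  "connects A ps \<longleftrightarrow> (\<forall>B\<subseteq>A. B \<noteq> {} \<longrightarrow> closed_under ps B \<longrightarrow> B = A)"

text \<open>Transpositions are listed as ordered pairs, so that every factorization of length \<open>r\<close> is
  counted \<open>2 ^ r\<close> times; this removes the factors \<open>1 / 2\<close> from the join-cut recurrence.\<close>

definition pair_factorizations :: "'a set \<Rightarrow> ('a \<Rightarrow> 'a) \<Rightarrow> nat \<Rightarrow> ('a \<times> 'a) list set" where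
  "pair_factorizations A f r =
     {ps. length ps = r \<and> set ps \<subseteq> ordered_pairs A \<and> pair_prod ps = f \<and> connects A ps}"

lemma finite_ordered_pairs: "finite A \<Longrightarrow> finite (ordered_pairs A)"
  by (rule finite_subset[of _ "A \<times> A"]) (auto simp: ordered_pairs_def)

lemma finite_pair_factorizations: "finite A \<Longrightarrow> finite (pair_factorizations A f r)"
  by (rule finite_subset[OF _ finite_lists_length_eq[OF finite_ordered_pairs, of A r]])
    (auto simp: pair_factorizations_def)

lemma pair_prod_permutes: "set ps \<subseteq> ordered_pairs A \<Longrightarrow> pair_prod ps permutes A"
proof (induction ps rule: pair_prod.induct)
  case (2 a b ps)
  then show ?case
    unfolding pair_prod.simps
    by (intro permutes_compose permutes_swap_id) (auto simp: ordered_pairs_def)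
qed (simp add: permutes_id)

lemma closed_underD: "closed_under ps B \<Longrightarrow> (a, b) \<in> set ps \<Longrightarrow> a \<in> B \<longleftrightarrow> b \<in> B"
  by (auto simp: closed_under_def)

lemma closed_under_Cons: "closed_under ((a, b) # ps) B \<longleftrightarrow> (a \<in> B \<longleftrightarrow> b \<in> B) \<and> closed_under ps B"
  by (auto simp: closed_under_def)

lemma closed_under_Diff: "closed_under ps B \<Longrightarrow> closed_under ps C \<Longrightarrow> closed_under ps (B - C)"
  by (fastforce simp: closed_under_def)

lemma closed_under_Int: "closed_under ps B \<Longrightarrow> closed_under ps C \<Longrightarrow> closed_under ps (B \<inter> C)"
  by (fastforce simp: closed_under_def)

lemma closed_under_whole: "set ps \<subseteq> ordered_pairs A \<Longrightarrow> closed_under ps A"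
  by (auto simp: closed_under_def ordered_pairs_def)

lemma closed_under_filter: "closed_under ps B \<Longrightarrow> closed_under (filter P ps) B"
  by (auto simp: closed_under_def)

lemma connectsD: "connects A ps \<Longrightarrow> B \<subseteq> A \<Longrightarrow> B \<noteq> {} \<Longrightarrow> closed_under ps B \<Longrightarrow> B = A"
  by (auto simp: connects_def)

text \<open>Testing the first entry is enough: if the list is closed under B, both entries of a pair
  lie on the same side.\<close>

abbreviation starts_in :: "'a set \<Rightarrow> 'a \<times> 'a \<Rightarrow> bool" where
  "starts_in B p \<equiv> fst p \<in> B"

abbreviation starts_out :: "'a set \<Rightarrow> 'a \<times> 'a \<Rightarrow> bool" where
  "starts_out B p \<equiv> \<not> starts_in B p"

lemma closed_under_iff_split:
  assumes "set ps \<subseteq> ordered_pairs A"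
  shows "closed_under ps B \<longleftrightarrow>
    set (filter (starts_in B) ps) \<subseteq> ordered_pairs B \<and> set (filter (starts_out B) ps) \<subseteq> ordered_pairs (A - B)"
  using assms by (fastforce simp: closed_under_def ordered_pairs_def)

text \<open>A transposition of two points outside B commutes with every permutation of B, so it can
  be moved past the product of the inner ones.\<close>

lemma pair_prod_split:
  assumes "set (filter (starts_in B) ps) \<subseteq> ordered_pairs B"
    and "set (filter (starts_out B) ps) \<subseteq> ordered_pairs (A - B)"
  shows "pair_prod ps = pair_prod (filter (starts_in B) ps) \<circ> pair_prod (filter (starts_out B) ps)"
  using assms
proof (induction ps rule: pair_prod.induct)
  case (2 a b ps)
  define g1 g2 where "g1 = pair_prod (filter (starts_in B) ps)" and "g2 = pair_prod (filter (starts_out B) ps)"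
  have IH: "pair_prod ps = g1 \<circ> g2"
    unfolding g1_def g2_def using 2 by (auto split: if_splits)
  show ?case
  proof (cases "a \<in> B")
    case True
    then show ?thesis using IH by (simp add: g1_def g2_def comp_assoc)
  next
    case False
    then have b: "b \<notin> B"
      using "2.prems" by (auto simp: ordered_pairs_def)
    have g1: "g1 permutes B"
      unfolding g1_def using "2.prems"(1) False by (intro pair_prod_permutes) simp
    have "Transposition.transpose a b (g1 y) = g1 (Transposition.transpose a b y)" for y
    proof (cases "y \<in> B")
      case True
      then have "g1 y \<in> B" using g1 by (simp add: permutes_in_image)
      then show ?thesis
        using True False b by (auto simp: Transposition.transpose_def)
    next
      case y: False
      then show ?thesis
        using False b permutes_not_in[OF g1] by (auto simp: Transposition.transpose_def)
    qed
    then show ?thesis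
      using False IH by (auto simp: g1_def g2_def fun_eq_iff)
  qed
qed simp

section \<open>Factorizations whose graph has two components\<close>

lemma perm_restrict_comp_disjoint:
  assumes "g permutes B" "h permutes C" "B \<inter> C = {}"
  shows "perm_restrict (g \<circ> h) B = g" "perm_restrict (g \<circ> h) C = h" "(g \<circ> h) ` B \<subseteq> B"
proof -
  have h: "h x = x" if "x \<in> B" for x
    using permutes_not_in[OF assms(2)] that assms(3) by blast
  have g: "g (h x) = h x" if "x \<in> C" for x
    using permutes_in_image[OF assms(2), of x] permutes_not_in[OF assms(1)] that assms(3) by blast
  show "perm_restrict (g \<circ> h) B = g"
    using h permutes_not_in[OF assms(1)] by (auto simp: perm_restrict_def fun_eq_iff)
  show "perm_restrict (g \<circ> h) C = h"
    using g permutes_not_in[OF assms(2)] by (auto simp: perm_restrict_def fun_eq_iff)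
  show "(g \<circ> h) ` B \<subseteq> B"
    using h permutes_in_image[OF assms(1)] by auto
qed

text \<open>For a proper nonempty B the graph has exactly the components B and A - B. The set B is a
  parameter so that counts can be summed over it.\<close>

definition split_factorizations :: "'a set \<Rightarrow> 'a set \<Rightarrow> ('a \<Rightarrow> 'a) \<Rightarrow> nat \<Rightarrow> ('a \<times> 'a) list set" where
  "split_factorizations A B f r = {ps. length ps = r \<and> set ps \<subseteq> ordered_pairs A \<and> pair_prod ps = f \<and>
     closed_under ps B \<and> connects B (filter (starts_in B) ps) \<and> connects (A - B) (filter (starts_out B) ps)}"

lemma split_factorizations_invariant:
  assumes "ps \<in> split_factorizations A B f r"
  shows "f ` B \<subseteq> B"
    and "pair_prod (filter (starts_in B) ps) = perm_restrict f B"
    and "pair_prod (filter (starts_out B) ps) = perm_restrict f (A - B)"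
proof -
  have sets: "set (filter (starts_in B) ps) \<subseteq> ordered_pairs B" "set (filter (starts_out B) ps) \<subseteq> ordered_pairs (A - B)"
    using assms closed_under_iff_split[of ps A B] by (auto simp: split_factorizations_def)
  have f: "f = pair_prod (filter (starts_in B) ps) \<circ> pair_prod (filter (starts_out B) ps)"
    using pair_prod_split[OF sets] assms by (simp add: split_factorizations_def)
  note * = perm_restrict_comp_disjoint[OF pair_prod_permutes[OF sets(1)] pair_prod_permutes[OF sets(2)] Diff_disjoint, folded f]
  show "f ` B \<subseteq> B"
    and "pair_prod (filter (starts_in B) ps) = perm_restrict f B"
    and "pair_prod (filter (starts_out B) ps) = perm_restrict f (A - B)"
    using * by auto
qed

text \<open>Each such list is a shuffle of connected factorizations of the two restrictions of f.
  Filtering recovers both, so different pairs have disjoint sets of shuffles, and a pair of lengths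
  i and r - i has r choose i of them.\<close>

lemma card_split_factorizations:
  assumes "finite A" "B \<subseteq> A" "f permutes A" "f ` B \<subseteq> B"
  shows "card (split_factorizations A B f r) = (\<Sum>i\<le>r. (r choose i) *
     card (pair_factorizations B (perm_restrict f B) i) * card (pair_factorizations (A - B) (perm_restrict f (A - B)) (r - i)))"
proof -
  interpret finite_perm A f
    using assms by unfold_locales
  define T where "T i = pair_factorizations B (perm_restrict f B) i \<times> pair_factorizations (A - B) (perm_restrict f (A - B)) (r - i)" for i
  have fin_B: "finite B" "finite (A - B)"
    using assms(1,2) finite_subset by auto
  have fin_T: "finite (T i)" for i
    unfolding T_def using fin_B by (intro finite_cartesian_product finite_pair_factorizations)
  have T: "xs \<in> pair_factorizations B (perm_restrict f B) i" "ys \<in> pair_factorizations (A - B) (perm_restrict f (A - B)) (r - i)"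
    if "(xs, ys) \<in> T i" for xs ys i
    using that by (auto simp: T_def)
  have part: "List.partition (starts_in B) zs = (xs, ys)" if "(xs, ys) \<in> T i" "zs \<in> shuffles xs ys" for xs ys zs i
    using inv_image_partition[of xs "starts_in B" ys] T[OF that(1)] that(2)
    by (fastforce simp: pair_factorizations_def ordered_pairs_def)
  have "split_factorizations A B f r = (\<Union>p\<in>(\<Union>i\<le>r. T i). shuffles (fst p) (snd p))" (is "?L = ?R")
  proof (intro equalityI subsetI)
    fix ps assume ps: "ps \<in> ?L"
    let ?xs = "filter (starts_in B) ps" and ?ys = "filter (starts_out B) ps"
    have len: "length ?xs + length ?ys = r"
      using ps sum_length_filter_compl[of "starts_in B" ps] by (simp add: split_factorizations_def)
    have "(?xs, ?ys) \<in> T (length ?xs)"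
      using ps closed_under_iff_split[of ps A B] split_factorizations_invariant[OF ps] len
      by (auto simp: T_def pair_factorizations_def split_factorizations_def)
    moreover have "length ?xs \<le> r"
      using len by linarith
    moreover have "ps \<in> shuffles ?xs ?ys"
      by (rule partition_in_shuffles)
    ultimately show "ps \<in> ?R" by fastforce
  next
    fix ps assume "ps \<in> ?R"
    then obtain i xs ys where i: "i \<le> r" and xy: "(xs, ys) \<in> T i" and ps: "ps \<in> shuffles xs ys"
      by auto
    have f: "filter (starts_in B) ps = xs" "filter (starts_out B) ps = ys"
      using part[OF xy ps] by (auto simp: o_def)
    have sets: "set xs \<subseteq> ordered_pairs B" "set ys \<subseteq> ordered_pairs (A - B)"
      using T[OF xy] by (auto simp: pair_factorizations_def)
    have "set ps \<subseteq> ordered_pairs A"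
      using set_shuffles[OF ps] sets assms(2) by (auto simp: ordered_pairs_def)
    moreover have "closed_under ps B"
      using closed_under_iff_split[OF calculation, of B] f sets by simp
    moreover have "pair_prod ps = f"
      using pair_prod_split[of B ps A] f sets T[OF xy] perm_restrict_compose[OF assms(2,4)]
      by (simp add: pair_factorizations_def)
    moreover have "length ps = r"
      using length_shuffles[OF ps] T[OF xy] i by (simp add: pair_factorizations_def)
    ultimately show "ps \<in> ?L"
      using T[OF xy] f by (simp add: split_factorizations_def pair_factorizations_def)
  qed
  also have "card \<dots> = (\<Sum>p\<in>(\<Union>i\<le>r. T i). card (shuffles (fst p) (snd p)))"
  proof (rule card_UN_disjoint)
    show "\<forall>p\<in>\<Union>i\<le>r. T i. \<forall>q\<in>\<Union>i\<le>r. T i. p \<noteq> q \<longrightarrow> shuffles (fst p) (snd p) \<inter> shuffles (fst q) (snd q) = {}"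
    proof (intro ballI impI)
      fix p q
      assume "p \<in> (\<Union>i\<le>r. T i)" "q \<in> (\<Union>i\<le>r. T i)" "p \<noteq> q"
      then show "shuffles (fst p) (snd p) \<inter> shuffles (fst q) (snd q) = {}"
        using part[of "fst p" "snd p"] part[of "fst q" "snd q"] by (auto simp del: partition_filter_conv) (metis prod.inject surjective_pairing)+
    qed
  qed (use fin_T in auto)
  also have "\<dots> = (\<Sum>i\<le>r. \<Sum>p\<in>T i. card (shuffles (fst p) (snd p)))"
    using fin_T by (intro sum.UNION_disjoint) (auto simp: T_def pair_factorizations_def)
  also have "\<dots> = (\<Sum>i\<le>r. (r choose i) *
     card (pair_factorizations B (perm_restrict f B) i) * card (pair_factorizations (A - B) (perm_restrict f (A - B)) (r - i)))"
  proof (rule sum.cong[OF refl])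
    fix i assume i: "i \<in> {..r}"
    have "card (shuffles (fst p) (snd p)) = r choose i" if "p \<in> T i" for p
    proof -
      have "(fst p, snd p) \<in> T i" using that by simp
      note T = T[OF this]
      have "set (fst p) \<inter> set (snd p) = {}"
        using T by (fastforce simp: pair_factorizations_def ordered_pairs_def)
      then show ?thesis
        using card_disjoint_shuffles[of "fst p" "snd p"] T i by (simp add: pair_factorizations_def)
    qed
    then have "(\<Sum>p\<in>T i. card (shuffles (fst p) (snd p))) = card (T i) * (r choose i)"
      by simp
    then show "(\<Sum>p\<in>T i. card (shuffles (fst p) (snd p))) = (r choose i) *
     card (pair_factorizations B (perm_restrict f B) i) * card (pair_factorizations (A - B) (perm_restrict f (A - B)) (r - i))"
      by (simp add: T_def card_cartesian_product mult_ac)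
  qed
  finally show ?thesis .
qed

definition pair_factorizations_after :: "'a set \<Rightarrow> 'a \<times> 'a \<Rightarrow> ('a \<Rightarrow> 'a) \<Rightarrow> nat \<Rightarrow> ('a \<times> 'a) list set" where
  "pair_factorizations_after A p f r =
     {ps. length ps = r \<and> set ps \<subseteq> ordered_pairs A \<and> pair_prod ps = f \<and> connects A (p # ps)}"

text \<open>One more edge makes a graph connected exactly if it already was connected or has two
  components, each containing one end of the edge. B is the component of a.\<close>

lemma pair_factorizations_after_eq:
  assumes ab: "a \<in> A" "b \<in> A" "a \<noteq> b"
  shows "pair_factorizations_after A (a, b) f r = pair_factorizations A f r \<union>
    (\<Union>B\<in>{B. B \<subseteq> A \<and> a \<in> B \<and> b \<notin> B}. split_factorizations A B f r)" (is "?L = ?F \<union> ?S")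
proof (intro equalityI subsetI)
  fix ps assume ps: "ps \<in> ?L"
  then have sub: "set ps \<subseteq> ordered_pairs A" and conn: "connects A ((a, b) # ps)"
    by (auto simp: pair_factorizations_after_def)
  show "ps \<in> ?F \<union> ?S"
  proof (cases "connects A ps")
    case True
    then show ?thesis using ps by (simp add: pair_factorizations_after_def pair_factorizations_def)
  next
    case False
    then obtain B0 where B0: "B0 \<subseteq> A" "B0 \<noteq> {}" "closed_under ps B0" "B0 \<noteq> A"
      by (auto simp: connects_def)
    have sep: "a \<in> B \<longleftrightarrow> b \<notin> B" if "B \<subseteq> A" "B \<noteq> {}" "closed_under ps B" "B \<noteq> A" for B
      using connectsD[OF conn that(1,2)] that by (auto simp: closed_under_Cons)
    define B where "B = (if a \<in> B0 then B0 else A - B0)"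
    have B: "B \<subseteq> A" "a \<in> B" "b \<notin> B" "closed_under ps B"
      using sep[OF B0] B0 ab closed_under_Diff[OF closed_under_whole[OF sub]] by (auto simp: B_def)
    have closed_filter: "closed_under ps C" if "C \<subseteq> B" "closed_under (filter (starts_in B) ps) C" for C
      unfolding closed_under_def
    proof clarify
      fix c d assume cd: "(c, d) \<in> set ps"
      show "c \<in> C \<longleftrightarrow> d \<in> C"
        using closed_underD[OF that(2), of c d] closed_underD[OF B(4) cd] that(1) cd by auto
    qed
    have closed_filter': "closed_under ps C" if "C \<subseteq> A - B" "closed_under (filter (starts_out B) ps) C" for C
      unfolding closed_under_def
    proof clarify
      fix c d assume cd: "(c, d) \<in> set ps"
      show "c \<in> C \<longleftrightarrow> d \<in> C"
        using closed_underD[OF that(2), of c d] closed_underD[OF B(4) cd] that(1) cd by auto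
    qed
    \<comment> \<open>A closed set that avoids a and b is also closed under the pair (a, b), which
      connectedness of the whole list excludes. It is used for C and for its complement within B or
      A - B, one of which avoids both points.\<close>
    have no_sep: False if "C \<subseteq> A" "C \<noteq> {}" "closed_under ps C" "a \<notin> C" "b \<notin> C" for C
      using sep[of C] that ab by auto
    have "connects B (filter (starts_in B) ps)"
      unfolding connects_def
    proof (intro allI impI)
      fix C assume C: "C \<subseteq> B" "C \<noteq> {}" "closed_under (filter (starts_in B) ps) C"
      note cl = closed_filter[OF C(1,3)]
      show "C = B"
      proof (rule ccontr)
        assume "C \<noteq> B"
        then show False
          using no_sep[of C] no_sep[of "B - C"] C(1,2) cl closed_under_Diff[OF B(4) cl] B by blast
      qed
    qed
    moreover have "connects (A - B) (filter (starts_out B) ps)"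
      unfolding connects_def
    proof (intro allI impI)
      fix C assume C: "C \<subseteq> A - B" "C \<noteq> {}" "closed_under (filter (starts_out B) ps) C"
      note cl = closed_filter'[OF C(1,3)]
      have "closed_under ps (A - B - C)"
        using closed_under_Diff[OF closed_under_Diff[OF closed_under_whole[OF sub] B(4)] cl] .
      then show "C = A - B"
        using no_sep[of C] no_sep[of "A - B - C"] C(1,2) cl B by blast
    qed
    ultimately have "ps \<in> split_factorizations A B f r"
      using ps B by (simp add: split_factorizations_def pair_factorizations_after_def)
    then show ?thesis using B by blast
  qed
next
  fix ps assume "ps \<in> ?F \<union> ?S"
  then show "ps \<in> ?L"
  proof
    assume "ps \<in> ?F"
    then show ?thesis
      by (auto simp: pair_factorizations_def pair_factorizations_after_def connects_def closed_under_Cons)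
  next
    assume "ps \<in> ?S"
    then obtain B where B: "B \<subseteq> A" "a \<in> B" "b \<notin> B" and ps: "ps \<in> split_factorizations A B f r"
      by blast
    have "connects A ((a, b) # ps)"
      unfolding connects_def
    proof (intro allI impI)
      fix C assume C: "C \<subseteq> A" "C \<noteq> {}" "closed_under ((a, b) # ps) C"
      then have iff: "a \<in> C \<longleftrightarrow> b \<in> C" and cl: "closed_under ps C"
        by (auto simp: closed_under_Cons)
      have clB: "closed_under ps B" "closed_under ps (A - B)"
        using ps closed_under_Diff[OF closed_under_whole, of ps A B] by (auto simp: split_factorizations_def)
      have "C \<inter> B \<noteq> {} \<Longrightarrow> C \<inter> B = B"
        using ps closed_under_filter[OF closed_under_Int[OF cl clB(1)], of "starts_in B"]
        by (intro connectsD[of B]) (auto simp: split_factorizations_def)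
      moreover have "C \<inter> (A - B) \<noteq> {} \<Longrightarrow> C \<inter> (A - B) = A - B"
        using ps closed_under_filter[OF closed_under_Int[OF cl clB(2)], of "starts_out B"]
        by (intro connectsD[of "A - B"]) (auto simp: split_factorizations_def)
      ultimately show "C = A"
        using C(1,2) B ab iff by blast
    qed
    then show ?thesis
      using ps by (simp add: split_factorizations_def pair_factorizations_after_def)
  qed
qed

text \<open>The union is disjoint: a connected list has no proper nonempty closed set, and a split
  list determines B as the component of a. Only sets invariant under f contribute, as f is composed
  of permutations of B and A - B.\<close>

lemma card_pair_factorizations_after:
  assumes "finite A" "f permutes A" and ab: "a \<in> A" "b \<in> A" "a \<noteq> b"
  shows "card (pair_factorizations_after A (a, b) f r) = card (pair_factorizations A f r) +
    (\<Sum>B | B \<subseteq> A \<and> f ` B \<subseteq> B \<and> a \<in> B \<and> b \<notin> B. card (split_factorizations A B f r))"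
proof -
  let ?Bs = "{B. B \<subseteq> A \<and> a \<in> B \<and> b \<notin> B}"
  have fin: "finite ?Bs"
    by (rule finite_subset[of _ "Pow A"]) (use assms in auto)
  have fin_split: "finite (split_factorizations A B f r)" for B
    by (rule finite_subset[OF _ finite_lists_length_eq[OF finite_ordered_pairs[OF assms(1)], of r]])
      (auto simp: split_factorizations_def)
  have le: "B \<subseteq> C" if "B \<in> ?Bs" "C \<in> ?Bs" "ps \<in> split_factorizations A B f r" "ps \<in> split_factorizations A C f r"
    for B C ps
  proof -
    have "B \<inter> C = B"
      using that ab closed_under_filter[OF closed_under_Int, of ps B C "starts_in B"]
      by (intro connectsD[of B "filter (starts_in B) ps"]) (auto simp: split_factorizations_def)
    then show ?thesis by blast
  qed
  have "card (pair_factorizations_after A (a, b) f r)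
      = card (pair_factorizations A f r) + card (\<Union>B\<in>?Bs. split_factorizations A B f r)"
    unfolding pair_factorizations_after_eq[OF ab]
  proof (rule card_Un_disjoint)
    show "pair_factorizations A f r \<inter> (\<Union>B\<in>?Bs. split_factorizations A B f r) = {}"
    proof (rule ccontr)
      assume "pair_factorizations A f r \<inter> (\<Union>B\<in>?Bs. split_factorizations A B f r) \<noteq> {}"
      then obtain ps B where "B \<in> ?Bs" "connects A ps" "closed_under ps B"
        unfolding pair_factorizations_def split_factorizations_def by blast
      then show False
        using connectsD[of A ps B] ab by blast
    qed
    show "finite (\<Union>B\<in>?Bs. split_factorizations A B f r)"
      by (rule finite_UN_I[OF fin fin_split])
  qed (rule finite_pair_factorizations[OF assms(1)])
  also have "card (\<Union>B\<in>?Bs. split_factorizations A B f r) = (\<Sum>B\<in>?Bs. card (split_factorizations A B f r))"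
  proof (rule card_UN_disjoint[OF fin])
    show "\<forall>B\<in>?Bs. \<forall>C\<in>?Bs. B \<noteq> C \<longrightarrow> split_factorizations A B f r \<inter> split_factorizations A C f r = {}"
    proof (intro ballI impI)
      fix B C assume "B \<in> ?Bs" "C \<in> ?Bs" "B \<noteq> C"
      then show "split_factorizations A B f r \<inter> split_factorizations A C f r = {}"
        using le[of B C] le[of C B] by (meson disjoint_iff subset_antisym)
    qed
  qed (use fin_split in blast)
  also have "\<dots> = (\<Sum>B | B \<subseteq> A \<and> f ` B \<subseteq> B \<and> a \<in> B \<and> b \<notin> B. card (split_factorizations A B f r))"
  proof (rule sum.mono_neutral_right[OF fin])
    show "\<forall>B\<in>?Bs - {B. B \<subseteq> A \<and> f ` B \<subseteq> B \<and> a \<in> B \<and> b \<notin> B}. card (split_factorizations A B f r) = 0"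
    proof
      fix B assume "B \<in> ?Bs - {B. B \<subseteq> A \<and> f ` B \<subseteq> B \<and> a \<in> B \<and> b \<notin> B}"
      then have "\<not> f ` B \<subseteq> B" by blast
      then have "split_factorizations A B f r = {}"
        using split_factorizations_invariant(1) by blast
      then show "card (split_factorizations A B f r) = 0" by simp
    qed
  qed auto
  finally show ?thesis .
qed

lemma card_pair_factorizations_Suc:
  assumes "finite A" "f permutes A"
  shows "card (pair_factorizations A f (Suc r))
    = (\<Sum>(a, b)\<in>ordered_pairs A. card (pair_factorizations_after A (a, b) (Transposition.transpose a b \<circ> f) r))"
proof -
  let ?G = "\<lambda>p. pair_factorizations_after A p (Transposition.transpose (fst p) (snd p) \<circ> f) r"
  have *: "Transposition.transpose a b \<circ> (Transposition.transpose a b \<circ> g) = g" for a b and g :: "'a \<Rightarrow> 'a"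
    by (simp add: fun_eq_iff)
  have "pair_factorizations A f (Suc r) = (\<Union>p\<in>ordered_pairs A. Cons p ` ?G p)"
    by (auto simp: pair_factorizations_def pair_factorizations_after_def * length_Suc_conv image_iff)
  also have "card \<dots> = (\<Sum>p\<in>ordered_pairs A. card (Cons p ` ?G p))"
    using assms(1) finite_ordered_pairs finite_lists_length_eq[OF finite_ordered_pairs[OF assms(1)], of r]
    by (intro card_UN_disjoint ballI finite_imageI)
      (auto intro: finite_subset[of _ "{ps. set ps \<subseteq> ordered_pairs A \<and> length ps = r}"]
        simp: pair_factorizations_after_def)
  also have "\<dots> = (\<Sum>(a, b)\<in>ordered_pairs A. card (pair_factorizations_after A (a, b) (Transposition.transpose a b \<circ> f) r))"
    by (intro sum.cong refl) (auto simp: card_image)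
  finally show ?thesis .
qed

subsection \<open>The Goulden--Jackson formula\<close>

text \<open>The Goulden--Jackson number divided by (N + l - 2)!, for l cycles with N points in all.
  The quotient stands for N^(l-3), also when l < 3; for empty K it is 1 / 0 = 0.\<close>

definition factorization_weight :: "'a set set \<Rightarrow> rat" where
  "factorization_weight K = of_nat (sum card K) ^ card K / of_nat (sum card K) ^ 3 * (\<Prod>C\<in>K. cycle_weight (card C))"

text \<open>Used with C one half of a cut cycle: the exponent (|K| + 1) - 3 becomes the |K| - 2 of
  \<open>Hurwitz_cut_identity\<close>.\<close>

lemma factorization_weight_insert:
  assumes "finite K" "C \<notin> K" "card C \<ge> 1"
  shows "factorization_weight (insert C K) = (of_nat (card C) + (\<Sum>D\<in>K. of_nat (card D))) ^ card K
    / (of_nat (card C) + (\<Sum>D\<in>K. of_nat (card D)))\<^sup>2 * (cycle_weight (card C) * (\<Prod>D\<in>K. cycle_weight (card D)))"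
proof -
  have "y ^ Suc n / y ^ 3 = y ^ n / y\<^sup>2" for y :: rat and n
    by (cases "y = 0") (simp_all add: power2_eq_square power3_eq_cube)
  then show ?thesis
    using assms unfolding factorization_weight_def by (simp del: power_Suc)
qed

text \<open>The Riemann--Hurwitz bound is part of the induction because it makes all contributions to
  the recurrence vanish other than the minimal ones.\<close>

definition counted_upto :: "nat \<Rightarrow> 'a set \<Rightarrow> ('a \<Rightarrow> 'a) \<Rightarrow> bool" where
  "counted_upto r A f \<longleftrightarrow> (\<forall>i\<le>r.
     (pair_factorizations A f i \<noteq> {} \<longrightarrow> card A + card (perm_cycles A f) \<le> i + 2) \<and>
     (card A + card (perm_cycles A f) = i + 2 \<longrightarrow>
       of_nat (card (pair_factorizations A f i)) = 2 ^ i * fact i * factorization_weight (perm_cycles A f)))"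

lemma transpose_comp_cancel: "Transposition.transpose a b \<circ> (Transposition.transpose a b \<circ> g) = g"
  by (simp add: fun_eq_iff)

context finite_perm
begin

lemma invariant_obtain_cycles:
  assumes "B \<subseteq> A" "f ` B \<subseteq> B"
  obtains S where "S \<subseteq> perm_cycles A f" "B = \<Union>S"
proof -
  have "B \<in> Union ` Pow (perm_cycles A f)"
    unfolding bij_betw_imp_surj_on[OF bij_betw_Union_cycles] using assms by simp
  then show thesis
    using that by auto
qed

lemma card_perm_cycles_invariant:
  assumes "B \<subseteq> A" "f ` B \<subseteq> B"
  shows "card (perm_cycles B (perm_restrict f B)) + card (perm_cycles (A - B) (perm_restrict f (A - B)))
       = card (perm_cycles A f)"
proof -
  obtain S where S: "S \<subseteq> perm_cycles A f" "B = \<Union>S"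
    using invariant_obtain_cycles[OF assms] .
  have "card (perm_cycles A f - S) = card (perm_cycles A f) - card S"
    using S(1) finite_perm_cycles finite_subset by (blast intro: card_Diff_subset)
  moreover have "card S \<le> card (perm_cycles A f)"
    by (rule card_mono[OF finite_perm_cycles S(1)])
  ultimately show ?thesis
    unfolding S(2) perm_cycles_Union[OF S(1)] perm_cycles_Diff_Union[OF S(1)]
    by simp
qed

lemma card_perm_cycles_pos: "A \<noteq> {} \<Longrightarrow> card (perm_cycles A f) \<ge> 1"
  using finite_perm_cycles by (auto simp: Suc_le_eq card_gt_0_iff perm_cycles_def)

lemma finite_perm_restrict:
  assumes "B \<subseteq> A" "f ` B \<subseteq> B"
  shows "finite_perm B (perm_restrict f B)" "finite_perm (A - B) (perm_restrict f (A - B))"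
  using assms fin finite_subset perm_restrict_permutes invariant_compl
  by (auto intro!: finite_perm.intro)

text \<open>Let u and v be points plus cycles on the two sides; they add up to the total for f. A
  connected factorization takes at least u - 2 transpositions on one side and v - 2 on the other,
  hence the 4. If r attains this bound, only i = u - 2 survives in the convolution, and the binomial
  coefficient turns the two factorials into r!.\<close>

lemma card_split_parts:
  assumes B: "B \<subseteq> A" "B \<noteq> {}" "B \<noteq> A" "f ` B \<subseteq> B"
    and IH: "counted_upto r B (perm_restrict f B)" "counted_upto r (A - B) (perm_restrict f (A - B))"
  shows "split_factorizations A B f r \<noteq> {} \<Longrightarrow> card A + card (perm_cycles A f) \<le> r + 4"
    and "card A + card (perm_cycles A f) = r + 4 \<Longrightarrow>
      of_nat (card (split_factorizations A B f r)) = 2 ^ r * fact r *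
        (factorization_weight (perm_cycles B (perm_restrict f B))
         * factorization_weight (perm_cycles (A - B) (perm_restrict f (A - B))))"
proof -
  define g h where "g = perm_restrict f B" and "h = perm_restrict f (A - B)"
  define u v where "u = card B + card (perm_cycles B g)" and "v = card (A - B) + card (perm_cycles (A - B) h)"
  interpret B: finite_perm B g
    unfolding g_def by (rule finite_perm_restrict(1)[OF B(1,4)])
  interpret C: finite_perm "A - B" h
    unfolding h_def by (rule finite_perm_restrict(2)[OF B(1,4)])
  have uv: "u + v = card A + card (perm_cycles A f)"
    using card_perm_cycles_invariant[OF B(1,4)] card_Diff_subset[OF B.fin B(1)] card_mono[OF fin B(1)]
    by (simp add: u_def v_def g_def h_def)
  have "card B \<ge> 1" "card (A - B) \<ge> 1"
    using B fin B.fin by (auto simp: Suc_le_eq card_gt_0_iff)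
  then have uv2: "u \<ge> 2" "v \<ge> 2"
    using B.card_perm_cycles_pos C.card_perm_cycles_pos B by (auto simp: u_def v_def)
  have zero_u: "u \<le> i + 2" if "i \<le> r" "card (pair_factorizations B g i) \<noteq> 0" for i
    using IH(1) that unfolding counted_upto_def u_def g_def by (metis card.empty)
  have zero_v: "v \<le> i + 2" if "i \<le> r" "card (pair_factorizations (A - B) h i) \<noteq> 0" for i
    using IH(2) that unfolding counted_upto_def v_def h_def by (metis card.empty)
  have zero: "u \<le> i + 2 \<and> v \<le> r - i + 2"
    if "i \<le> r" "(r choose i) * card (pair_factorizations B g i) * card (pair_factorizations (A - B) h (r - i)) \<noteq> 0" for i
    using zero_u[of i] zero_v[of "r - i"] that by auto
  note card_eq = card_split_factorizations[OF fin B(1) perm B(4), of r, folded g_def h_def]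
  show "card A + card (perm_cycles A f) \<le> r + 4" if "split_factorizations A B f r \<noteq> {}"
  proof -
    have "finite (split_factorizations A B f r)"
      by (rule finite_subset[OF _ finite_lists_length_eq[OF finite_ordered_pairs[OF fin], of r]])
        (auto simp: split_factorizations_def)
    then have "card (split_factorizations A B f r) \<noteq> 0"
      using that by simp
    then obtain i where "i \<le> r" "u \<le> i + 2 \<and> v \<le> r - i + 2"
      unfolding card_eq using zero by (metis (no_types, lifting) atMost_iff sum.neutral)
    then show ?thesis using uv by linarith
  qed
  show "of_nat (card (split_factorizations A B f r)) = 2 ^ r * fact r *
        (factorization_weight (perm_cycles B (perm_restrict f B))
         * factorization_weight (perm_cycles (A - B) (perm_restrict f (A - B))))"
    if "card A + card (perm_cycles A f) = r + 4"
  proof -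
    define j where "j = u - 2"
    have j: "j \<le> r" "u = j + 2" "v = r - j + 2"
      using that uv uv2 by (auto simp: j_def)
    have "card (split_factorizations A B f r)
       = (\<Sum>i\<in>{j}. (r choose i) * card (pair_factorizations B g i) * card (pair_factorizations (A - B) h (r - i)))"
      unfolding card_eq
    proof (rule sum.mono_neutral_right)
      show "\<forall>i\<in>{..r} - {j}. (r choose i) * card (pair_factorizations B g i) * card (pair_factorizations (A - B) h (r - i)) = 0"
      proof (rule ballI, rule ccontr)
        fix i assume i: "i \<in> {..r} - {j}"
          and "(r choose i) * card (pair_factorizations B g i) * card (pair_factorizations (A - B) h (r - i)) \<noteq> 0"
        then have "u \<le> i + 2 \<and> v \<le> r - i + 2"
          using zero by simp
        then show False using i j by auto
      qed
    qed (use j in auto)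
    then have "of_nat (card (split_factorizations A B f r)) = of_nat (r choose j)
      * of_nat (card (pair_factorizations B g j)) * (of_nat (card (pair_factorizations (A - B) h (r - j))) :: rat)"
      by simp
    also have "of_nat (card (pair_factorizations B g j)) = 2 ^ j * fact j * factorization_weight (perm_cycles B g)"
      using IH(1) j unfolding counted_upto_def g_def[symmetric] u_def by blast
    also have "of_nat (card (pair_factorizations (A - B) h (r - j)))
        = 2 ^ (r - j) * fact (r - j) * factorization_weight (perm_cycles (A - B) h)"
      using IH(2) j unfolding counted_upto_def h_def[symmetric] v_def by (metis diff_le_self)
    also have "of_nat (r choose j) = (fact r / (fact j * fact (r - j)) :: rat)"
      using j(1) by (rule binomial_fact)
    also have "fact r / (fact j * fact (r - j)) * (2 ^ j * fact j * factorization_weight (perm_cycles B g))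
        * (2 ^ (r - j) * fact (r - j) * factorization_weight (perm_cycles (A - B) h))
      = 2 ^ r * fact r * (factorization_weight (perm_cycles B g) * factorization_weight (perm_cycles (A - B) h))"
    proof -
      have "(2::rat) ^ r = 2 ^ j * 2 ^ (r - j)"
        using j(1) by (simp add: power_add[symmetric])
      then show ?thesis by simp
    qed
    finally show ?thesis unfolding g_def h_def .
  qed
qed

text \<open>Only joins are counted directly; for a cut, f arises from f' by a join with the same
  transposition.\<close>

lemma card_perm_cycles_transpose:
  assumes ab: "a \<in> A" "b \<in> A" "a \<noteq> b"
  defines "f' \<equiv> Transposition.transpose a b \<circ> f"
  shows "b \<in> orbit f a \<Longrightarrow> card (perm_cycles A f') = Suc (card (perm_cycles A f))"
    and "b \<notin> orbit f a \<Longrightarrow> card (perm_cycles A f) = Suc (card (perm_cycles A f'))"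
proof -
  have join: "card (perm_cycles A g) = Suc (card (perm_cycles A (Transposition.transpose a b \<circ> g)))"
    if "finite_perm A g" "b \<notin> orbit g a" for g
  proof -
    interpret g: finite_perm A g by fact
    let ?K = "perm_cycles A g - {orbit g a, orbit g b}"
    have "orbit g a \<noteq> orbit g b"
      using that(2) g.self_in_orbit by blast
    then have "card {orbit g a, orbit g b} = 2"
      by simp
    moreover have "{orbit g a, orbit g b} \<subseteq> perm_cycles A g"
      using g.orbit_in_perm_cycles ab by auto
    ultimately have "card (perm_cycles A g) = card ?K + 2"
      using card_Diff_subset[of "{orbit g a, orbit g b}" "perm_cycles A g"]
        card_mono[of "perm_cycles A g" "{orbit g a, orbit g b}"] g.finite_perm_cycles by simp
    moreover have "card (perm_cycles A (Transposition.transpose a b \<circ> g)) = Suc (card ?K)"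
      unfolding g.perm_cycles_join(2)[OF ab(1,2) that(2)]
      using g.perm_cycles_join(3)[OF ab(1,2) that(2)] g.finite_perm_cycles by simp
    ultimately show ?thesis by simp
  qed
  show "card (perm_cycles A f) = Suc (card (perm_cycles A f'))" if "b \<notin> orbit f a"
    unfolding f'_def using that join finite_perm_axioms by blast
  show "card (perm_cycles A f') = Suc (card (perm_cycles A f))" if b: "b \<in> orbit f a"
  proof -
    have f': "finite_perm A f'"
      unfolding f'_def using fin transpose_comp_permutes[OF ab(1,2)] by unfold_locales
    obtain k where k: "1 \<le> k" "k < card (orbit f a)" "b = (f ^^ k) a"
      using same_orbit_obtain[OF b] ab(3) by auto
    have "b \<notin> orbit f' a"
      using perm_cycles_cut(1)[OF ab(1) k(1,2)] finite_perm.self_in_orbit[OF f', of b]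
      by (auto simp: f'_def k(3))
    then show ?thesis
      using join[OF f'] by (simp add: f'_def transpose_comp_cancel)
  qed
qed

lemma invariant_orbit_subset:
  assumes "f ` B \<subseteq> B" "a \<in> B"
  shows "orbit f a \<subseteq> B"
proof
  fix x assume "x \<in> orbit f a"
  then show "x \<in> B" by induction (use assms in auto)
qed

end

text \<open>If the tail is connected, the bound for f' suffices because f has at most one cycle
  more. If it is split, the bound is weaker by 2, but an invariant set separates a from b, so f
  joins two cycles of f' and has one cycle fewer.\<close>

lemma card_le_of_pair_factorizations_after:
  fixes A :: "'a set"
  assumes "finite_perm A f" and ab: "a \<in> A" "b \<in> A" "a \<noteq> b"
    and ne: "pair_factorizations_after A (a, b) (Transposition.transpose a b \<circ> f) r \<noteq> {}"
    and IH: "\<And>(B :: 'a set) g. finite_perm B g \<Longrightarrow> B \<noteq> {} \<Longrightarrow> counted_upto r B g"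
  shows "card A + card (perm_cycles A f) \<le> Suc r + 2"
proof -
  interpret finite_perm A f by fact
  define f' where "f' = Transposition.transpose a b \<circ> f"
  interpret f': finite_perm A f'
    unfolding f'_def using fin transpose_comp_permutes[OF ab(1,2)] by unfold_locales
  have le: "card (perm_cycles A f) \<le> Suc (card (perm_cycles A f'))"
    using card_perm_cycles_transpose[OF ab] unfolding f'_def by (cases "b \<in> orbit f a") simp_all
  from ne consider "pair_factorizations A f' r \<noteq> {}"
    | B where "B \<subseteq> A" "a \<in> B" "b \<notin> B" "split_factorizations A B f' r \<noteq> {}"
    unfolding pair_factorizations_after_eq[OF ab] f'_def[symmetric] by blast
  then show ?thesis
  proof cases
    case 1
    have "counted_upto r A f'"
      using IH[OF f'.finite_perm_axioms] ab by blast
    with 1 have "card A + card (perm_cycles A f') \<le> r + 2"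
      by (simp add: counted_upto_def)
    then show ?thesis using le by simp
  next
    case 2
    then have inv: "f' ` B \<subseteq> B"
      using split_factorizations_invariant(1) by blast
    have "card A + card (perm_cycles A f') \<le> r + 4"
      using 2 inv ab f'.finite_perm_restrict[OF 2(1) inv]
      by (intro f'.card_split_parts(1)[of B r] IH) auto
    moreover have "b \<notin> orbit f' a"
      using f'.invariant_orbit_subset[OF inv 2(2)] 2(3) by blast
    then have "card (perm_cycles A f') = Suc (card (perm_cycles A f))"
      using f'.card_perm_cycles_transpose(2)[OF ab] by (simp add: f'_def transpose_comp_cancel)
    ultimately show ?thesis by simp
  qed
qed

text \<open>After the join a and b lie on one cycle, so no invariant set separates them and only
  connected tails remain. There are now l - 1 cycles, whence the exponent l - 4.\<close>

lemma of_nat_card_after_join: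
  fixes A :: "'a set"
  assumes "finite_perm A f" and ab: "a \<in> A" "b \<in> A" "b \<notin> orbit f a"
    and IH: "\<And>(B :: 'a set) g. finite_perm B g \<Longrightarrow> B \<noteq> {} \<Longrightarrow> counted_upto r B g"
    and r: "card A + card (perm_cycles A f) = Suc r + 2"
  defines "K \<equiv> perm_cycles A f" and "C \<equiv> orbit f a" and "D \<equiv> orbit f b"
  shows "of_nat (card (pair_factorizations_after A (a, b) (Transposition.transpose a b \<circ> f) r))
    = 2 ^ r * fact r * (cycle_weight (card C + card D) * (\<Prod>B\<in>K - {C, D}. cycle_weight (card B))
        * (of_nat (card A) ^ card K / of_nat (card A) ^ 4))"
proof -
  interpret finite_perm A f by fact
  have ne: "a \<noteq> b"
    using ab(3) self_in_orbit by blast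
  define f' where "f' = Transposition.transpose a b \<circ> f"
  interpret f': finite_perm A f'
    unfolding f'_def using fin transpose_comp_permutes[OF ab(1,2)] by unfold_locales
  have card_K: "card K = Suc (card (perm_cycles A f'))"
    using card_perm_cycles_transpose(2)[OF ab(1,2) ne ab(3)] by (simp add: K_def f'_def)
  have empty: "{B. B \<subseteq> A \<and> f' ` B \<subseteq> B \<and> a \<in> B \<and> b \<notin> B} = {}"
    using f'.invariant_orbit_subset perm_cycles_join(1)[OF ab] unfolding f'_def by blast
  have "of_nat (card (pair_factorizations_after A (a, b) f' r)) = (of_nat (card (pair_factorizations A f' r)) :: rat)"
    unfolding card_pair_factorizations_after[OF fin f'.perm ab(1,2) ne] empty by simp
  also have "\<dots> = 2 ^ r * fact r * factorization_weight (perm_cycles A f')"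
    using IH[OF f'.finite_perm_axioms] ab(1) r card_K by (auto simp: counted_upto_def K_def)
  also have "factorization_weight (perm_cycles A f') = of_nat (card A) ^ card (perm_cycles A f') / of_nat (card A) ^ 3
      * (\<Prod>B\<in>perm_cycles A f'. cycle_weight (card B))"
    by (simp add: factorization_weight_def f'.sum_card_perm_cycles)
  also have "(\<Prod>B\<in>perm_cycles A f'. cycle_weight (card B))
      = cycle_weight (card C + card D) * (\<Prod>B\<in>K - {C, D}. cycle_weight (card B))"
  proof -
    have "C \<inter> D = {}"
      using disjoint_perm_cycles ab orbit_in_perm_cycles self_in_orbit orbit_eq
      unfolding C_def D_def by (metis disjointD)
    then have "card (C \<union> D) = card C + card D"
      using finite_perm_cycle orbit_in_perm_cycles ab unfolding C_def D_def by (simp add: card_Un_disjoint)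
    then show ?thesis
      using perm_cycles_join(2,3)[OF ab] finite_perm_cycles by (simp add: f'_def K_def C_def D_def)
  qed
  also have "of_nat (card A) ^ card (perm_cycles A f') / of_nat (card A) ^ 3
      = (of_nat (card A) ^ card K / of_nat (card A) ^ 4 :: rat)"
  proof -
    have "card A \<noteq> 0" using ab fin by auto
    then show ?thesis
      unfolding card_K by (simp add: power4_eq_xxxx power3_eq_cube)
  qed
  finally show ?thesis
    by (simp only: f'_def mult_ac)
qed

text \<open>The cut adds a cycle, so r falls below the bound for connected tails and only split ones
  remain. The invariant sets that contain a but not b consist of the piece at a together with any
  set S of the uncut cycles.\<close>

lemma of_nat_card_after_cut:
  fixes A :: "'a set" and k :: nat
  assumes "finite_perm A f" and a: "a \<in> A" and k: "1 \<le> k" "k < card (orbit f a)"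
    and IH: "\<And>(B :: 'a set) g. finite_perm B g \<Longrightarrow> B \<noteq> {} \<Longrightarrow> counted_upto r B g"
    and r: "card A + card (perm_cycles A f) = Suc r + 2"
  defines "K \<equiv> perm_cycles A f" and "C \<equiv> orbit f a" and "b \<equiv> (f ^^ k) a" and "X \<equiv> \<lambda>B. of_nat (card B) :: rat"
  shows "of_nat (card (pair_factorizations_after A (a, b) (Transposition.transpose a b \<circ> f) r))
    = 2 ^ r * fact r * (cycle_weight k * cycle_weight (card C - k)
            * (\<Prod>B\<in>K - {C}. cycle_weight (card B))
            * (\<Sum>S\<in>Pow (K - {C}). (of_nat k + sum X S) ^ card S / (of_nat k + sum X S)\<^sup>2
                * ((of_nat (card C - k) + sum X (K - {C} - S)) ^ card (K - {C} - S)
                    / (of_nat (card C - k) + sum X (K - {C} - S))\<^sup>2)))"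
proof -
  interpret finite_perm A f by fact
  define f' where "f' = Transposition.transpose a b \<circ> f"
  define C1 C2 where "C1 = orbit f' a" and "C2 = orbit f' b"
  note cut = perm_cycles_cut[OF a k, folded b_def, folded f'_def, folded C1_def C2_def C_def K_def]
  have b_in: "b \<in> orbit f a"
    unfolding b_def by (rule funpow_in_orbit[OF self_in_orbit])
  then have b: "b \<in> A"
    using orbit_subset_A[OF a] by blast
  interpret f': finite_perm A f'
    unfolding f'_def using fin transpose_comp_permutes[OF a b] by unfold_locales
  have aC: "a \<in> C1" "b \<in> C2"
    using f'.self_in_orbit by (auto simp: C1_def C2_def)
  then have ne: "a \<noteq> b" "C1 \<noteq> C2"
    using cut(1) by auto
  have CK: "C \<in> K" and finK: "finite K" and finC: "finite C"
    using orbit_in_perm_cycles[OF a] finite_perm_cycles finite_perm_cycle by (auto simp: C_def K_def)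
  have notin: "C1 \<notin> K - {C}" "C2 \<notin> K - {C}"
    using perm_cycle_eq[of C1 a] perm_cycle_eq[of C2 b] orbit_eq[OF b_in] aC
    by (auto simp: K_def C_def)
  have card_C: "card C1 = k" "card C2 = card C - k"
    using cut(2,3) finC card_Un_disjoint[of C1 C2] cut(1) finite_subset[of _ C] by auto
  have card_K': "card (perm_cycles A f') = Suc (card K)"
    unfolding K_def f'_def by (rule card_perm_cycles_transpose(1)[OF a b ne(1) b_in])
  let ?Bs = "{B. B \<subseteq> A \<and> f' ` B \<subseteq> B \<and> a \<in> B \<and> b \<notin> B}"
  have no_connected: "pair_factorizations A f' r = {}"
  proof -
    have "counted_upto r A f'"
      using IH[OF f'.finite_perm_axioms] a by blast
    then show ?thesis
      using card_K' r by (force simp: counted_upto_def K_def)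
  qed
  have "of_nat (card (pair_factorizations_after A (a, b) f' r))
      = (\<Sum>B\<in>?Bs. of_nat (card (split_factorizations A B f' r)) :: rat)"
    unfolding card_pair_factorizations_after[OF fin f'.perm a b ne(1)] no_connected by simp
  also have "\<dots> = (\<Sum>B\<in>?Bs. 2 ^ r * fact r * (factorization_weight (perm_cycles B (perm_restrict f' B))
         * factorization_weight (perm_cycles (A - B) (perm_restrict f' (A - B)))))"
  proof (rule sum.cong[OF refl])
    fix B assume B: "B \<in> ?Bs"
    then have "B \<subseteq> A" "f' ` B \<subseteq> B" by auto
    from f'.finite_perm_restrict[OF this]
    show "of_nat (card (split_factorizations A B f' r)) = 2 ^ r * fact r * (factorization_weight (perm_cycles B (perm_restrict f' B))
         * factorization_weight (perm_cycles (A - B) (perm_restrict f' (A - B))))"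
      using B b r card_K' by (intro f'.card_split_parts(2) IH) (auto simp: K_def)
  qed
  also have "\<dots> = 2 ^ r * fact r * (\<Sum>B\<in>?Bs. factorization_weight (perm_cycles B (perm_restrict f' B))
         * factorization_weight (perm_cycles (A - B) (perm_restrict f' (A - B))))"
    by (simp only: sum_distrib_left)
  also have "(\<Sum>B\<in>?Bs. factorization_weight (perm_cycles B (perm_restrict f' B))
         * factorization_weight (perm_cycles (A - B) (perm_restrict f' (A - B))))
      = (\<Sum>S\<in>Pow (K - {C}). factorization_weight (insert C1 S) * factorization_weight (insert C2 (K - {C} - S)))"
  proof (rule sum.reindex_bij_betw[of "\<lambda>S. \<Union>(insert C1 S)", symmetric, THEN trans])
    have sub: "insert C1 S \<subseteq> perm_cycles A f'" if "S \<in> Pow (K - {C})" for S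
      using that cut(4) by auto
    have inter: "orbit f' x \<in> T" if "x \<in> \<Union>T" "T \<subseteq> perm_cycles A f'" for x T
      using that f'.perm_cycle_eq by blast
    show "bij_betw (\<lambda>S. \<Union>(insert C1 S)) (Pow (K - {C})) ?Bs"
    proof (rule bij_betwI')
      fix S T assume ST: "S \<in> Pow (K - {C})" "T \<in> Pow (K - {C})"
      show "\<Union>(insert C1 S) = \<Union>(insert C1 T) \<longleftrightarrow> S = T"
      proof
        assume "\<Union>(insert C1 S) = \<Union>(insert C1 T)"
        then have "insert C1 S = insert C1 T"
          using bij_betw_imp_inj_on[OF f'.bij_betw_Union_cycles] sub ST by (meson PowI inj_onD)
        then show "S = T"
          using notin ST by (metis Pow_iff insert_ident subsetD)
      qed simp
    next
      fix S assume S: "S \<in> Pow (K - {C})"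
      have "b \<notin> \<Union>(insert C1 S)"
        using inter[OF _ sub[OF S], of b] notin ne S by (auto simp: C2_def[symmetric])
      then show "\<Union>(insert C1 S) \<in> ?Bs"
        using f'.Union_cycles_invariant[OF sub[OF S]] aC by auto
    next
      fix B assume B: "B \<in> ?Bs"
      then obtain T where T: "T \<subseteq> perm_cycles A f'" "B = \<Union>T"
        using f'.invariant_obtain_cycles by blast
      have "C1 \<in> T" "C2 \<notin> T"
        using B T inter[of a T] aC by (auto simp: C1_def)
      then show "\<exists>S\<in>Pow (K - {C}). B = \<Union>(insert C1 S)"
        using T cut(4) by (intro bexI[of _ "T - {C1}"]) (auto simp: insert_absorb)
    qed
    show "(\<Sum>S\<in>Pow (K - {C}). factorization_weight (perm_cycles (\<Union>(insert C1 S)) (perm_restrict f' (\<Union>(insert C1 S))))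
         * factorization_weight (perm_cycles (A - \<Union>(insert C1 S)) (perm_restrict f' (A - \<Union>(insert C1 S)))))
      = (\<Sum>S\<in>Pow (K - {C}). factorization_weight (insert C1 S) * factorization_weight (insert C2 (K - {C} - S)))"
    proof (rule sum.cong[OF refl])
      fix S assume S: "S \<in> Pow (K - {C})"
      have "perm_cycles A f' - insert C1 S = insert C2 (K - {C} - S)"
        using cut(4) notin ne S by auto
      then show "factorization_weight (perm_cycles (\<Union>(insert C1 S)) (perm_restrict f' (\<Union>(insert C1 S))))
         * factorization_weight (perm_cycles (A - \<Union>(insert C1 S)) (perm_restrict f' (A - \<Union>(insert C1 S))))
        = factorization_weight (insert C1 S) * factorization_weight (insert C2 (K - {C} - S))"
        by (simp only: f'.perm_cycles_Union[OF sub[OF S]] f'.perm_cycles_Diff_Union[OF sub[OF S]])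
    qed
  qed
  also have "\<dots> = (\<Sum>S\<in>Pow (K - {C}). cycle_weight k * cycle_weight (card C - k)
            * (\<Prod>B\<in>K - {C}. cycle_weight (card B)) * ((of_nat k + sum X S) ^ card S / (of_nat k + sum X S)\<^sup>2
                * ((of_nat (card C - k) + sum X (K - {C} - S)) ^ card (K - {C} - S)
                    / (of_nat (card C - k) + sum X (K - {C} - S))\<^sup>2)))"
  proof (rule sum.cong[OF refl])
    fix S assume S: "S \<in> Pow (K - {C})"
    then have "finite S" using finK finite_subset by blast
    have "(\<Prod>B\<in>K - {C}. cycle_weight (card B))
        = (\<Prod>B\<in>S. cycle_weight (card B)) * (\<Prod>B\<in>K - {C} - S. cycle_weight (card B))"
      using prod.subset_diff[of S "K - {C}" "\<lambda>B. cycle_weight (card B)"] S finK by (simp add: mult.commute)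
    moreover have "factorization_weight (insert C1 S) = (of_nat k + sum X S) ^ card S / (of_nat k + sum X S)\<^sup>2
        * (cycle_weight k * (\<Prod>B\<in>S. cycle_weight (card B)))"
      using factorization_weight_insert[of S C1] notin(1) S \<open>finite S\<close> card_C k unfolding X_def by auto
    moreover have "factorization_weight (insert C2 (K - {C} - S)) = (of_nat (card C - k) + sum X (K - {C} - S)) ^ card (K - {C} - S)
          / (of_nat (card C - k) + sum X (K - {C} - S))\<^sup>2
        * (cycle_weight (card C - k) * (\<Prod>B\<in>K - {C} - S. cycle_weight (card B)))"
      using factorization_weight_insert[of "K - {C} - S" C2] notin(2) finK card_C k unfolding X_def C_def by auto
    ultimately show "factorization_weight (insert C1 S) * factorization_weight (insert C2 (K - {C} - S))
      = cycle_weight k * cycle_weight (card C - k)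
            * (\<Prod>B\<in>K - {C}. cycle_weight (card B)) * ((of_nat k + sum X S) ^ card S / (of_nat k + sum X S)\<^sup>2
                * ((of_nat (card C - k) + sum X (K - {C} - S)) ^ card (K - {C} - S)
                    / (of_nat (card C - k) + sum X (K - {C} - S))\<^sup>2))"
      by (simp only: mult_ac)
  qed
  finally show ?thesis
    by (simp only: f'_def sum_distrib_left)
qed

lemma (in finite_perm) sum_perm_cycles:
  "(\<Sum>x\<in>A. g x) = (\<Sum>C\<in>perm_cycles A f. \<Sum>x\<in>C. g x)"
  using sum.Union_disjoint[of "perm_cycles A f" g] disjoint_perm_cycles finite_perm_cycle
  by (auto simp: Union_perm_cycles disjoint_def)

text \<open>A partner of a lies either in another cycle D, where the term depends on C and D only,
  or at distance k in the cycle C of a. Summing over the points yields the multiplicities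
  \<open>card C\<close> and \<open>card D\<close>.\<close>

lemma (in finite_perm) sum_ordered_pairs:
  fixes g :: "'a \<Rightarrow> 'a \<Rightarrow> rat"
  assumes join: "\<And>a b. a \<in> A \<Longrightarrow> b \<in> A \<Longrightarrow> b \<notin> orbit f a \<Longrightarrow> g a b = J (orbit f a) (orbit f b)"
    and cut: "\<And>a k. a \<in> A \<Longrightarrow> 1 \<le> k \<Longrightarrow> k < card (orbit f a) \<Longrightarrow> g a ((f ^^ k) a) = L (orbit f a) k"
  defines "K \<equiv> perm_cycles A f"
  shows "(\<Sum>(a, b)\<in>ordered_pairs A. g a b)
    = (\<Sum>C\<in>K. \<Sum>D\<in>K - {C}. of_nat (card C) * of_nat (card D) * J C D)
      + (\<Sum>C\<in>K. of_nat (card C) * (\<Sum>k=1..<card C. L C k))"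
proof -
  have "(\<Sum>(a, b)\<in>ordered_pairs A. g a b) = (\<Sum>a\<in>A. \<Sum>b\<in>A - {a}. g a b)"
    using fin by (subst sum.Sigma) (auto intro!: sum.cong simp: ordered_pairs_def)
  also have "\<dots> = (\<Sum>C\<in>K. \<Sum>a\<in>C. (\<Sum>k=1..<card C. L C k) + (\<Sum>D\<in>K - {C}. of_nat (card D) * J C D))"
    unfolding K_def sum_perm_cycles[of "\<lambda>a. \<Sum>b\<in>A - {a}. g a b"]
  proof (intro sum.cong refl)
    fix C a assume C: "C \<in> perm_cycles A f" and a: "a \<in> C"
    have Ca: "C = orbit f a" and aA: "a \<in> A"
      using perm_cycle_eq[OF C a] perm_cycle_subset[OF C] a by auto
    have "A - C = \<Union>(perm_cycles A f - {C})"
      using Diff_Union_cycles[of "{C}"] C by simp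
    then have "(\<Sum>b\<in>A - C. g a b) = (\<Sum>D\<in>perm_cycles A f - {C}. \<Sum>b\<in>D. g a b)"
      using sum.Union_disjoint[of "perm_cycles A f - {C}" "g a"] disjoint_perm_cycles finite_perm_cycle
      by (auto simp: disjoint_def)
    also have "\<dots> = (\<Sum>D\<in>perm_cycles A f - {C}. of_nat (card D) * J C D)"
    proof (rule sum.cong[OF refl])
      fix D assume D: "D \<in> perm_cycles A f - {C}"
      have "g a b = J C D" if "b \<in> D" for b
      proof -
        have "D = orbit f b" "b \<in> A"
          using perm_cycle_eq[of D b] perm_cycle_subset[of D] that D by auto
        then show ?thesis
          using join[OF aA, of b] D Ca orbit_eq[of b a] by auto
      qed
      then show "(\<Sum>b\<in>D. g a b) = of_nat (card D) * J C D" by simp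
    qed
    finally have other: "(\<Sum>b\<in>A - C. g a b) = (\<Sum>D\<in>perm_cycles A f - {C}. of_nat (card D) * J C D)" .
    have same: "(\<Sum>b\<in>C - {a}. g a b) = (\<Sum>k=1..<card C. L C k)"
      unfolding Ca sum_orbit_Diff by (intro sum.cong refl cut[OF aA]) auto
    have "A - {a} = (C - {a}) \<union> (A - C)"
      using a perm_cycle_subset[OF C] by auto
    then have "(\<Sum>b\<in>A - {a}. g a b) = (\<Sum>b\<in>C - {a}. g a b) + (\<Sum>b\<in>A - C. g a b)"
      using finite_perm_cycle[OF C] fin by (simp add: sum.union_disjoint[of "C - {a}" "A - C"] Int_Diff disjoint_iff)
    then show "(\<Sum>b\<in>A - {a}. g a b) = (\<Sum>k=1..<card C. L C k) + (\<Sum>D\<in>perm_cycles A f - {C}. of_nat (card D) * J C D)"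
      using other same by simp
  qed
  also have "\<dots> = (\<Sum>C\<in>K. (\<Sum>D\<in>K - {C}. of_nat (card C) * of_nat (card D) * J C D) + of_nat (card C) * (\<Sum>k=1..<card C. L C k))"
    by (intro sum.cong refl) (simp add: distrib_left sum_distrib_left mult_ac)
  finally show ?thesis by (simp only: sum.distrib)
qed

text \<open>Induction on the length with A and f arbitrary, since the two sides of a split list live
  on smaller sets. In the base case the empty list connects a nonempty set only if it is a
  singleton, where f is the identity and all counts are 1.\<close>

lemma counted_upto_finite_perm:
  assumes "finite_perm A f" "A \<noteq> {}"
  shows "counted_upto r A f"
  using assms
proof (induction r arbitrary: A f)
  case 0
  interpret finite_perm A f by fact
  have cards: "card A \<ge> 1" "card (perm_cycles A f) \<ge> 1"
    using 0 fin card_perm_cycles_pos by (auto simp: Suc_le_eq card_gt_0_iff)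
  have sing: "f = id \<and> card A = 1 \<and> card (perm_cycles A f) = 1 \<and> pair_factorizations A f 0 = {[]}
      \<and> factorization_weight (perm_cycles A f) = 1" if A: "A = {x}" for x
  proof -
    have f: "f = id"
      using perm A by simp
    have "perm_cycles A f = {{x}}"
      by (simp add: perm_cycles_def A f orbit_eq_singleton_iff)
    moreover have "connects {x} []"
      by (auto simp: connects_def)
    ultimately show ?thesis
      using f by (auto simp: pair_factorizations_def A factorization_weight_def cycle_weight_1)
  qed
  have "card A + card (perm_cycles A f) \<le> 2" if ne: "pair_factorizations A f 0 \<noteq> {}"
  proof -
    obtain x where "x \<in> A" using 0 by blast
    have "connects A []"
      using ne by (auto simp: pair_factorizations_def)
    then have "A = {x}"
      using connectsD[of A "[]" "{x}"] \<open>x \<in> A\<close> by (auto simp: closed_under_def)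
    from sing[OF this] show ?thesis by linarith
  qed
  moreover have "of_nat (card (pair_factorizations A f 0)) = factorization_weight (perm_cycles A f)"
    if "card A + card (perm_cycles A f) = 2"
  proof -
    have "card A = 1" using that cards by linarith
    then obtain x where "A = {x}" by (auto simp: card_1_singleton_iff)
    from sing[OF this] show ?thesis by (metis One_nat_def card.empty card.insert empty_iff finite.emptyI of_nat_1)
  qed
  ultimately show ?case by (auto simp: counted_upto_def numeral_2_eq_2)
next
  case (Suc r)
  interpret finite_perm A f by fact
  define K where "K = perm_cycles A f"
  have "card A + card K \<le> Suc r + 2" if ne: "pair_factorizations A f (Suc r) \<noteq> {}"
  proof -
    have "card (pair_factorizations A f (Suc r)) \<noteq> 0"
      using ne finite_pair_factorizations[OF fin] by simp
    then obtain p where "p \<in> ordered_pairs A"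
        "(case p of (a, b) \<Rightarrow> card (pair_factorizations_after A (a, b) (Transposition.transpose a b \<circ> f) r)) \<noteq> 0"
      unfolding card_pair_factorizations_Suc[OF fin perm] by (rule sum.not_neutral_contains_not_neutral)
    then obtain a b where "(a, b) \<in> ordered_pairs A"
        "pair_factorizations_after A (a, b) (Transposition.transpose a b \<circ> f) r \<noteq> {}"
      by (cases p) (use card.empty in fastforce)
    then show ?thesis
      using card_le_of_pair_factorizations_after[OF finite_perm_axioms _ _ _ _ Suc.IH, of a b] unfolding K_def
      by (auto simp: ordered_pairs_def)
  qed
  moreover have "of_nat (card (pair_factorizations A f (Suc r))) = 2 ^ Suc r * fact (Suc r) * factorization_weight K"
    if r: "card A + card K = Suc r + 2"
  proof -
    let ?X = "\<lambda>B. of_nat (card B) :: rat"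
    define J where "J C D = cycle_weight (card C + card D) * (\<Prod>B\<in>K - {C, D}. cycle_weight (card B))
        * (of_nat (card A) ^ card K / of_nat (card A) ^ 4)" for C D
    define L where "L C k = cycle_weight k * cycle_weight (card C - k)
            * (\<Prod>B\<in>K - {C}. cycle_weight (card B))
            * (\<Sum>S\<in>Pow (K - {C}). (of_nat k + sum ?X S) ^ card S / (of_nat k + sum ?X S)\<^sup>2
                * ((of_nat (card C - k) + sum ?X (K - {C} - S)) ^ card (K - {C} - S)
                    / (of_nat (card C - k) + sum ?X (K - {C} - S))\<^sup>2))" for C k
    have card_A: "sum ?X K = of_nat (card A)"
      using sum_card_perm_cycles by (simp add: K_def flip: of_nat_sum)
    have "of_nat (card (pair_factorizations A f (Suc r)))
       = (\<Sum>(a, b)\<in>ordered_pairs A. of_nat (card (pair_factorizations_after A (a, b) (Transposition.transpose a b \<circ> f) r)) :: rat)"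
      unfolding card_pair_factorizations_Suc[OF fin perm] of_nat_sum by (intro sum.cong) auto
    also have "\<dots> = (\<Sum>C\<in>K. \<Sum>D\<in>K - {C}. ?X C * ?X D * (2 ^ r * fact r * J C D))
      + (\<Sum>C\<in>K. ?X C * (\<Sum>k=1..<card C. 2 ^ r * fact r * L C k))"
      unfolding K_def
    proof (rule sum_ordered_pairs)
      fix a b assume "a \<in> A" "b \<in> A" "b \<notin> orbit f a"
      then show "of_nat (card (pair_factorizations_after A (a, b) (Transposition.transpose a b \<circ> f) r))
          = 2 ^ r * fact r * J (orbit f a) (orbit f b)"
        unfolding J_def K_def using r Suc.IH by (intro of_nat_card_after_join finite_perm_axioms) (auto simp: K_def)
    next
      fix a k assume "a \<in> A" "1 \<le> k" "k < card (orbit f a)"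
      then show "of_nat (card (pair_factorizations_after A (a, (f ^^ k) a) (Transposition.transpose a ((f ^^ k) a) \<circ> f) r))
          = 2 ^ r * fact r * L (orbit f a) k"
        unfolding L_def K_def using r Suc.IH by (intro of_nat_card_after_cut finite_perm_axioms) (auto simp: K_def)
    qed
    also have "\<dots> = 2 ^ r * fact r * ((\<Sum>C\<in>K. \<Sum>D\<in>K - {C}. ?X C * ?X D * J C D)
      + (\<Sum>C\<in>K. ?X C * (\<Sum>k=1..<card C. L C k)))"
      by (simp only: distrib_left sum_distrib_left mult.left_commute[of _ "2 ^ r * fact r"])
    also have "(\<Sum>C\<in>K. \<Sum>D\<in>K - {C}. ?X C * ?X D * J C D) + (\<Sum>C\<in>K. ?X C * (\<Sum>k=1..<card C. L C k))
       = 2 * (of_nat (card A) + of_nat (card K) - 2) * (of_nat (card A) ^ card K / of_nat (card A) ^ 3)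
          * (\<Prod>B\<in>K. cycle_weight (card B))"
      unfolding J_def L_def card_A[symmetric]
      using finite_perm_cycles card_perm_cycle Suc.prems by (intro join_cut_identity) (auto simp: K_def perm_cycles_def)
    \<comment> \<open>The recurrence contributes the factor 2 (N + l - 2) = 2 (r + 1), which raises
      2^r r! to its value for r + 1.\<close>
    also have "of_nat (card A) + of_nat (card K) - 2 = (of_nat (Suc r) :: rat)"
      using r by (simp flip: of_nat_add)
    also have "2 ^ r * fact r * (2 * of_nat (Suc r) * (of_nat (card A) ^ card K / of_nat (card A) ^ 3)
          * (\<Prod>B\<in>K. cycle_weight (card B))) = 2 ^ Suc r * fact (Suc r) * factorization_weight K"
      using sum_card_perm_cycles by (simp add: factorization_weight_def K_def mult_ac)
    finally show ?thesis .
  qed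
  ultimately show ?case
    using Suc.IH[OF Suc.prems] unfolding counted_upto_def K_def by (auto simp: le_Suc_eq)
qed

section \<open>From pairs of points back to transpositions and cycle types\<close>

definition pair_transpose :: "'a \<times> 'a \<Rightarrow> 'a \<Rightarrow> 'a" where
  "pair_transpose p = Transposition.transpose (fst p) (snd p)"

lemma pair_prod_conv_foldr: "pair_prod ps = foldr (\<circ>) (map pair_transpose ps) id"
  by (induction ps rule: pair_prod.induct) (auto simp: pair_transpose_def)

lemma transpositions_conv: "transpositions n = pair_transpose ` ordered_pairs {1..n}"
  by (force simp: transpositions_def ordered_pairs_def pair_transpose_def)

lemma card_pair_transpose_fibre:
  assumes "t \<in> pair_transpose ` ordered_pairs A"
  shows "card {p \<in> ordered_pairs A. pair_transpose p = t} = 2"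
proof -
  from assms obtain i j where ij: "i \<in> A" "j \<in> A" "i \<noteq> j" and t: "t = Transposition.transpose i j"
    by (auto simp: ordered_pairs_def pair_transpose_def)
  have *: "(a, b) = (i, j) \<or> (a, b) = (j, i)"
    if "a \<noteq> b" "Transposition.transpose a b = Transposition.transpose i j" for a b
    using that ij(3) by (metis transpose_apply_first transpose_apply_other)
  then have "{p \<in> ordered_pairs A. pair_transpose p = t} = {(i, j), (j, i)}"
    unfolding t
  proof (intro equalityI subsetI)
    fix p assume "p \<in> {p \<in> ordered_pairs A. pair_transpose p = Transposition.transpose i j}"
    then show "p \<in> {(i, j), (j, i)}"
      using *[of "fst p" "snd p"] by (auto simp: ordered_pairs_def pair_transpose_def)
  qed (use ij in \<open>auto simp: ordered_pairs_def pair_transpose_def transpose_commute\<close>)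
  then show ?thesis using ij by simp
qed

text \<open>With c = 2 this is the factor by which lists of pairs overcount lists of
  transpositions.\<close>

lemma card_list_fibre:
  assumes "finite P" "\<And>t. t \<in> h ` P \<Longrightarrow> card {p \<in> P. h p = t} = c" "set ts \<subseteq> h ` P"
  shows "card {ps. set ps \<subseteq> P \<and> map h ps = ts} = c ^ length ts"
  using assms(3)
proof (induction ts)
  case Nil
  then show ?case by (simp add: conj_commute cong: conj_cong)
next
  case (Cons t ts)
  have "{ps. set ps \<subseteq> P \<and> map h ps = t # ts}
      = (\<lambda>(p, ps). p # ps) ` ({p \<in> P. h p = t} \<times> {ps. set ps \<subseteq> P \<and> map h ps = ts})"
    by (auto simp: map_eq_Cons_conv image_iff)
  also have "card \<dots> = card ({p \<in> P. h p = t} \<times> {ps. set ps \<subseteq> P \<and> map h ps = ts})"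
    by (rule card_image) (auto simp: inj_on_def)
  finally show ?case
    using Cons assms(2)[of t] by (simp add: card_cartesian_product)
qed

text \<open>If the graph is connected, the group orbit of a point is a nonempty closed set and hence
  everything. Conversely each generator preserves a closed set, so the group does; inverses add
  nothing because transpositions are involutions.\<close>

lemma generates_transitive_iff_connects:
  assumes ps: "set ps \<subseteq> ordered_pairs {1..n}"
  shows "generates_transitive n (map pair_transpose ps) \<longleftrightarrow> connects {1..n} ps"
proof
  let ?G = "generate (sym_group n) (set (map pair_transpose ps))"
  have carrier: "t permutes {1..n}" if "t \<in> set (map pair_transpose ps)" for t
    using that ps by (auto simp: ordered_pairs_def pair_transpose_def intro!: permutes_swap_id)
  have inv: "inv\<^bsub>sym_group n\<^esub> t = t" if t: "t \<in> set (map pair_transpose ps)" for t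
    using carrier[OF t] t by (auto simp: sym_group_inv_equality sym_group_carrier pair_transpose_def)
  {
    assume conn: "connects {1..n} ps"
    have G: "g permutes {1..n}" if "g \<in> ?G" for g
      using that
    proof induction
      case (eng h1 h2)
      then show ?case
        unfolding sym_group_mult by (intro permutes_compose)
    qed (use permutes_id carrier inv in \<open>simp_all only: sym_group_one\<close>)
    show "generates_transitive n (map pair_transpose ps)"
      unfolding generates_transitive_def
    proof (intro ballI)
      fix i j assume i: "i \<in> {1..n}" and j: "j \<in> {1..n}"
      define B where "B = (\<lambda>g. g i) ` ?G"
      have step: "pair_transpose p y \<in> B" if p: "p \<in> set ps" and y: "y \<in> B" for p y
      proof -
        obtain g where "g \<in> ?G" "y = g i" using y unfolding B_def by blast
        moreover have "pair_transpose p \<in> ?G"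
          using p by (intro generate.incl) auto
        ultimately have "pair_transpose p \<circ> g \<in> ?G"
          using generate.eng[of "pair_transpose p" "sym_group n" _ g] by (simp add: sym_group_mult)
        then show ?thesis
          unfolding B_def \<open>y = g i\<close> by (metis comp_apply imageI)
      qed
      have "B = {1..n}"
      proof (rule connectsD[OF conn])
        show "B \<subseteq> {1..n}"
          using G i by (auto simp: B_def permutes_in_image simp del: atLeastAtMost_iff)
        show "B \<noteq> {}"
          using generate.one by (auto simp: B_def)
        show "closed_under ps B"
          unfolding closed_under_def
        proof clarify
          fix a b assume "(a, b) \<in> set ps"
          from step[OF this, of a] step[OF this, of b] show "a \<in> B \<longleftrightarrow> b \<in> B"
            by (auto simp: pair_transpose_def)
        qed
      qed
      with j have "j \<in> B" by simp
      then obtain g where "g \<in> ?G" "j = g i"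
        unfolding B_def by blast
      then show "\<exists>g\<in>?G. g i = j" by blast
    qed
  }
  {
    assume trans: "generates_transitive n (map pair_transpose ps)"
    show "connects {1..n} ps"
      unfolding connects_def
    proof (intro allI impI)
      fix B assume B: "B \<subseteq> {1..n}" "B \<noteq> {}" "closed_under ps B"
      have step: "t x \<in> B \<longleftrightarrow> x \<in> B" if t: "t \<in> set (map pair_transpose ps)" for t x
      proof -
        obtain a b where "(a, b) \<in> set ps" "t = Transposition.transpose a b"
          using t by (auto simp: pair_transpose_def)
        then show ?thesis
          using closed_underD[OF B(3)] by (auto simp: Transposition.transpose_def)
      qed
      have G: "\<forall>x. g x \<in> B \<longleftrightarrow> x \<in> B" if "g \<in> ?G" for g
        using that
        by induction (auto simp: sym_group_one sym_group_mult inv step simp del: set_map)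
      obtain i where i: "i \<in> B" using B by blast
      have "j \<in> B" if j: "j \<in> {1..n}" for j
      proof -
        obtain g where "g \<in> ?G" "g i = j"
          using trans j i B(1) unfolding generates_transitive_def by blast
        then show ?thesis using G i by blast
      qed
      then show "B = {1..n}" using B(1) by blast
    qed
  }
qed

definition cycle_mset :: "'a set \<Rightarrow> ('a \<Rightarrow> 'a) \<Rightarrow> nat multiset" where
  "cycle_mset A f = image_mset card (mset_set (perm_cycles A f))"

lemma cycle_type_conv: "cycle_type n f = cycle_mset {1..n} f"
  by (simp add: cycle_type_def cycle_mset_def perm_cycles_def)

text \<open>\<open>factorization_weight\<close> depends on the cycle lengths only; as a function of
  \<alpha> it can stand in a series over partitions.\<close>

definition mset_weight :: "nat multiset \<Rightarrow> rat" where
  "mset_weight \<alpha> = of_nat (sum_mset \<alpha>) ^ size \<alpha> / of_nat (sum_mset \<alpha>) ^ 3 * (\<Prod>i\<in>#\<alpha>. cycle_weight i)"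

lemma mset_weight_image_mset_set:
  "mset_weight (image_mset card (mset_set K)) = factorization_weight K"
proof (cases "finite K")
  case True
  then show ?thesis
    by (simp add: mset_weight_def factorization_weight_def sum_unfold_sum_mset prod_unfold_prod_mset image_mset.compositionality comp_def)
qed (simp add: mset_weight_def factorization_weight_def)

context finite_perm
begin

lemma mset_weight_cycle_mset: "mset_weight (cycle_mset A f) = factorization_weight (perm_cycles A f)"
  by (simp add: cycle_mset_def mset_weight_image_mset_set)

lemma size_cycle_mset: "size (cycle_mset A f) = card (perm_cycles A f)"
  by (simp add: cycle_mset_def)

lemma sum_mset_cycle_mset: "sum_mset (cycle_mset A f) = card A"
  using sum_card_perm_cycles by (simp add: cycle_mset_def sum_unfold_sum_mset)

lemma cycle_mset_pos: "0 \<notin># cycle_mset A f"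
  using card_perm_cycle finite_perm_cycles by (force simp: cycle_mset_def)

end

text \<open>The Goulden--Jackson formula; the overcount 2^r cancels against the power of 2 in
  \<open>counted_upto\<close>. The right-hand side depends on the class of f only.\<close>

lemma card_min_trans_factorizations:
  assumes n: "n \<ge> 1" and f: "f \<in> conj_class n \<alpha>"
  shows "of_nat (card (min_trans_factorizations n \<alpha> f)) = fact (n + size \<alpha> - 2) * mset_weight \<alpha>"
proof -
  define r where "r = n + size \<alpha> - 2"
  interpret finite_perm "{1..n}" f
    using f by unfold_locales (auto simp: conj_class_def)
  have \<alpha>: "\<alpha> = cycle_mset {1..n} f"
    using f by (simp add: conj_class_def cycle_type_conv)
  have r: "n + card (perm_cycles {1..n} f) = r + 2"
    using n card_perm_cycles_pos unfolding r_def \<alpha> size_cycle_mset by auto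
  have eq: "pair_factorizations {1..n} f r
      = (\<Union>ts\<in>min_trans_factorizations n \<alpha> f. {ps. set ps \<subseteq> ordered_pairs {1..n} \<and> map pair_transpose ps = ts})"
    unfolding pair_factorizations_def min_trans_factorizations_def r_def
    by (auto simp: generates_transitive_iff_connects transpositions_conv pair_prod_conv_foldr intro!: imageI)
  have fin_ts: "finite (min_trans_factorizations n \<alpha> f)"
    by (rule finite_subset[OF _ finite_lists_length_eq[of "transpositions n" r]])
      (auto simp: min_trans_factorizations_def r_def transpositions_conv finite_ordered_pairs)
  have fin_ps: "finite {ps. set ps \<subseteq> ordered_pairs {1..n} \<and> map pair_transpose ps = ts}" for ts
    by (rule finite_subset[OF _ finite_lists_length_eq[OF finite_ordered_pairs[of "{1..n}"], of "length ts"]]) auto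
  have "card (pair_factorizations {1..n} f r)
      = (\<Sum>ts\<in>min_trans_factorizations n \<alpha> f. card {ps. set ps \<subseteq> ordered_pairs {1..n} \<and> map pair_transpose ps = ts})"
    unfolding eq using fin_ts fin_ps by (intro card_UN_disjoint) auto
  also have "\<dots> = (\<Sum>ts\<in>min_trans_factorizations n \<alpha> f. 2 ^ r)"
  proof (rule sum.cong[OF refl])
    fix ts assume "ts \<in> min_trans_factorizations n \<alpha> f"
    then show "card {ps. set ps \<subseteq> ordered_pairs {1..n} \<and> map pair_transpose ps = ts} = 2 ^ r"
      using card_list_fibre[OF finite_ordered_pairs[of "{1..n}"] card_pair_transpose_fibre, of ts]
      by (simp add: min_trans_factorizations_def transpositions_conv r_def)
  qed
  finally have "card (pair_factorizations {1..n} f r) = card (min_trans_factorizations n \<alpha> f) * 2 ^ r"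
    by simp
  moreover have "of_nat (card (pair_factorizations {1..n} f r)) = 2 ^ r * fact r * factorization_weight (perm_cycles {1..n} f)"
    using counted_upto_finite_perm[OF finite_perm_axioms, of r] n r by (simp add: counted_upto_def)
  moreover have "mset_weight \<alpha> = factorization_weight (perm_cycles {1..n} f)"
    unfolding \<alpha> by (rule mset_weight_cycle_mset)
  ultimately show ?thesis
    by (simp add: r_def)
qed

subsection \<open>The generating series\<close>

definition const_fps :: "rat \<Rightarrow> p_poly fps" where
  "const_fps c = fps_const (p_const c)"

lemma const_fps_0 [simp]: "const_fps 0 = 0"
  by (simp add: const_fps_def p_const_def)

lemma const_fps_1 [simp]: "const_fps 1 = 1"
  by (simp add: const_fps_def p_const_def single_one)

lemma const_fps_add: "const_fps (a + b) = const_fps a + const_fps b"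
  by (simp add: const_fps_def p_const_def single_add)

lemma const_fps_diff: "const_fps (a - b) = const_fps a - const_fps b"
  using const_fps_add[of "a - b" b] by simp

lemma const_fps_mult: "const_fps (a * b) = const_fps a * const_fps b"
  by (simp add: const_fps_def p_const_def mult_single)

lemma const_fps_of_nat: "const_fps (of_nat n) = of_nat n"
  by (induction n) (simp_all add: const_fps_add)

lemma const_fps_sum: "const_fps (sum f S) = (\<Sum>x\<in>S. const_fps (f x))"
  by (induction S rule: infinite_finite_induct) (simp_all add: const_fps_add)

text \<open>Coefficients of z^n are compared after multiplication by n!, which is invertible over
  the rationals.\<close>

lemma const_fps_cancel:
  assumes "c \<noteq> 0" "const_fps c * F = const_fps c * G"
  shows "F = G"
proof -
  have "const_fps (1 / c) * (const_fps c * H) = H" for H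
    using assms(1) by (simp add: mult.assoc[symmetric] const_fps_mult[symmetric])
  then show ?thesis using assms(2) by metis
qed

definition cycle_monom :: "nat multiset \<Rightarrow> p_poly fps" where
  "cycle_monom \<alpha> = fps_const (p_prod \<alpha>) * fps_X ^ size \<alpha>"

lemma cycle_monom_add: "cycle_monom (\<alpha> + \<beta>) = cycle_monom \<alpha> * cycle_monom \<beta>"
proof -
  have "fps_const (p_prod (\<alpha> + \<beta>)) = fps_const (p_prod \<alpha>) * fps_const (p_prod \<beta>)"
    by (simp add: p_prod_def)
  then show ?thesis
    by (simp add: cycle_monom_def power_add mult_ac)
qed

text \<open>One operator serves both variables: on the outer series it is \<open>z_D\<close>, on
  each coefficient \<open>u_D\<close>.\<close>

definition euler_op :: "'a::comm_semiring_1 fps \<Rightarrow> 'a fps" where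
  "euler_op F = fps_X * fps_deriv F"

lemma euler_op_nth: "fps_nth (euler_op F) n = of_nat n * fps_nth F n"
  by (cases n) (simp_all add: euler_op_def)

lemma euler_op_sum: "euler_op (sum f S) = (\<Sum>x\<in>S. euler_op (f x))" for f :: "_ \<Rightarrow> 'a::comm_ring_1 fps"
  by (simp add: fps_eq_iff euler_op_nth fps_sum_nth sum_distrib_left)

lemma euler_op_const_mult: "euler_op (fps_const c * F) = fps_const c * euler_op F"
  for F :: "'a::comm_ring_1 fps"
  by (simp add: fps_eq_iff euler_op_nth mult_ac)

lemma euler_op_cycle_monom: "euler_op (cycle_monom \<alpha>) = of_nat (size \<alpha>) * cycle_monom \<alpha>"
proof (rule fps_ext)
  fix n
  show "fps_nth (euler_op (cycle_monom \<alpha>)) n = fps_nth (of_nat (size \<alpha>) * cycle_monom \<alpha>) n"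
    by (simp add: euler_op_nth cycle_monom_def fps_X_power_nth fps_of_nat[symmetric])
qed

text \<open>Summing over permutations instead of partitions absorbs the class sizes, and products become
  sums over invariant subsets.\<close>

definition perm_sum :: "'a set \<Rightarrow> p_poly fps" where
  "perm_sum A = (\<Sum>f | f permutes A. const_fps (factorization_weight (perm_cycles A f)) * cycle_monom (cycle_mset A f))"

text \<open>Conjugation by h carries permutations of A to permutations of B and each cycle to one of
  the same size.\<close>

lemma perm_sum_bij_betw:
  assumes "finite A" "bij_betw h A B"
  shows "perm_sum A = perm_sum B"
proof -
  define c where "c f y = (if y \<in> B then h (f (inv_into A h y)) else y)" for f y
  have fin: "finite B"
    using assms bij_betw_finite by blast
  have inj: "inj_on h A" and B: "B = h ` A"
    using assms(2) by (auto simp: bij_betw_def)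
  have c_bij: "bij_betw c {f. f permutes A} {f. f permutes B}"
    unfolding c_def[abs_def] by (rule bij_betw_permutations[OF assms(2)])
  have "cycle_mset B (c f) = cycle_mset A f" if f: "f permutes A" for f
  proof -
    interpret finite_perm A f
      using assms f by unfold_locales
    have "orbit (c f) (h x) = h ` orbit f x" if x: "x \<in> A" for x
    proof (rule orbit_inverse[OF self_in_orbit, symmetric])
      fix y assume "y \<in> orbit f x"
      then have "y \<in> A" using orbit_subset_A[OF x] by blast
      then show "c f (h y) = h (f y)"
        using inj by (simp add: c_def B)
    qed
    then have "perm_cycles B (c f) = image h ` perm_cycles A f"
      by (auto simp: perm_cycles_def B image_iff)
    moreover have "inj_on (image h) (perm_cycles A f)"
      by (rule inj_on_subset[OF inj_on_image_Pow[OF inj]]) (use perm_cycle_subset in auto)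
    ultimately have "cycle_mset B (c f) = image_mset card (image_mset (image h) (mset_set (perm_cycles A f)))"
      by (simp add: cycle_mset_def image_mset_mset_set)
    also have "\<dots> = image_mset card (mset_set (perm_cycles A f))"
      unfolding image_mset.compositionality
    proof (rule image_mset_cong)
      fix C assume "C \<in># mset_set (perm_cycles A f)"
      then have "C \<subseteq> A"
        using finite_perm_cycles perm_cycle_subset by simp
      then show "(card \<circ> image h) C = card C"
        using inj by (simp add: card_image inj_on_subset)
    qed
    finally show ?thesis by (simp add: cycle_mset_def)
  qed
  then have "perm_sum A = (\<Sum>f | f permutes A. const_fps (mset_weight (cycle_mset B (c f))) * cycle_monom (cycle_mset B (c f)))"
    unfolding perm_sum_def by (intro sum.cong) (simp_all add: cycle_mset_def mset_weight_image_mset_set)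
  also have "\<dots> = (\<Sum>g | g permutes B. const_fps (mset_weight (cycle_mset B g)) * cycle_monom (cycle_mset B g))"
    by (rule sum.reindex_bij_betw[OF c_bij])
  also have "\<dots> = perm_sum B"
    unfolding perm_sum_def by (intro sum.cong) (simp_all add: cycle_mset_def mset_weight_image_mset_set)
  finally show ?thesis .
qed

lemma perm_sum_card:
  assumes "finite A"
  shows "perm_sum A = perm_sum {1..card A}"
proof -
  obtain h where "bij_betw h A {1..card A}"
    using ex_bij_betw_finite_nat[OF assms] bij_betw_iff_card[OF assms, of "{1..card A}"] by auto
  then show ?thesis by (rule perm_sum_bij_betw[OF assms])
qed

text \<open>A permutation with an invariant set B is the same as a permutation of B and one of A -
  B: compose the two in one direction, restrict in the other.\<close>

lemma sum_permutes_decompose: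
  assumes "finite A"
  shows "(\<Sum>B\<in>Pow A. \<Sum>g | g permutes B. \<Sum>h | h permutes (A - B). F B g h)
    = (\<Sum>f | f permutes A. \<Sum>B | B \<subseteq> A \<and> f ` B \<subseteq> B. F B (perm_restrict f B) (perm_restrict f (A - B)))"
proof -
  have fin: "finite {g. g permutes B}" if "B \<subseteq> A" for B
    using finite_permutations finite_subset[OF that assms] by blast
  have fin_inv: "finite {B. B \<subseteq> A \<and> f ` B \<subseteq> B}" for f :: "'a \<Rightarrow> 'a"
    by (rule finite_subset[of _ "Pow A"]) (use assms in auto)
  have "(\<Sum>B\<in>Pow A. \<Sum>g | g permutes B. \<Sum>h | h permutes (A - B). F B g h)
     = (\<Sum>(B, g, h)\<in>(SIGMA B:Pow A. {g. g permutes B} \<times> {h. h permutes (A - B)}). F B g h)"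
    using assms fin by (subst sum.Sigma[symmetric]) (auto simp: sum.cartesian_product intro!: sum.cong)
  also have "\<dots> = (\<Sum>(f, B)\<in>(SIGMA f:{f. f permutes A}. {B. B \<subseteq> A \<and> f ` B \<subseteq> B}).
      F B (perm_restrict f B) (perm_restrict f (A - B)))"
  proof (rule sum.reindex_bij_witness[of _ "\<lambda>(f, B). (B, perm_restrict f B, perm_restrict f (A - B))" "\<lambda>(B, g, h). (g \<circ> h, B)"])
    fix x assume "x \<in> (SIGMA B:Pow A. {g. g permutes B} \<times> {h. h permutes (A - B)})"
    then obtain B g h where x: "x = (B, g, h)" "B \<subseteq> A" "g permutes B" "h permutes (A - B)"
      by auto
    note r = perm_restrict_comp_disjoint[OF x(3,4) Diff_disjoint]
    have "g \<circ> h permutes A"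
      using x by (intro permutes_compose) (auto intro: permutes_subset)
    then show "(case (case x of (B, g, h) \<Rightarrow> (g \<circ> h, B)) of (f, B) \<Rightarrow> (B, perm_restrict f B, perm_restrict f (A - B))) = x"
      and "(case x of (B, g, h) \<Rightarrow> (g \<circ> h, B)) \<in> (SIGMA f:{f. f permutes A}. {B. B \<subseteq> A \<and> f ` B \<subseteq> B})"
      and "(case case x of (B, g, h) \<Rightarrow> (g \<circ> h, B) of (f, B) \<Rightarrow> F B (perm_restrict f B) (perm_restrict f (A - B)))
          = (case x of (B, g, h) \<Rightarrow> F B g h)"
      using r x by auto
  next
    fix y assume "y \<in> (SIGMA f:{f. f permutes A}. {B. B \<subseteq> A \<and> f ` B \<subseteq> B})"
    then obtain f B where y: "y = (f, B)" "f permutes A" "B \<subseteq> A" "f ` B \<subseteq> B"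
      by auto
    interpret finite_perm A f
      using assms y by unfold_locales
    show "(case case y of (f, B) \<Rightarrow> (B, perm_restrict f B, perm_restrict f (A - B)) of (B, g, h) \<Rightarrow> (g \<circ> h, B)) = y"
      and "(case y of (f, B) \<Rightarrow> (B, perm_restrict f B, perm_restrict f (A - B)))
          \<in> (SIGMA B:Pow A. {g. g permutes B} \<times> {h. h permutes (A - B)})"
      using y perm_restrict_compose[OF y(3,4)] finite_perm.perm[OF finite_perm_restrict(1)[OF y(3,4)]]
        finite_perm.perm[OF finite_perm_restrict(2)[OF y(3,4)]] by auto
  qed
  also have "\<dots> = (\<Sum>f | f permutes A. \<Sum>B | B \<subseteq> A \<and> f ` B \<subseteq> B. F B (perm_restrict f B) (perm_restrict f (A - B)))"
    using finite_permutations[OF assms] fin_inv by (subst sum.Sigma) auto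
  finally show ?thesis .
qed

text \<open>The effect of two Euler derivatives in z: N^(l-3) becomes N^(l-1), the exponent of
  \<open>Cayley_split_identity\<close>. For N = 0 both sides are 0.\<close>

lemma factorization_weight_square:
  "of_nat (sum card K) ^ 2 * factorization_weight K
    = of_nat (sum card K) ^ card K / of_nat (sum card K) * (\<Prod>C\<in>K. cycle_weight (card C))"
  by (cases "of_nat (sum card K) = (0::rat)") (simp_all add: factorization_weight_def power2_eq_square power3_eq_cube)

text \<open>The product of the cycle weights is the same for every splitting and factors out. The
  remaining powers sum to 2 (l - 1) N^(l-2), and one factor N taken out of N^(l-2) restores the
  weight of K. Summands with an empty part are 0.\<close>

lemma factorization_weight_convolution:
  assumes "finite K" "\<And>C. C \<in> K \<Longrightarrow> card C \<ge> 1"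
  shows "(\<Sum>S\<in>Pow K. (of_nat (sum card S) ^ 2 * factorization_weight S)
             * (of_nat (sum card (K - S)) ^ 2 * factorization_weight (K - S)))
       = 2 * (of_nat (card K) - 1) * of_nat (sum card K) * factorization_weight K"
proof -
  let ?X = "\<lambda>C. of_nat (card C) :: rat" and ?P = "\<Prod>C\<in>K. cycle_weight (card C)"
  have "(\<Sum>S\<in>Pow K. (of_nat (sum card S) ^ 2 * factorization_weight S)
             * (of_nat (sum card (K - S)) ^ 2 * factorization_weight (K - S)))
     = (\<Sum>S\<in>Pow K. sum ?X S ^ card S / sum ?X S * (sum ?X (K - S) ^ card (K - S) / sum ?X (K - S)) * ?P)"
  proof (rule sum.cong[OF refl])
    fix S assume "S \<in> Pow K"
    then have "?P = (\<Prod>C\<in>S. cycle_weight (card C)) * (\<Prod>C\<in>K - S. cycle_weight (card C))"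
      using prod.subset_diff[of S K "\<lambda>C. cycle_weight (card C)"] assms(1) by (simp add: mult.commute)
    then show "(of_nat (sum card S) ^ 2 * factorization_weight S)
             * (of_nat (sum card (K - S)) ^ 2 * factorization_weight (K - S))
      = sum ?X S ^ card S / sum ?X S * (sum ?X (K - S) ^ card (K - S) / sum ?X (K - S)) * ?P"
      unfolding factorization_weight_square unfolding of_nat_sum by (simp only: mult_ac)
  qed
  also have "\<dots> = 2 * (of_nat (card K) - 1) * (sum ?X K ^ card K / (sum ?X K)\<^sup>2) * ?P"
    unfolding sum_distrib_right[symmetric] using assms
    by (subst Cayley_split_identity) (auto simp: Suc_le_eq)
  also have "sum ?X K ^ card K / (sum ?X K)\<^sup>2 = of_nat (sum card K) * (of_nat (sum card K) ^ card K / of_nat (sum card K) ^ 3)"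
    by (cases "sum ?X K = 0") (simp_all add: power2_eq_square power3_eq_cube)
  finally show ?thesis
    by (simp add: factorization_weight_def)
qed

lemma (in finite_perm) cycle_mset_split:
  assumes "S \<subseteq> perm_cycles A f"
  shows "cycle_mset (\<Union>S) (perm_restrict f (\<Union>S)) + cycle_mset (A - \<Union>S) (perm_restrict f (A - \<Union>S)) = cycle_mset A f"
proof -
  have fin: "finite S"
    using assms finite_perm_cycles finite_subset by blast
  have "mset_set S + mset_set (perm_cycles A f - S) = mset_set (S \<union> (perm_cycles A f - S))"
    using fin finite_perm_cycles by (intro mset_set_Union[symmetric]) auto
  also have "S \<union> (perm_cycles A f - S) = perm_cycles A f"
    using assms by blast
  finally show ?thesis
    unfolding cycle_mset_def perm_cycles_Union[OF assms] perm_cycles_Diff_Union[OF assms]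
    by (simp flip: image_mset_union)
qed

text \<open>The binomial coefficient chooses the labels B. Permutations of B and of its complement
  are glued to one permutation f leaving B invariant, so B is a union of cycles of f. The monomials
  multiply to that of f whatever B is, and the weights sum by
  \<open>factorization_weight_convolution\<close>.\<close>

lemma perm_sum_convolution:
  "(\<Sum>i\<le>n. of_nat (n choose i) * ((of_nat i ^ 2 * perm_sum {1..i}) * (of_nat (n - i) ^ 2 * perm_sum {1..n - i})))
   = (\<Sum>f | f permutes {1..n}. const_fps (2 * (of_nat (size (cycle_mset {1..n} f)) - 1) * of_nat n
        * factorization_weight (perm_cycles {1..n} f)) * cycle_monom (cycle_mset {1..n} f))"
proof -
  let ?A = "{1..n}"
  let ?w = "\<lambda>B g. of_nat (card B) ^ 2 * factorization_weight (perm_cycles B g) :: rat"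
  let ?v = "\<lambda>B g. const_fps (?w B g) * cycle_monom (cycle_mset B g)"
  have w: "const_fps (of_nat m ^ 2 * c) = of_nat m ^ 2 * const_fps c" for m c
    by (simp add: const_fps_mult const_fps_of_nat power2_eq_square)
  have perm_sum: "of_nat (card B) ^ 2 * perm_sum B = (\<Sum>g | g permutes B. ?v B g)" for B :: "nat set"
    unfolding perm_sum_def sum_distrib_left w by (simp only: mult.assoc)
  have "(\<Sum>i\<le>n. of_nat (n choose i) * ((of_nat i ^ 2 * perm_sum {1..i}) * (of_nat (n - i) ^ 2 * perm_sum {1..n - i})))
     = (\<Sum>B\<in>Pow ?A. (of_nat (card B) ^ 2 * perm_sum {1..card B}) * (of_nat (n - card B) ^ 2 * perm_sum {1..n - card B}))"
    using sum_Pow_card[of ?A "\<lambda>i. (of_nat i ^ 2 * perm_sum {1..i}) * (of_nat (n - i) ^ 2 * perm_sum {1..n - i})"]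
    by simp
  also have "\<dots> = (\<Sum>B\<in>Pow ?A. \<Sum>g | g permutes B. \<Sum>h | h permutes (?A - B). ?v B g * ?v (?A - B) h)"
  proof (rule sum.cong[OF refl])
    fix B assume B: "B \<in> Pow ?A"
    then have fin: "finite B" "finite (?A - B)" and c: "n - card B = card (?A - B)"
      using finite_subset[of B ?A] by (auto simp: card_Diff_subset)
    show "(of_nat (card B) ^ 2 * perm_sum {1..card B}) * (of_nat (n - card B) ^ 2 * perm_sum {1..n - card B})
      = (\<Sum>g | g permutes B. \<Sum>h | h permutes (?A - B). ?v B g * ?v (?A - B) h)"
      unfolding c perm_sum_card[OF fin(1), symmetric] perm_sum_card[OF fin(2), symmetric] perm_sum
      by (rule sum_product)
  qed
  also have "\<dots> = (\<Sum>f | f permutes ?A. \<Sum>B | B \<subseteq> ?A \<and> f ` B \<subseteq> B.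
      ?v B (perm_restrict f B) * ?v (?A - B) (perm_restrict f (?A - B)))"
    by (rule sum_permutes_decompose) simp
  also have "\<dots> = (\<Sum>f | f permutes ?A. const_fps (2 * (of_nat (size (cycle_mset ?A f)) - 1) * of_nat n
        * factorization_weight (perm_cycles ?A f)) * cycle_monom (cycle_mset ?A f))"
  proof (rule sum.cong[OF refl])
    fix f assume "f \<in> {f. f permutes ?A}"
    then interpret finite_perm ?A f
      by unfold_locales auto
    let ?K = "perm_cycles ?A f"
    let ?c = "\<lambda>S. of_nat (sum card S) ^ 2 * factorization_weight S :: rat"
    have "(\<Sum>B | B \<subseteq> ?A \<and> f ` B \<subseteq> B. ?v B (perm_restrict f B) * ?v (?A - B) (perm_restrict f (?A - B)))
      = (\<Sum>S\<in>Pow ?K. ?v (\<Union>S) (perm_restrict f (\<Union>S)) * ?v (?A - \<Union>S) (perm_restrict f (?A - \<Union>S)))"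
      by (rule sum.reindex_bij_betw[OF bij_betw_Union_cycles, symmetric])
    also have "\<dots> = (\<Sum>S\<in>Pow ?K. const_fps (?c S * ?c (?K - S)) * cycle_monom (cycle_mset ?A f))"
    proof (rule sum.cong[OF refl])
      fix S assume "S \<in> Pow ?K"
      then have S: "S \<subseteq> ?K" by simp
      have c: "card (\<Union>S) = sum card S" "card (?A - \<Union>S) = sum card (?K - S)"
        using finite_perm.sum_card_perm_cycles[OF finite_perm_restrict(1)[OF Union_cycles_invariant[OF S]]]
          finite_perm.sum_card_perm_cycles[OF finite_perm_restrict(2)[OF Union_cycles_invariant[OF S]]]
        unfolding perm_cycles_Union[OF S] perm_cycles_Diff_Union[OF S] by simp_all
      show "?v (\<Union>S) (perm_restrict f (\<Union>S)) * ?v (?A - \<Union>S) (perm_restrict f (?A - \<Union>S))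
        = const_fps (?c S * ?c (?K - S)) * cycle_monom (cycle_mset ?A f)"
        unfolding cycle_mset_split[OF S, symmetric] cycle_monom_add const_fps_mult[of "?c S"]
          perm_cycles_Union[OF S] perm_cycles_Diff_Union[OF S] c by (simp only: mult_ac)
    qed
    also have "\<dots> = const_fps (\<Sum>S\<in>Pow ?K. ?c S * ?c (?K - S)) * cycle_monom (cycle_mset ?A f)"
      by (simp only: const_fps_sum sum_distrib_right)
    also have "(\<Sum>S\<in>Pow ?K. ?c S * ?c (?K - S))
        = 2 * (of_nat (size (cycle_mset ?A f)) - 1) * of_nat n * factorization_weight ?K"
      using factorization_weight_convolution[OF finite_perm_cycles card_perm_cycle]
      unfolding sum_card_perm_cycles size_cycle_mset by simp
    finally show "(\<Sum>B | B \<subseteq> ?A \<and> f ` B \<subseteq> B. ?v B (perm_restrict f B) * ?v (?A - B) (perm_restrict f (?A - B)))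
      = const_fps (2 * (of_nat (size (cycle_mset ?A f)) - 1) * of_nat n
        * factorization_weight ?K) * cycle_monom (cycle_mset ?A f)" .
  qed
  finally show ?thesis .
qed


text \<open>A permutation with l cycles and weight w contributes n l w - (1/2) 2 (l - 1) n w = n w;
  the factor 1/2 undoes the orientation of the distinguished edge.\<close>

lemma perm_sum_identity:
  "of_nat n * perm_sum {1..n} = of_nat n * euler_op (perm_sum {1..n}) - const_fps (1 / 2) *
     (\<Sum>i\<le>n. of_nat (n choose i) * ((of_nat i ^ 2 * perm_sum {1..i}) * (of_nat (n - i) ^ 2 * perm_sum {1..n - i})))"
proof -
  let ?m = "\<lambda>f. cycle_mset {1..n} f" and ?w = "\<lambda>f. factorization_weight (perm_cycles {1..n} f)"
  have "euler_op (perm_sum {1..n})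
      = (\<Sum>f | f permutes {1..n}. const_fps (of_nat (size (?m f)) * ?w f) * cycle_monom (?m f))"
  proof -
    have "euler_op (const_fps c * cycle_monom \<alpha>) = const_fps (of_nat (size \<alpha>) * c) * cycle_monom \<alpha>" for c \<alpha>
      unfolding const_fps_mult const_fps_of_nat unfolding const_fps_def euler_op_const_mult euler_op_cycle_monom
      by (simp only: mult_ac)
    then show ?thesis
      unfolding perm_sum_def euler_op_sum by simp
  qed
  then have "of_nat n * euler_op (perm_sum {1..n}) - const_fps (1 / 2) *
     (\<Sum>i\<le>n. of_nat (n choose i) * ((of_nat i ^ 2 * perm_sum {1..i}) * (of_nat (n - i) ^ 2 * perm_sum {1..n - i})))
    = (\<Sum>f | f permutes {1..n}. of_nat n * (const_fps (of_nat (size (?m f)) * ?w f) * cycle_monom (?m f))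
        - const_fps (1 / 2) * (const_fps (2 * (of_nat (size (?m f)) - 1) * of_nat n * ?w f) * cycle_monom (?m f)))"
    unfolding perm_sum_convolution sum_subtractf sum_distrib_left[symmetric] by simp
  also have "\<dots> = (\<Sum>f | f permutes {1..n}. of_nat n * (const_fps (?w f) * cycle_monom (?m f)))"
  proof (rule sum.cong[OF refl])
    fix f
    have "of_nat n * (of_nat (size (?m f)) * ?w f) - 1 / 2 * (2 * (of_nat (size (?m f)) - 1) * of_nat n * ?w f)
        = of_nat n * ?w f"
      by (simp add: algebra_simps)
    then show "of_nat n * (const_fps (of_nat (size (?m f)) * ?w f) * cycle_monom (?m f))
        - const_fps (1 / 2) * (const_fps (2 * (of_nat (size (?m f)) - 1) * of_nat n * ?w f) * cycle_monom (?m f))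
      = of_nat n * (const_fps (?w f) * cycle_monom (?m f))"
      unfolding mult.assoc[symmetric] const_fps_of_nat[symmetric]
      by (simp only: const_fps_mult[symmetric] const_fps_diff[symmetric] left_diff_distrib[symmetric] mult.assoc)
  qed
  finally show ?thesis
    by (simp only: perm_sum_def sum_distrib_left)
qed

text \<open>All permutations in a class have the same summand, so a sum over partitions weighted by
  class sizes is a sum over permutations; the factorials in the definition cancel against n! and the
  count.\<close>

lemma fps_nth_H_series:
  assumes \<pi>: "\<And>n \<alpha>. n \<ge> 1 \<Longrightarrow> \<alpha> \<in> partitions_of n \<Longrightarrow> \<pi> n \<alpha> \<in> conj_class n \<alpha>"
  defines "H \<equiv> \<lambda>n \<alpha>. card (min_trans_factorizations n \<alpha> (\<pi> n \<alpha>))"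
  shows "const_fps (fact n) * fps_nth (H_series H) n = perm_sum {1..n}"
proof (cases "n = 0")
  case True
  \<comment> \<open>The series has constant coefficient 0, and so has the other side: the only
    permutation of the empty set has weight 0 by 1 / 0 = 0.\<close>
  then show ?thesis
    by (simp add: H_series_def perm_sum_def perm_cycles_def factorization_weight_def)
next
  case False
  then have n: "n \<ge> 1" by simp
  let ?P = "{f. f permutes {1..n}}"
  let ?t = "\<lambda>\<alpha>. const_fps (mset_weight \<alpha>) * cycle_monom \<alpha>"
  have conj: "conj_class n \<alpha> = {f. f \<in> ?P \<and> cycle_mset {1..n} f = \<alpha>}" for \<alpha>
    by (simp add: conj_class_def cycle_type_conv)
  have finP: "finite ?P"
    by (simp add: finite_permutations)
  \<comment> \<open>Every partition of n is a cycle type because \<pi> supplies a permutation of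
    that type.\<close>
  have parts: "partitions_of n = cycle_mset {1..n} ` ?P"
  proof (intro equalityI subsetI)
    fix \<alpha> assume "\<alpha> \<in> partitions_of n"
    then have "\<pi> n \<alpha> \<in> ?P" "cycle_mset {1..n} (\<pi> n \<alpha>) = \<alpha>"
      using \<pi>[OF n, of \<alpha>] unfolding conj by auto
    then show "\<alpha> \<in> cycle_mset {1..n} ` ?P"
      by (metis imageI)
  next
    fix \<alpha> assume "\<alpha> \<in> cycle_mset {1..n} ` ?P"
    then obtain f where f: "f permutes {1..n}" "\<alpha> = cycle_mset {1..n} f" by blast
    interpret finite_perm "{1..n}" f
      using f by unfold_locales auto
    show "\<alpha> \<in> partitions_of n"
      using cycle_mset_pos sum_mset_cycle_mset f by (simp add: partitions_of_def)
  qed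
  have "const_fps (fact n) * fps_nth (H_series H) n
      = (\<Sum>\<alpha>\<in>partitions_of n. of_nat (card (conj_class n \<alpha>)) * ?t \<alpha>)"
    using False unfolding H_series_def fps_nth_Abs_fps if_not_P[OF False] sum_distrib_left
  proof (intro sum.cong refl)
    fix \<alpha> assume "\<alpha> \<in> partitions_of n"
    then have H: "of_nat (H n \<alpha>) = fact (n + size \<alpha> - 2) * mset_weight \<alpha>"
      unfolding H_def by (intro card_min_trans_factorizations n \<pi>)
    have split: "fps_const (p_const c * p_prod \<alpha>) * fps_X ^ size \<alpha> = const_fps c * cycle_monom \<alpha>" for c
      by (simp add: const_fps_def cycle_monom_def mult.assoc[symmetric])
    have "const_fps (fact n) * (fps_const (p_const (of_nat (H n \<alpha>) * (1 / fact n) *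
            (of_nat (card (conj_class n \<alpha>)) / fact (n + size \<alpha> - 2))) * p_prod \<alpha>) * fps_X ^ size \<alpha>)
        = const_fps (fact n * (of_nat (H n \<alpha>) * (1 / fact n) *
            (of_nat (card (conj_class n \<alpha>)) / fact (n + size \<alpha> - 2)))) * cycle_monom \<alpha>"
      unfolding split const_fps_mult[of "fact n"] by (simp only: mult.assoc)
    also have "fact n * (of_nat (H n \<alpha>) * (1 / fact n) *
            (of_nat (card (conj_class n \<alpha>)) / fact (n + size \<alpha> - 2))) = of_nat (card (conj_class n \<alpha>)) * mset_weight \<alpha>"
      unfolding H by simp
    finally show "const_fps (fact n) * (fps_const (p_const (of_nat (H n \<alpha>) * (1 / fact n) *
            (of_nat (card (conj_class n \<alpha>)) / fact (n + size \<alpha> - 2))) * p_prod \<alpha>) * fps_X ^ size \<alpha>)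
        = of_nat (card (conj_class n \<alpha>)) * ?t \<alpha>"
      by (simp only: const_fps_mult const_fps_of_nat mult.assoc)
  qed
  also have "\<dots> = (\<Sum>\<alpha>\<in>partitions_of n. \<Sum>f | f \<in> ?P \<and> cycle_mset {1..n} f = \<alpha>. ?t (cycle_mset {1..n} f))"
    unfolding conj by (intro sum.cong refl) simp
  also have "\<dots> = (\<Sum>f\<in>?P. ?t (cycle_mset {1..n} f))"
    unfolding parts by (intro sum.group finP finite_imageI) simp
  also have "\<dots> = perm_sum {1..n}"
    unfolding perm_sum_def by (intro sum.cong refl) (simp add: cycle_mset_def mset_weight_image_mset_set)
  finally show ?thesis .
qed

theorem theorem6:
  fixes \<pi> :: "nat \<Rightarrow> nat multiset \<Rightarrow> nat \<Rightarrow> nat"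
    and H :: "nat \<Rightarrow> nat multiset \<Rightarrow> nat"
    and Hhat :: zup_series
  assumes "\<And>n \<alpha>. n \<ge> 1 \<Longrightarrow> \<alpha> \<in> partitions_of n \<Longrightarrow> \<pi> n \<alpha> \<in> conj_class n \<alpha>"
  defines "H \<equiv> \<lambda>n \<alpha>. card (min_trans_factorizations n \<alpha> (\<pi> n \<alpha>))"
    and "Hhat \<equiv> H_series H"
  shows "z_D Hhat = z_D (u_D Hhat) - zup_const (1 / 2) * (z_D (z_D Hhat))\<^sup>2"
proof (rule fps_ext)
  fix n
  let ?F = "fps_nth Hhat" and ?c = "\<lambda>n. const_fps (fact n)"
  have F: "?c m * ?F m = perm_sum {1..m}" for m
    unfolding Hhat_def H_def by (rule fps_nth_H_series[OF assms(1)])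
  have zD: "fps_nth (z_D G) m = of_nat m * fps_nth G m" for G m
    unfolding z_D_def euler_op_def[symmetric] by (rule euler_op_nth)
  have uD: "fps_nth (u_D Hhat) m = euler_op (?F m)" for m
    by (simp add: u_D_def euler_op_def)
  have sq: "fps_nth ((z_D (z_D Hhat))\<^sup>2) n = (\<Sum>i\<le>n. (of_nat i ^ 2 * ?F i) * (of_nat (n - i) ^ 2 * ?F (n - i)))"
    unfolding power2_eq_square fps_mult_nth zD atMost_atLeast0 by (simp only: mult.assoc)
  have const: "fps_nth (zup_const c * G) m = const_fps c * fps_nth G m" for c G m
    by (simp add: zup_const_def const_fps_def)
  \<comment> \<open>Splitting n! as i! (n - i)! (n choose i) turns the product of ordinary series
    into the binomial convolution of the scaled coefficients.\<close>
  have conv: "?c n * (\<Sum>i\<le>n. (of_nat i ^ 2 * ?F i) * (of_nat (n - i) ^ 2 * ?F (n - i)))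
    = (\<Sum>i\<le>n. of_nat (n choose i) * ((of_nat i ^ 2 * perm_sum {1..i}) * (of_nat (n - i) ^ 2 * perm_sum {1..n - i})))"
    unfolding sum_distrib_left
  proof (rule sum.cong[OF refl])
    fix i assume "i \<in> {..n}"
    then have "fact n = (fact i * fact (n - i) * of_nat (n choose i) :: rat)"
      by (simp add: binomial_fact)
    then have c: "?c n = of_nat (n choose i) * (?c i * ?c (n - i))"
      by (simp add: const_fps_mult const_fps_of_nat mult_ac)
    show "?c n * ((of_nat i ^ 2 * ?F i) * (of_nat (n - i) ^ 2 * ?F (n - i)))
      = of_nat (n choose i) * ((of_nat i ^ 2 * perm_sum {1..i}) * (of_nat (n - i) ^ 2 * perm_sum {1..n - i}))"
      unfolding F[symmetric] c by (simp only: mult_ac)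
  qed
  have euler: "?c n * euler_op (?F n) = euler_op (perm_sum {1..n})"
    unfolding F[symmetric] const_fps_def by (rule euler_op_const_mult[symmetric])
  have "?c n * (of_nat n * ?F n) = of_nat n * perm_sum {1..n}"
    unfolding F[symmetric] by (rule mult.left_commute)
  also have "\<dots> = of_nat n * (?c n * euler_op (?F n)) - const_fps (1 / 2) *
      (?c n * (\<Sum>i\<le>n. (of_nat i ^ 2 * ?F i) * (of_nat (n - i) ^ 2 * ?F (n - i))))"
    unfolding conv euler by (rule perm_sum_identity)
  also have "\<dots> = ?c n * (of_nat n * euler_op (?F n) - const_fps (1 / 2) *
      (\<Sum>i\<le>n. (of_nat i ^ 2 * ?F i) * (of_nat (n - i) ^ 2 * ?F (n - i))))"
    by (simp only: right_diff_distrib mult.left_commute[of "?c n"])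
  finally show "fps_nth (z_D Hhat) n = fps_nth (z_D (u_D Hhat) - zup_const (1 / 2) * (z_D (z_D Hhat))\<^sup>2) n"
    unfolding fps_sub_nth const sq zD uD by (rule const_fps_cancel[rotated]) simp
qed

end
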